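(* Let $r,t$ be positive integers. There is a constant $\beta=\beta(r,t)$ such that the following holds. Let $G$ be an $n$-vertex graph with $e(G)\geq \beta n^{\frac{4t}{2t+1}+\frac{1}{r}}$ edges, where $n^{(2t+1)/r}>12t\ln(r^2 n)$ and $n>t!$. Then $G$ contains a subgraph $G^*$ with $d(G^* )\geq 2t+1$, $\mathrm{rad}(G^* )\leq r+1$ and $n(G^* )\leq r(4t^2+2t)$.
   Context: $n(H)$, $e(H)$, $d(H)=2e(H)/n(H)$ and $\mathrm{rad}(H)$ denote the number of vertices, number of edges, average degree and radius of a graph $H$. *)

theory Defs
  imports "Graph_Theory.Graph_Theory"
begin

text \<open>
  Finite simple graphs are the library's \<^locale>\<open>pair_graph\<close>s: finite, loop-free, symmetric digraphs
  whose arcs are pairs of vertices. Each undirected edge is represented by two opposite arcs, so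
  edges are counted as the unordered pairs underlying the arcs.
\<close>

definition num_verts :: "'a pair_pre_digraph \<Rightarrow> nat" where
  "num_verts H = card (pverts H)"

definition num_edges :: "'a pair_pre_digraph \<Rightarrow> nat" where
  "num_edges H = card {{u, v} | u v. (u, v) \<in> parcs H}"

definition avg_degree :: "'a pair_pre_digraph \<Rightarrow> real" where
  "avg_degree H = 2 * real (num_edges H) / real (num_verts H)"

text \<open>
  The library's shortest-path function with unit weights is the usual graph distance; its value is
  infinite if there is no walk. Hence a finite radius entails connectedness.
\<close>

definition graph_dist :: "'a pair_pre_digraph \<Rightarrow> 'a \<Rightarrow> 'a \<Rightarrow> ereal" where
  "graph_dist H u v = wf_digraph.\<mu> (with_proj H) (\<lambda>_. 1) u v"

definition eccentricity :: "'a pair_pre_digraph \<Rightarrow> 'a \<Rightarrow> ereal" where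
  "eccentricity H u = (SUP v\<in>pverts H. graph_dist H u v)"

definition radius :: "'a pair_pre_digraph \<Rightarrow> ereal" where
  "radius H = (INF u\<in>pverts H. eccentricity H u)"

end

theory Submission
  imports Defs
begin

text \<open>
  Put \<open>s = 2t + 1\<close>. In a bipartite subgraph of large minimum degree, either some \<open>t + 1\<close> vertices have
  \<open>s(t + 1)\<close> common neighbours, which already gives a biclique of average degree \<open>s\<close>, or \<open>r > s(t + 1)\<close>.
  In the latter case fix a \<open>t\<close>-set \<open>A\<close> with many common neighbours \<open>P\<close> and fix \<open>ts - 1\<close> points of \<open>P\<close>.
  From a point \<open>p\<close> of \<open>P\<close> one moves to a hub, that is, a \<open>t\<close>-set \<open>B\<close> joined by paths \<open>p' - y - B\<close> to
  \<open>p\<close> and to the fixed points, with \<open>y\<close> adjacent to all of \<open>B\<close>; from a hub one moves along such a path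
  to another point of \<open>P\<close>. The vertices and edges added by a move are in the exact proportion
  \<open>2 : s\<close>, and a move with some but not all of its new vertices already present gains at least half an edge. Double counting gives
  so many moves at every position that the walks of a suitable length, of order \<open>r\<close>, outnumber the
  points of \<open>P\<close>. So either at some stage many moves meet the old vertices, or \<open>2st + 1\<close> walks from one
  point end in a common point; in both cases \<open>2st\<close> gains of one half compensate for the initial
  deficit \<open>st\<close> of the biclique on \<open>A\<close> and the starting points. As every point of \<open>P\<close> is adjacent to all
  of \<open>A\<close>, each vertex has distance at most 3 from a fixed vertex of \<open>A\<close>.
\<close>

section \<open>Growing subgraphs by balanced steps\<close>

text \<open>The numbers come from the balance. A hub with \<open>k\<close> links costs
  \<open>t + k\<close> vertices and brings \<open>k * t + k\<close> edges, which is the ratio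
  \<open>s / 2\<close> exactly for \<open>k = t * s\<close>. All but one of the links must end in
  vertices that cost nothing, and a pigeonhole over their ends is what fixes
  \<open>t * s - 1\<close> points. Leaving a hub costs two vertices and brings
  \<open>t + t + 1 = s\<close> edges. The balance also governs the counting: for \<open>d\<close> of
  order \<open>n ^ (1 - 2/s + 1/r)\<close> a point has at least about
  \<open>n ^ (t * s * (t + 1) / r)\<close> continuations and a hub at least about
  \<open>n ^ (s / r)\<close>. Both exponents come from the term \<open>1/r\<close> alone, so a
  number of rounds proportional to \<open>r\<close> outnumbers \<open>P\<close>. The obstacle is
  that different walks may overlap in uncontrolled ways. No attempt is made to describe the
  overlaps: only the excess is tracked, and a walk leading to a vertex set already reached either
  gains or lies entirely in what has been built. The latter is rare, because the number of walks
  inside a vertex set of bounded size is bounded independently of \<open>n\<close>.\<close>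

text \<open>Twice the surplus of edges over those needed for average degree \<open>s\<close>; \<open>H\<close> is a set of
  edges, its vertices being the elements of \<open>\<Union>H\<close>.\<close>

definition excess :: "nat \<Rightarrow> 'v set set \<Rightarrow> int" where
  "excess s H = 2 * int (card H) - int s * int (card (\<Union>H))"

lemma excess_Un:
  assumes "finite H" "finite (\<Union>H)" "finite K" "finite (\<Union>K)"
  shows "excess s (H \<union> K) = excess s H + 2 * int (card (K - H)) - int s * int (card (\<Union>K - \<Union>H))"
proof -
  have "H \<union> K = H \<union> (K - H)" by blast
  then have 1: "card (H \<union> K) = card H + card (K - H)"
    using assms card_Un_disjoint[of H "K - H"] by auto
  have "\<Union>(H \<union> K) = \<Union>H \<union> (\<Union>K - \<Union>H)" by blast
  then have 2: "card (\<Union>(H \<union> K)) = card (\<Union>H) + card (\<Union>K - \<Union>H)"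
    using assms card_Un_disjoint[of "\<Union>H" "\<Union>K - \<Union>H"] by auto
  show ?thesis unfolding excess_def 1 2 by (simp add: algebra_simps)
qed

text \<open>A step \<open>k\<close> leaving the state \<open>st\<close> adds the edges \<open>ed st k\<close>; its vertices outside \<open>new st k\<close>
  belong to the root graph \<open>R\<close> or to the anchor of \<open>st\<close>. The balance conditions say that a step never
  decreases the excess, and increases it when some but not all of its new vertices are already present.
  \<open>Good\<close> and \<open>att\<close> carry an arbitrary invariant along.\<close>

locale growth =
  fixes s G c l :: nat
    and Good :: "'v set set \<Rightarrow> bool"
    and att :: "'st \<Rightarrow> 'v set set \<Rightarrow> bool"
    and R :: "'v set set"
    and s0 :: 'st
    and S :: "nat \<Rightarrow> 'st set"
    and Out :: "'st \<Rightarrow> 'k set"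
    and ed :: "'st \<Rightarrow> 'k \<Rightarrow> 'v set set"
    and new :: "'st \<Rightarrow> 'k \<Rightarrow> 'v set"
    and nxt :: "'st \<Rightarrow> 'k \<Rightarrow> 'st"
    and anc :: "'st \<Rightarrow> 'v set"
    and D nu :: "nat \<Rightarrow> nat"
  assumes finR: "finite R" "finite (\<Union>R)"
    and start: "s0 \<in> S 0" "anc s0 \<subseteq> \<Union>R" "Good R" "att s0 R"
    and nxt_S: "st \<in> S i \<Longrightarrow> k \<in> Out st \<Longrightarrow> nxt st k \<in> S (Suc i)"
    and fin_Out: "st \<in> S i \<Longrightarrow> finite (Out st)"
    and fin_ed: "st \<in> S i \<Longrightarrow> k \<in> Out st \<Longrightarrow> finite (ed st k)"
      "st \<in> S i \<Longrightarrow> k \<in> Out st \<Longrightarrow> finite (\<Union>(ed st k))"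
    and Un_ed: "st \<in> S i \<Longrightarrow> k \<in> Out st \<Longrightarrow> \<Union>(ed st k) \<subseteq> new st k \<union> anc st \<union> \<Union>R"
    and new_ed: "st \<in> S i \<Longrightarrow> k \<in> Out st \<Longrightarrow> new st k \<subseteq> \<Union>(ed st k)"
    and anc_ed: "st \<in> S i \<Longrightarrow> k \<in> Out st \<Longrightarrow> anc st \<subseteq> \<Union>(ed st k)"
    and anc_nxt: "st \<in> S i \<Longrightarrow> k \<in> Out st \<Longrightarrow> anc (nxt st k) \<subseteq> new st k"
    and anc_ne: "st \<in> S i \<Longrightarrow> anc st \<noteq> {}"
    and ed_new: "st \<in> S i \<Longrightarrow> k \<in> Out st \<Longrightarrow> e \<in> ed st k \<Longrightarrow> e \<inter> new st k \<noteq> {}"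
    and balanced: "st \<in> S i \<Longrightarrow> k \<in> Out st \<Longrightarrow> N \<subseteq> new st k \<Longrightarrow>
          s * card N \<le> 2 * card {e \<in> ed st k. e \<inter> N \<noteq> {}}"
    and strictly_balanced: "st \<in> S i \<Longrightarrow> k \<in> Out st \<Longrightarrow> N \<subset> new st k \<Longrightarrow> N \<noteq> {} \<Longrightarrow>
          s * card N < 2 * card {e \<in> ed st k. e \<inter> N \<noteq> {}}"
    and card_new: "st \<in> S i \<Longrightarrow> k \<in> Out st \<Longrightarrow> card (new st k) \<le> nu i"
    and nu_pos: "0 < nu i"
    and few_inside: "st \<in> S i \<Longrightarrow> finite Z \<Longrightarrow> card Z \<le> card (\<Union>R) + (G + 1) * sum nu {..<l} \<Longrightarrow>
          card {k \<in> Out st. new st k \<subseteq> Z} \<le> c"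
    and many_Out: "st \<in> S i \<Longrightarrow> D i + c \<le> card (Out st)"
    and att_mono: "att st H \<Longrightarrow> H \<subseteq> H' \<Longrightarrow> att st H'"
    and Good_step: "st \<in> S i \<Longrightarrow> k \<in> Out st \<Longrightarrow> R \<subseteq> H \<Longrightarrow> anc st \<subseteq> \<Union>H \<Longrightarrow> Good H \<Longrightarrow> att st H \<Longrightarrow>
          Good (H \<union> ed st k) \<and> att (nxt st k) (H \<union> ed st k)"
begin

section \<open>Effect of steps and walks on the excess\<close>

definition ready :: "'st \<Rightarrow> 'v set set \<Rightarrow> bool" where
  "ready st H \<longleftrightarrow> finite H \<and> finite (\<Union>H) \<and> R \<subseteq> H \<and> anc st \<subseteq> \<Union>H \<and> Good H \<and> att st H"

lemma ready_start: "ready s0 R"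
  using finR start by (auto simp: ready_def)

lemma ready_Un:
  assumes "ready st H" "st \<in> S i" "k \<in> Out st"
  shows "ready (nxt st k) (H \<union> ed st k)"
proof -
  have "Good (H \<union> ed st k) \<and> att (nxt st k) (H \<union> ed st k)"
    using assms Good_step unfolding ready_def by blast
  moreover have "anc (nxt st k) \<subseteq> \<Union>(H \<union> ed st k)"
    using anc_nxt[OF assms(2,3)] new_ed[OF assms(2,3)] by auto
  ultimately show ?thesis using assms(1) fin_ed[OF assms(2,3)] unfolding ready_def by auto
qed

lemma new_part:
  assumes "ready st H" "st \<in> S i" "k \<in> Out st"
  shows "\<Union>(ed st k) - \<Union>H = new st k - \<Union>H"
  using Un_ed[OF assms(2,3)] new_ed[OF assms(2,3)] assms(1) unfolding ready_def by blast

lemma finite_new: "st \<in> S i \<Longrightarrow> k \<in> Out st \<Longrightarrow> finite (new st k)"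
  using new_ed fin_ed finite_subset by metis

text \<open>Every edge of the step that touches a vertex outside \<open>\<Union>H\<close> is missing
  from \<open>H\<close>, so the balance condition for the set \<open>N\<close> of missing vertices
  bounds the number of added edges from below. If a new vertex is already present, \<open>N\<close>
  is a proper subset: either it is nonempty and strict balance applies, or no vertex is added but an
  edge is.\<close>

lemma excess_step:
  assumes "ready st H" "st \<in> S i" "k \<in> Out st"
  shows "excess s H \<le> excess s (H \<union> ed st k)"
    and "new st k \<inter> \<Union>H \<noteq> {} \<Longrightarrow> \<not> ed st k \<subseteq> H \<Longrightarrow> excess s H + 1 \<le> excess s (H \<union> ed st k)"
proof -
  define N where "N = new st k - \<Union>H"
  have ex: "excess s (H \<union> ed st k) =
      excess s H + 2 * int (card (ed st k - H)) - int s * int (card N)"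
    using excess_Un[of H "ed st k" s] assms fin_ed[OF assms(2,3)] new_part[OF assms]
    unfolding ready_def N_def by auto
  have fin: "finite (ed st k - H)" using fin_ed[OF assms(2,3)] by auto
  have le: "card {e \<in> ed st k. e \<inter> N \<noteq> {}} \<le> card (ed st k - H)"
    by (rule card_mono[OF fin]) (auto simp: N_def)
  have N: "N \<subseteq> new st k" unfolding N_def by auto
  have b: "s * card N \<le> 2 * card (ed st k - H)"
    using balanced[OF assms(2,3) N] le by linarith
  show "excess s H \<le> excess s (H \<union> ed st k)"
    unfolding ex using b by (metis (no_types, opaque_lifting) diff_add_eq diff_ge_0_iff_ge le_add_same_cancel1 of_nat_le_iff of_nat_mult of_nat_numeral add_diff_eq)
  assume meet: "new st k \<inter> \<Union>H \<noteq> {}" and nin: "\<not> ed st k \<subseteq> H"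
  have "s * card N < 2 * card (ed st k - H)"
  proof (cases "N = {}")
    case True
    have "ed st k - H \<noteq> {}" using nin by auto
    then have "card (ed st k - H) > 0" using fin by (simp add: card_gt_0_iff)
    then show ?thesis using True by simp
  next
    case False
    have "N \<subset> new st k" using meet unfolding N_def by blast
    then show ?thesis using strictly_balanced[OF assms(2,3) _ False] le by fastforce
  qed
  then have "int (s * card N) < int (2 * card (ed st k - H))" by (simp only: of_nat_less_iff)
  then show "excess s H + 1 \<le> excess s (H \<union> ed st k)"
    unfolding ex by simp
qed

text \<open>The single vertex saved by a step that meets \<open>H\<close> is recorded because the
  savings of all \<open>G\<close> gains together enter the final size bound.\<close>

lemma card_step:
  assumes "ready st H" "st \<in> S i" "k \<in> Out st"
  shows "card (\<Union>(H \<union> ed st k)) \<le> card (\<Union>H) + nu i"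
    and "new st k \<inter> \<Union>H \<noteq> {} \<Longrightarrow> card (\<Union>(H \<union> ed st k)) \<le> card (\<Union>H) + nu i - 1"
proof -
  have eq: "\<Union>(H \<union> ed st k) = \<Union>H \<union> (new st k - \<Union>H)"
    using new_part[OF assms] by blast
  have fin: "finite (new st k)" by (rule finite_new[OF assms(2,3)])
  have le: "card (\<Union>(H \<union> ed st k)) \<le> card (\<Union>H) + card (new st k - \<Union>H)"
    unfolding eq by (rule card_Un_le)
  have "card (new st k - \<Union>H) \<le> card (new st k)" by (rule card_mono[OF fin]) auto
  then show "card (\<Union>(H \<union> ed st k)) \<le> card (\<Union>H) + nu i"
    using le card_new[OF assms(2,3)] by linarith
  assume "new st k \<inter> \<Union>H \<noteq> {}"
  then have "card (new st k - \<Union>H) < card (new st k)"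
    by (intro psubset_card_mono[OF fin]) auto
  then show "card (\<Union>(H \<union> ed st k)) \<le> card (\<Union>H) + nu i - 1"
    using le card_new[OF assms(2,3)] by linarith
qed

fun walk :: "'st \<Rightarrow> 'k list \<Rightarrow> bool" where
  "walk st [] \<longleftrightarrow> True"
| "walk st (k # ks) \<longleftrightarrow> k \<in> Out st \<and> walk (nxt st k) ks"

fun edges :: "'st \<Rightarrow> 'k list \<Rightarrow> 'v set set" where
  "edges st [] = {}"
| "edges st (k # ks) = ed st k \<union> edges (nxt st k) ks"

fun final :: "'st \<Rightarrow> 'k list \<Rightarrow> 'st" where
  "final st [] = st"
| "final st (k # ks) = final (nxt st k) ks"

text \<open>The set tested against grows along the walk, so a fresh walk also avoids the vertices of
  its own earlier steps.\<close>

fun fresh :: "'v set set \<Rightarrow> 'st \<Rightarrow> 'k list \<Rightarrow> bool" where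
  "fresh H st [] \<longleftrightarrow> True"
| "fresh H st (k # ks) \<longleftrightarrow> k \<in> Out st \<and> new st k \<inter> \<Union>H = {} \<and> fresh (H \<union> ed st k) (nxt st k) ks"

lemma fresh_walk: "fresh H st ks \<Longrightarrow> walk st ks"
  by (induction ks arbitrary: H st) auto

lemma final_S: "st \<in> S i \<Longrightarrow> walk st ks \<Longrightarrow> final st ks \<in> S (i + length ks)"
proof (induction ks arbitrary: st i)
  case (Cons k ks)
  then show ?case using Cons.IH[of "nxt st k" "Suc i"] nxt_S by auto
qed auto

lemma walk_anc: "st \<in> S i \<Longrightarrow> walk st ks \<Longrightarrow> ks \<noteq> [] \<Longrightarrow> anc st \<subseteq> \<Union>(edges st ks)"
  using anc_ed[of st i] by (cases ks) auto

lemma fresh_disjoint: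
  assumes "fresh H st ks" "st \<in> S i"
  shows "edges st ks \<inter> H = {}"
  using assms
proof (induction ks arbitrary: H st i)
  case (Cons k ks)
  have "edges (nxt st k) ks \<inter> (H \<union> ed st k) = {}"
    using Cons nxt_S by (metis fresh.simps(2))
  moreover have "ed st k \<inter> H = {}"
    using Cons.prems ed_new[of st i k] by fastforce
  ultimately show ?case by auto
qed auto

lemma ready_walk:
  assumes "ready st H" "st \<in> S i" "walk st ks"
  shows "ready (final st ks) (H \<union> edges st ks) \<and> excess s H \<le> excess s (H \<union> edges st ks) \<and>
    card (\<Union>(H \<union> edges st ks)) \<le> card (\<Union>H) + sum nu {i..<i + length ks}"
  using assms
proof (induction ks arbitrary: H st i)
  case (Cons k ks)
  have r: "ready (nxt st k) (H \<union> ed st k)" "nxt st k \<in> S (Suc i)" "walk (nxt st k) ks"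
    using Cons.prems ready_Un nxt_S by auto
  have k: "k \<in> Out st" using Cons.prems by simp
  have eq: "H \<union> ed st k \<union> edges (nxt st k) ks = H \<union> edges st (k # ks)" by auto
  have "sum nu {i..<i + length (k # ks)} = nu i + sum nu {Suc i..<Suc i + length ks}"
    by (simp add: sum.atLeast_Suc_lessThan)
  then have "card (\<Union>(H \<union> edges st (k # ks))) \<le> card (\<Union>H) + sum nu {i..<i + length (k # ks)}"
    using Cons.IH[OF r] card_step(1)[OF Cons.prems(1,2) k] unfolding eq by linarith
  moreover have "ready (final st (k # ks)) (H \<union> edges st (k # ks))"
    using Cons.IH[OF r] unfolding eq by simp
  moreover have "excess s H \<le> excess s (H \<union> edges st (k # ks))"
    using Cons.IH[OF r] excess_step(1)[OF Cons.prems(1,2) k] unfolding eq by linarith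
  ultimately show ?case by blast
qed auto

text \<open>Consider the last step that still contributes a missing edge once its predecessors have
  been added. Everything after it is present, so the anchor it leads to is present as well; hence
  this step meets the old vertices and gains. \<open>H0\<close> is the smaller subgraph relative to
  which the walk is fresh. Freshness separates the edges of different steps, so later edges covered
  by \<open>H \<union> ed st k\<close> already lie in \<open>H\<close>.\<close>

lemma excess_walk:
  assumes "fresh H0 st ks" "H0 \<subseteq> H" "ready st H" "st \<in> S i"
    and "anc (final st ks) \<subseteq> \<Union>H" "\<not> edges st ks \<subseteq> H"
  shows "excess s H + 1 \<le> excess s (H \<union> edges st ks) \<and>
    card (\<Union>(H \<union> edges st ks)) \<le> card (\<Union>H) + sum nu {i..<i + length ks} - 1"
  using assms
proof (induction ks arbitrary: H0 H st i)
  case (Cons k ks)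
  have k: "k \<in> Out st" using Cons.prems by simp
  have r: "ready (nxt st k) (H \<union> ed st k)" "nxt st k \<in> S (Suc i)" 
    using Cons.prems ready_Un nxt_S by auto
  have f: "fresh (H0 \<union> ed st k) (nxt st k) ks" and sub: "H0 \<union> ed st k \<subseteq> H \<union> ed st k"
    using Cons.prems by auto
  have w: "walk (nxt st k) ks" using fresh_walk[OF f] .
  have fin: "anc (final (nxt st k) ks) \<subseteq> \<Union>(H \<union> ed st k)" using Cons.prems by auto
  have eq: "H \<union> ed st k \<union> edges (nxt st k) ks = H \<union> edges st (k # ks)" by auto
  have su: "sum nu {i..<i + length (k # ks)} = nu i + sum nu {Suc i..<Suc i + length ks}"
    by (simp add: sum.atLeast_Suc_lessThan)
  show ?case
  proof (cases "edges (nxt st k) ks \<subseteq> H \<union> ed st k")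
    case False
    have ne: "ks \<noteq> []" using False by auto
    then have "sum nu {Suc i..<Suc i + length ks} > 0"
      using nu_pos by (intro sum_pos) auto
    then show ?thesis
      using Cons.IH[OF f sub r fin False] card_step(1)[OF Cons.prems(3,4) k]
        excess_step(1)[OF Cons.prems(3,4) k] unfolding eq su by linarith
  next
    case True
    have "edges (nxt st k) ks \<inter> (H0 \<union> ed st k) = {}"
      using fresh_disjoint[OF f r(2)] .
    then have T: "edges (nxt st k) ks \<subseteq> H" using True by blast
    then have nin: "\<not> ed st k \<subseteq> H" using Cons.prems(6) by auto
    have "anc (nxt st k) \<subseteq> \<Union>H"
    proof (cases "ks = []")
      case True
      then show ?thesis using Cons.prems(5) by simp
    next
      case False
      then show ?thesis using walk_anc[OF r(2) w False] T by blast
    qed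
    then have meet: "new st k \<inter> \<Union>H \<noteq> {}"
      using anc_ne[OF r(2)] anc_nxt[OF Cons.prems(4) k] by blast
    have "H \<union> edges st (k # ks) = H \<union> ed st k" using T by auto
    moreover have "card (\<Union>(H \<union> ed st k)) \<le> card (\<Union>H) + nu i - 1"
      by (rule card_step(2)[OF Cons.prems(3,4) k meet])
    ultimately show ?thesis
      using excess_step(2)[OF Cons.prems(3,4) k meet nin] unfolding su by auto
  qed
qed auto

section \<open>Dense subgraphs from many walks\<close>

definition dense :: "'v set set \<Rightarrow> bool" where
  "dense H \<longleftrightarrow> finite H \<and> finite (\<Union>H) \<and> R \<subseteq> H \<and> Good H \<and> excess s R + int G \<le> excess s H \<and>
     card (\<Union>H) \<le> card (\<Union>R) + (G + 1) * sum nu {..<l} - G"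

text \<open>A step whose edges lie in \<open>H\<close> has its new vertices in
  \<open>\<Union>H\<close>, and each state admits at most \<open>c\<close> such steps while
  \<open>\<Union>H\<close> is small. The bound does not involve the size of the ambient graph, so
  any larger family of walks contains one that leaves \<open>H\<close>.\<close>

lemma walks_inside:
  assumes "st \<in> S i" "finite H" "finite (\<Union>H)" "card (\<Union>H) \<le> card (\<Union>R) + (G + 1) * sum nu {..<l}"
  shows "finite {ks. length ks = j \<and> walk st ks} \<and>
    card {ks. length ks = j \<and> walk st ks \<and> edges st ks \<subseteq> H} \<le> c ^ j"
  using assms
proof (induction j arbitrary: st i)
  case 0
  have "{ks. length ks = 0 \<and> walk st ks} = {[]}"
    "{ks. length ks = 0 \<and> walk st ks \<and> edges st ks \<subseteq> H} = {[]}" by auto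
  then show ?case by simp
next
  case (Suc j)
  define W where "W = (\<lambda>st. {ks. length ks = j \<and> walk st ks \<and> edges st ks \<subseteq> H})"
  define W' where "W' = (\<lambda>st. {ks. length ks = j \<and> walk st ks})"
  define K where "K = {k \<in> Out st. new st k \<subseteq> \<Union>H}"
  have K: "finite K" "card K \<le> c" unfolding K_def using fin_Out few_inside Suc.prems by auto
  have IH: "finite (W' (nxt st k))" "card (W (nxt st k)) \<le> c ^ j" if "k \<in> Out st" for k
    unfolding W_def W'_def using Suc nxt_S that by blast+
  have "{ks. length ks = Suc j \<and> walk st ks} \<subseteq> (\<Union>k\<in>Out st. (#) k ` W' (nxt st k))"
  proof
    fix ks assume "ks \<in> {ks. length ks = Suc j \<and> walk st ks}"
    then obtain k ks' where "ks = k # ks'" "length ks' = j" "walk st (k # ks')"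
      by (auto simp: length_Suc_conv)
    then show "ks \<in> (\<Union>k\<in>Out st. (#) k ` W' (nxt st k))" unfolding W'_def by auto
  qed
  then have f: "finite {ks. length ks = Suc j \<and> walk st ks}"
    by (rule finite_subset) (simp add: IH(1) fin_Out[OF Suc.prems(1)])
  have "{ks. length ks = Suc j \<and> walk st ks \<and> edges st ks \<subseteq> H} \<subseteq> (\<Union>k\<in>K. (#) k ` W (nxt st k))"
  proof
    fix ks assume "ks \<in> {ks. length ks = Suc j \<and> walk st ks \<and> edges st ks \<subseteq> H}"
    then obtain k ks' where *: "ks = k # ks'" "length ks' = j" "walk st (k # ks')" "edges st (k # ks') \<subseteq> H"
      by (auto simp: length_Suc_conv)
    then have k: "k \<in> Out st" "ed st k \<subseteq> H" by auto
    then have "k \<in> K" unfolding K_def using new_ed[OF Suc.prems(1) k(1)] by blast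
    moreover have "ks' \<in> W (nxt st k)" using * unfolding W_def by auto
    ultimately show "ks \<in> (\<Union>k\<in>K. (#) k ` W (nxt st k))" using *(1) by blast
  qed
  moreover have fW: "finite (W (nxt st k))" if "k \<in> Out st" for k
    by (rule finite_subset[OF _ IH(1)[OF that]]) (auto simp: W_def W'_def)
  ultimately have "card {ks. length ks = Suc j \<and> walk st ks \<and> edges st ks \<subseteq> H}
      \<le> card (\<Union>k\<in>K. (#) k ` W (nxt st k))"
    using K by (intro card_mono) (auto simp: K_def)
  also have "\<dots> \<le> (\<Sum>k\<in>K. card ((#) k ` W (nxt st k)))" by (rule card_UN_le[OF K(1)])
  also have "\<dots> \<le> (\<Sum>k\<in>K. c ^ j)"
  proof (rule sum_mono)
    fix k assume "k \<in> K"
    then have k: "k \<in> Out st" unfolding K_def by auto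
    show "card ((#) k ` W (nxt st k)) \<le> c ^ j"
      using card_image_le[OF fW[OF k], of "(#) k"] IH(2)[OF k] by linarith
  qed
  also have "\<dots> \<le> c ^ Suc j" using K by simp
  finally show ?case using f by blast
qed

text \<open>All these steps meet \<open>H\<close>, hence also every larger subgraph, so that adding \<open>G\<close> of them one
  after the other gains at least 1 each time.\<close>

lemma dense_of_stale_steps:
  assumes "ready st H" "st \<in> S i" "i < l" "excess s R \<le> excess s H"
    and "card (\<Union>H) \<le> card (\<Union>R) + sum nu {..<i}"
    and "c < card {k \<in> Out st. new st k \<inter> \<Union>H \<noteq> {}}"
  shows "\<exists>H. dense H"
proof -
  have "sum nu {..<Suc i} \<le> sum nu {..<l}" using assms(3) by (intro sum_mono2) auto
  then have T: "sum nu {..<i} + nu i \<le> sum nu {..<l}" by simp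
  have "\<exists>H'. ready st H' \<and> H \<subseteq> H' \<and> excess s H + int m \<le> excess s H' \<and>
      card (\<Union>H') \<le> card (\<Union>H) + m * (nu i - 1)" if "m \<le> G" for m
    using that
  proof (induction m)
    case 0
    then show ?case using assms by auto
  next
    case (Suc m)
    then obtain H' where H': "ready st H'" "H \<subseteq> H'" "excess s H + int m \<le> excess s H'"
      "card (\<Union>H') \<le> card (\<Union>H) + m * (nu i - 1)" by auto
    have "m * (nu i - 1) \<le> G * sum nu {..<l}" using Suc.prems T by (intro mult_mono) auto
    then have cH': "card (\<Union>H') \<le> card (\<Union>R) + (G + 1) * sum nu {..<l}"
      using H'(4) assms(5) T by (simp add: algebra_simps)
    have "\<exists>k \<in> Out st. new st k \<inter> \<Union>H \<noteq> {} \<and> \<not> ed st k \<subseteq> H'"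
    proof (rule ccontr)
      assume "\<not> ?thesis"
      then have "{k \<in> Out st. new st k \<inter> \<Union>H \<noteq> {}} \<subseteq> {k \<in> Out st. new st k \<subseteq> \<Union>H'}"
        using new_ed[OF assms(2)] by blast
      then have "card {k \<in> Out st. new st k \<inter> \<Union>H \<noteq> {}} \<le> card {k \<in> Out st. new st k \<subseteq> \<Union>H'}"
        using fin_Out[OF assms(2)] by (intro card_mono) auto
      also have "\<dots> \<le> c" using few_inside[OF assms(2) _ cH'] H'(1) unfolding ready_def by auto
      finally show False using assms(6) by simp
    qed
    then obtain k where k: "k \<in> Out st" "new st k \<inter> \<Union>H \<noteq> {}" "\<not> ed st k \<subseteq> H'" by blast
    have meet: "new st k \<inter> \<Union>H' \<noteq> {}" using k H'(2) by blast
    have "ready st (H' \<union> ed st k)"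
      using ready_Un[OF H'(1) assms(2) k(1)] H'(1) att_mono[of st H' "H' \<union> ed st k"]
      unfolding ready_def by auto
    moreover have "H \<subseteq> H' \<union> ed st k" using H' by auto
    moreover have "excess s H + int (Suc m) \<le> excess s (H' \<union> ed st k)"
      using excess_step(2)[OF H'(1) assms(2) k(1) meet k(3)] H'(3) by simp
    moreover have "card (\<Union>(H' \<union> ed st k)) \<le> card (\<Union>H) + Suc m * (nu i - 1)"
      using card_step(2)[OF H'(1) assms(2) k(1) meet] H'(4) nu_pos[of i] by simp
    ultimately show ?case by blast
  qed
  from this[OF order_refl] obtain H' where H': "ready st H'" "excess s H + int G \<le> excess s H'"
      "card (\<Union>H') \<le> card (\<Union>H) + G * (nu i - 1)" by blast
  have a: "G * (nu i - 1) + G = G * nu i" using nu_pos[of i] by (cases "nu i") auto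
  have b: "G * nu i \<le> G * sum nu {..<l}" using T by (intro mult_left_mono) auto
  have d: "(G + 1) * sum nu {..<l} = G * sum nu {..<l} + sum nu {..<l}" by simp
  have "card (\<Union>H') + G \<le> card (\<Union>R) + (G + 1) * sum nu {..<l}"
    unfolding d using H'(3) assms(5) T a b by linarith
  then have "dense H'" using H' assms(4) unfolding dense_def ready_def by auto
  then show ?thesis by blast
qed

text \<open>If more than \<open>c\<close> steps met the old vertices at some stage,
  \<open>dense_of_stale_steps\<close> would give a dense subgraph. So at most \<open>c\<close> steps
  are lost at each stage, and of at least \<open>D i + c\<close> steps at least \<open>D i\<close>
  are fresh.\<close>

lemma many_fresh_walks:
  assumes "\<nexists>H. dense H" "ready st H" "st \<in> S i" "i + j \<le> l" "excess s R \<le> excess s H"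
    and "card (\<Union>H) \<le> card (\<Union>R) + sum nu {..<i}"
  shows "prod D {i..<i + j} \<le> card {ks. length ks = j \<and> fresh H st ks}"
  using assms
proof (induction j arbitrary: H st i)
  case 0
  have "{ks. length ks = 0 \<and> fresh H st ks} = {[]}" by auto
  then show ?case by simp
next
  case (Suc j)
  define K where "K = {k \<in> Out st. new st k \<inter> \<Union>H = {}}"
  define W where "W = (\<lambda>k. {ks. length ks = j \<and> fresh (H \<union> ed st k) (nxt st k) ks})"
  have fO: "finite (Out st)" by (rule fin_Out[OF Suc.prems(3)])
  have "card {k \<in> Out st. new st k \<inter> \<Union>H \<noteq> {}} \<le> c"
    using dense_of_stale_steps[OF Suc.prems(2,3) _ Suc.prems(5,6)] Suc.prems(1,4) by force
  moreover have "card (Out st) = card K + card {k \<in> Out st. new st k \<inter> \<Union>H \<noteq> {}}"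
    unfolding K_def using fO by (subst card_Un_disjoint[symmetric]) (auto intro!: arg_cong[where f=card])
  ultimately have K: "D i \<le> card K" using many_Out[OF Suc.prems(3)] by linarith
  have W: "prod D {Suc i..<Suc i + j} \<le> card (W k)" if "k \<in> K" for k
  proof -
    have k: "k \<in> Out st" using that unfolding K_def by auto
    show ?thesis unfolding W_def
    proof (rule Suc.IH[OF Suc.prems(1)])
      show "ready (nxt st k) (H \<union> ed st k)" using ready_Un Suc.prems k by auto
      show "nxt st k \<in> S (Suc i)" using nxt_S Suc.prems k by auto
      show "Suc i + j \<le> l" using Suc.prems by simp
      show "excess s R \<le> excess s (H \<union> ed st k)"
        using excess_step(1)[OF Suc.prems(2,3) k] Suc.prems by simp
      show "card (\<Union>(H \<union> ed st k)) \<le> card (\<Union>R) + sum nu {..<Suc i}"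
        using card_step(1)[OF Suc.prems(2,3) k] Suc.prems by simp
    qed
  qed
  have fW: "finite (W k)" if "k \<in> K" for k
  proof (rule finite_subset)
    show "W k \<subseteq> {ks. length ks = j \<and> walk (nxt st k) ks}" unfolding W_def using fresh_walk by auto
    have "nxt st k \<in> S (Suc i)" using nxt_S Suc.prems that unfolding K_def by auto
    then show "finite {ks. length ks = j \<and> walk (nxt st k) ks}"
      using walks_inside[of "nxt st k" "Suc i" R j] finR by auto
  qed
  have "{ks. length ks = Suc j \<and> fresh H st ks} = (\<Union>k\<in>K. (#) k ` W k)"
    unfolding K_def W_def by (fastforce simp: length_Suc_conv image_iff)
  then have "card {ks. length ks = Suc j \<and> fresh H st ks} = (\<Sum>k\<in>K. card ((#) k ` W k))"
    using fO fW by (simp only:, intro card_UN_disjoint) (auto simp: K_def)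
  also have "\<dots> = (\<Sum>k\<in>K. card (W k))" by (intro sum.cong) (auto simp: card_image)
  finally have eq: "card {ks. length ks = Suc j \<and> fresh H st ks} = (\<Sum>k\<in>K. card (W k))" .
  have "prod D {i..<i + Suc j} = D i * prod D {Suc i..<Suc i + j}"
    by (simp add: prod.atLeast_Suc_lessThan)
  also have "\<dots> \<le> card K * prod D {Suc i..<Suc i + j}" using K by simp
  also have "\<dots> \<le> (\<Sum>k\<in>K. card (W k))"
    using sum_mono[of K "\<lambda>_. prod D {Suc i..<Suc i + j}", OF W] by simp
  finally show ?case unfolding eq .
qed

text \<open>A pigeonhole over \<open>S l\<close> gives more than \<open>c ^ l\<close> fresh walks
  from \<open>s0\<close> with a common end \<open>e\<close>. A subgraph of admissible size contains
  at most \<open>c ^ l\<close> of them, so another one can always be added. The first puts the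
  anchor of \<open>e\<close> in place, and each of the next \<open>G\<close> gains 1.\<close>

theorem exists_dense:
  assumes fin: "finite (S l)" and l: "0 < l" and big: "c ^ l * card (S l) < prod D {..<l}"
  shows "\<exists>H. dense H"
proof (rule ccontr)
  assume no: "\<nexists>H. dense H"
  define W where "W = {ks. length ks = l \<and> fresh R s0 ks}"
  define T where "T = sum nu {..<l}"
  have Tpos: "T > 0" unfolding T_def using l nu_pos by (intro sum_pos) auto
  have "prod D {0..<0 + l} \<le> card W" unfolding W_def
    by (rule many_fresh_walks[OF no ready_start start(1)]) auto
  then have W: "c ^ l * card (S l) < card W" using big by (simp add: lessThan_atLeast0)
  have fW: "finite W"
    using walks_inside[OF start(1) finR, of l] fresh_walk
    by (auto simp: W_def intro: finite_subset[of _ "{ks. length ks = l \<and> walk s0 ks}"])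
  have img: "final s0 ` W \<subseteq> S l" using final_S[OF start(1)] fresh_walk unfolding W_def by force
  have "\<exists>e\<in>S l. c ^ l < card {w \<in> W. final s0 w = e}"
  proof (rule ccontr)
    assume "\<not> ?thesis"
    then have le: "card {w \<in> W. final s0 w = e} \<le> c ^ l" if "e \<in> S l" for e
      using that by force
    have "W = (\<Union>e\<in>S l. {w \<in> W. final s0 w = e})" using img by auto
    then have "card W \<le> (\<Sum>e\<in>S l. card {w \<in> W. final s0 w = e})"
      using card_UN_le[OF fin, of "\<lambda>e. {w \<in> W. final s0 w = e}"] by simp
    also have "\<dots> \<le> (\<Sum>e\<in>S l. c ^ l)" by (rule sum_mono) (rule le)
    finally show False using W by (simp add: mult.commute)
  qed
  then obtain e where e: "e \<in> S l" "c ^ l < card {w \<in> W. final s0 w = e}" by blast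
  have ex: "\<exists>w\<in>W. final s0 w = e \<and> \<not> edges s0 w \<subseteq> H"
    if "finite H" "finite (\<Union>H)" "card (\<Union>H) \<le> card (\<Union>R) + (G + 1) * T" for H
  proof (rule ccontr)
    assume "\<not> ?thesis"
    then have "{w \<in> W. final s0 w = e} \<subseteq> {ks. length ks = l \<and> walk s0 ks \<and> edges s0 ks \<subseteq> H}"
      unfolding W_def using fresh_walk by blast
    moreover have "finite {ks. length ks = l \<and> walk s0 ks \<and> edges s0 ks \<subseteq> H}"
      using walks_inside[OF start(1) finR, of l] 
      by (auto intro: finite_subset[of _ "{ks. length ks = l \<and> walk s0 ks}"])
    ultimately show False
      using walks_inside[OF start(1) that[unfolded T_def], of l] e(2) card_mono
      by (meson leD le_trans)
  qed
  have "\<exists>H. ready s0 H \<and> anc e \<subseteq> \<Union>H \<and> excess s R + int m \<le> excess s H \<and>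
      card (\<Union>H) + m \<le> card (\<Union>R) + (m + 1) * T" if "m \<le> G" for m
    using that
  proof (induction m)
    case 0
    have "{w \<in> W. final s0 w = e} \<noteq> {}" using e(2) by (metis card.empty not_less_zero)
    then obtain w where w: "fresh R s0 w" "length w = l" "final s0 w = e" unfolding W_def by blast
    have "ready s0 (R \<union> edges s0 w)"
      using ready_walk[OF ready_start start(1) fresh_walk[OF w(1)]] start att_mono[of s0 R]
      unfolding ready_def by auto
    moreover have "anc e \<subseteq> \<Union>(R \<union> edges s0 w)" "excess s R \<le> excess s (R \<union> edges s0 w)"
      "card (\<Union>(R \<union> edges s0 w)) \<le> card (\<Union>R) + T"
      using ready_walk[OF ready_start start(1) fresh_walk[OF w(1)]] w
      unfolding T_def ready_def lessThan_atLeast0 by auto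
    ultimately show ?case by (intro exI[of _ "R \<union> edges s0 w"]) simp
  next
    case (Suc m)
    then obtain H where H: "ready s0 H" "anc e \<subseteq> \<Union>H" "excess s R + int m \<le> excess s H"
      "card (\<Union>H) + m \<le> card (\<Union>R) + (m + 1) * T" by auto
    have "(m + 1) * T \<le> (G + 1) * T" using Suc.prems by (intro mult_right_mono) auto
    then have "card (\<Union>H) \<le> card (\<Union>R) + (G + 1) * T" using H(4) by linarith
    then have "\<exists>w\<in>W. final s0 w = e \<and> \<not> edges s0 w \<subseteq> H"
      using H(1) unfolding ready_def by (intro ex) auto
    then obtain w where w: "fresh R s0 w" "length w = l" "final s0 w = e" "\<not> edges s0 w \<subseteq> H"
      unfolding W_def by blast
    have RH: "R \<subseteq> H" using H unfolding ready_def by auto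
    have A: "anc (final s0 w) \<subseteq> \<Union>H" using H w by auto
    have g: "excess s H + 1 \<le> excess s (H \<union> edges s0 w)"
      "card (\<Union>(H \<union> edges s0 w)) \<le> card (\<Union>H) + T - 1"
      using excess_walk[OF w(1) RH H(1) start(1) A w(4)] w(2)
      unfolding T_def lessThan_atLeast0 by auto
    have "ready s0 (H \<union> edges s0 w)"
      using ready_walk[OF H(1) start(1) fresh_walk[OF w(1)]] H(1)
        att_mono[of s0 H "H \<union> edges s0 w"]
      unfolding ready_def by auto
    moreover have "excess s R + int (Suc m) \<le> excess s (H \<union> edges s0 w)" using g(1) H(3) by simp
    moreover have "card (\<Union>(H \<union> edges s0 w)) + Suc m \<le> card (\<Union>R) + (Suc m + 1) * T"
      using g(2) H(4) Tpos by simp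
    moreover have "anc e \<subseteq> \<Union>(H \<union> edges s0 w)" using H(2) by auto
    ultimately show ?case by blast
  qed
  from this[OF order_refl] obtain H where H: "ready s0 H" "excess s R + int G \<le> excess s H"
    "card (\<Union>H) + G \<le> card (\<Union>R) + (G + 1) * T" by blast
  then have "dense H" unfolding dense_def ready_def T_def by auto
  then show False using no by blast
qed

end

section \<open>Counting lemmas\<close>

text \<open>Deleting the whole fibre of \<open>x\<close> under \<open>h\<close> costs its size, wins
  back \<open>u\<close> for the lost value, and cannot increase the number of values of
  \<open>h'\<close>. Maximality forces the cost to be at least the win.\<close>

lemma large_fiber_of_maximal:
  fixes h :: "'a \<Rightarrow> 'b" and h' :: "'a \<Rightarrow> 'c" and u v :: real
  assumes fin: "finite \<Delta>" and x: "x \<in> \<Delta>" and v: "0 \<le> v"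
    and max: "\<And>\<Delta>'. \<Delta>' \<subseteq> \<Delta> \<Longrightarrow> real (card \<Delta>') - u * card (h ` \<Delta>') - v * card (h' ` \<Delta>')
      \<le> real (card \<Delta>) - u * card (h ` \<Delta>) - v * card (h' ` \<Delta>)"
  shows "u \<le> card {y \<in> \<Delta>. h y = h x}"
proof -
  define F where "F = {y \<in> \<Delta>. h y = h x}"
  have F: "F \<subseteq> \<Delta>" unfolding F_def by auto
  have "card (\<Delta> - F) = card \<Delta> - card F" using F fin by (simp add: card_Diff_subset finite_subset)
  moreover have "card F \<le> card \<Delta>" using F fin card_mono by blast
  ultimately have 1: "real (card (\<Delta> - F)) = real (card \<Delta>) - real (card F)" by (simp add: of_nat_diff)
  have "h ` (\<Delta> - F) = h ` \<Delta> - {h x}" unfolding F_def by auto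
  moreover have "h x \<in> h ` \<Delta>" using x by auto
  ultimately have c: "card (h ` (\<Delta> - F)) = card (h ` \<Delta>) - 1" "card (h ` \<Delta>) > 0"
    using fin card_gt_0_iff[of "h ` \<Delta>"] by auto
  have 2: "real (card (h ` (\<Delta> - F))) = real (card (h ` \<Delta>)) - 1"
    unfolding c(1) using c(2) by (subst of_nat_diff) auto
  have "card (h' ` (\<Delta> - F)) \<le> card (h' ` \<Delta>)" using fin by (intro card_mono) auto
  then have 3: "v * card (h' ` (\<Delta> - F)) \<le> v * card (h' ` \<Delta>)" using v by (intro mult_left_mono) auto
  have "u * (real (card (h ` \<Delta>)) - 1) = u * card (h ` \<Delta>) - u" by (simp add: right_diff_distrib)
  then have "u \<le> card F" using max[OF Diff_subset, of F] 3 unfolding 1 2 by linarith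
  then show ?thesis unfolding F_def .
qed

text \<open>This is passing to a subgraph of large minimum degree: \<open>\<Gamma>\<close> is the
  edge set of a bipartite graph, with \<open>f\<close> and \<open>g\<close> giving the two ends.
  Maximizing one weight treats both sides at once. It serves for the edges of the graph and for
  gadgets, seen as edges between points and hubs.\<close>

lemma exists_dense_fibers:
  fixes f :: "'a \<Rightarrow> 'b" and g :: "'a \<Rightarrow> 'c" and a b :: real
  assumes "finite \<Gamma>" "0 \<le> a" "0 \<le> b"
    and "a * card (f ` \<Gamma>) + b * card (g ` \<Gamma>) < card \<Gamma>"
  obtains \<Gamma>' where "\<Gamma>' \<subseteq> \<Gamma>" "\<Gamma>' \<noteq> {}"
    "\<And>x. x \<in> \<Gamma>' \<Longrightarrow> a \<le> card {y \<in> \<Gamma>'. f y = f x}"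
    "\<And>x. x \<in> \<Gamma>' \<Longrightarrow> b \<le> card {y \<in> \<Gamma>'. g y = g x}"
proof -
  define \<phi> where "\<phi> = (\<lambda>\<Delta>. real (card \<Delta>) - a * card (f ` \<Delta>) - b * card (g ` \<Delta>))"
  have "Max (\<phi> ` Pow \<Gamma>) \<in> \<phi> ` Pow \<Gamma>" using assms(1) by (intro Max_in) auto
  then obtain \<Delta> where "\<Delta> \<subseteq> \<Gamma>" "\<phi> \<Delta> = Max (\<phi> ` Pow \<Gamma>)" by auto
  then have \<Delta>: "\<Delta> \<subseteq> \<Gamma>" "\<And>\<Delta>'. \<Delta>' \<subseteq> \<Gamma> \<Longrightarrow> \<phi> \<Delta>' \<le> \<phi> \<Delta>" using assms(1) by auto
  have fin: "finite \<Delta>" using \<Delta>(1) assms(1) finite_subset by auto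
  have "0 < \<phi> \<Gamma>" using assms(4) unfolding \<phi>_def by simp
  then have "0 < \<phi> \<Delta>" using \<Delta>(2)[of \<Gamma>] by simp
  then have "\<Delta> \<noteq> {}" unfolding \<phi>_def by auto
  moreover have "a \<le> card {y \<in> \<Delta>. f y = f x}" if "x \<in> \<Delta>" for x
    using \<Delta> unfolding \<phi>_def
    by (intro large_fiber_of_maximal[OF fin that assms(3), of a f g]) blast
  moreover have "b \<le> card {y \<in> \<Delta>. g y = g x}" if "x \<in> \<Delta>" for x
  proof (rule large_fiber_of_maximal[OF fin that assms(2), of b g f])
    fix \<Delta>' assume "\<Delta>' \<subseteq> \<Delta>"
    then have "\<Delta>' \<subseteq> \<Gamma>" using \<Delta>(1) by blast
    from \<Delta>(2)[OF this] show "real (card \<Delta>') - b * card (g ` \<Delta>') - a * card (f ` \<Delta>')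
      \<le> real (card \<Delta>) - b * card (g ` \<Delta>) - a * card (f ` \<Delta>)"
      unfolding \<phi>_def by linarith
  qed
  ultimately show ?thesis by (rule that[OF \<Delta>(1)])
qed

text \<open>Vertices are placed one at a time. Each arc between the new vertex \<open>w\<close> and
  the earlier ones is cut by one of the two placements of \<open>w\<close>, so the better placement
  cuts at least half of them.\<close>

lemma exists_large_cut:
  assumes "finite V" "A \<subseteq> V \<times> V" "\<And>v. (v, v) \<notin> A"
  shows "\<exists>S. card A \<le> 2 * card {(u, v) \<in> A. (u \<in> S) \<noteq> (v \<in> S)}"
  using assms
proof (induction V arbitrary: A rule: finite_induct)
  case (insert w V)
  define B where "B = A \<inter> V \<times> V"
  obtain S where S: "card B \<le> 2 * card {(u, v) \<in> B. (u \<in> S) \<noteq> (v \<in> S)}"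
    using insert.IH[of B] insert.prems unfolding B_def by auto
  have finA: "finite A" using insert.prems(1) insert.hyps(1) finite_subset by fast
  define C where "C = (\<lambda>S. {(u, v) \<in> A - B. (u \<in> S) \<noteq> (v \<in> S)})"
  have split: "card {(u, v) \<in> A. (u \<in> T) \<noteq> (v \<in> T)} =
      card {(u, v) \<in> B. (u \<in> S) \<noteq> (v \<in> S)} + card (C T)" if "T - {w} = S - {w}" for T
  proof -
    have "{(u, v) \<in> A. (u \<in> T) \<noteq> (v \<in> T)} = {(u, v) \<in> B. (u \<in> S) \<noteq> (v \<in> S)} \<union> C T"
      using that insert.hyps(2) unfolding C_def B_def by auto
    moreover have "finite ({(u, v) \<in> B. (u \<in> S) \<noteq> (v \<in> S)})" "finite (C T)"
      unfolding B_def C_def by (auto intro: finite_subset[OF _ finA])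
    ultimately show ?thesis
      by (simp, subst card_Un_disjoint) (auto simp: C_def)
  qed
  have "A - B = C (S - {w}) \<union> C (insert w S)"
    using insert.prems insert.hyps(2) unfolding C_def B_def by blast
  then have "card (A - B) \<le> card (C (S - {w})) + card (C (insert w S))" by (metis card_Un_le)
  moreover have "card A = card B + card (A - B)"
    using finA card_Diff_subset[of B A] card_mono[of A B] unfolding B_def
    by (simp add: finite_subset[of B A])
  ultimately have "card A \<le> 2 * card {(u, v) \<in> A. (u \<in> S - {w}) \<noteq> (v \<in> S - {w})} \<or>
     card A \<le> 2 * card {(u, v) \<in> A. (u \<in> insert w S) \<noteq> (v \<in> insert w S)}"
    using split[of "S - {w}"] split[of "insert w S"] S by auto
  then show ?case by blast
qed auto

text \<open>The entries are chosen one after the other; fewer than \<open>k\<close> earlier entries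
  exclude at most \<open>m\<close> pairs each. Truncated subtraction covers the case that
  \<open>T\<close> is too small.\<close>

lemma card_lists_distinct_snd:
  fixes T :: "('a \<times> 'b) set"
  assumes "finite T" "\<And>y. card {x \<in> T. snd x = y} \<le> m"
  shows "(card T - k * m) ^ k \<le> card {ls. length ls = k \<and> set ls \<subseteq> T \<and> distinct (map snd ls)}"
proof (induction k)
  case 0
  have "{ls. length ls = 0 \<and> set ls \<subseteq> T \<and> distinct (map snd ls)} = {[]}" by auto
  then show ?case by simp
next
  case (Suc k)
  define W where "W = {ls. length ls = k \<and> set ls \<subseteq> T \<and> distinct (map snd ls)}"
  define N where "N = (\<lambda>ls :: ('a \<times> 'b) list. {x \<in> T. snd x \<notin> snd ` set ls})"
  have fW: "finite W" unfolding W_def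
    by (rule finite_subset[OF _ finite_lists_length_eq[OF assms(1), of k]]) auto
  have fN: "finite (N ls)" for ls unfolding N_def using assms(1) by auto
  have N: "card T - Suc k * m \<le> card (N ls)" if "ls \<in> W" for ls
  proof -
    have "T \<subseteq> N ls \<union> (\<Union>y\<in>snd ` set ls. {x \<in> T. snd x = y})" unfolding N_def by auto
    then have "card T \<le> card (N ls \<union> (\<Union>y\<in>snd ` set ls. {x \<in> T. snd x = y}))"
      using assms(1) fN by (intro card_mono) auto
    also have "\<dots> \<le> card (N ls) + card (\<Union>y\<in>snd ` set ls. {x \<in> T. snd x = y})"
      by (rule card_Un_le)
    also have "card (\<Union>y\<in>snd ` set ls. {x \<in> T. snd x = y}) \<le>
        (\<Sum>y\<in>snd ` set ls. card {x \<in> T. snd x = y})" by (rule card_UN_le) auto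
    also have "\<dots> \<le> card (snd ` set ls) * m" 
      using sum_bounded_above[of "snd ` set ls" "\<lambda>y. card {x \<in> T. snd x = y}" m] assms(2) by simp
    also have "\<dots> \<le> k * m"
    proof -
      have "card (snd ` set ls) \<le> length (map snd ls)" by (metis card_length set_map)
      then show ?thesis using that unfolding W_def by auto
    qed
    finally show ?thesis by simp
  qed
  have "{ls. length ls = Suc k \<and> set ls \<subseteq> T \<and> distinct (map snd ls)} = (\<Union>ls\<in>W. (\<lambda>x. x # ls) ` N ls)"
  proof (intro set_eqI iffI)
    fix ls assume "ls \<in> {ls. length ls = Suc k \<and> set ls \<subseteq> T \<and> distinct (map snd ls)}"
    then obtain x ls' where "ls = x # ls'" "length ls' = k" "set (x # ls') \<subseteq> T" "distinct (map snd (x # ls'))"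
      by (auto simp: length_Suc_conv)
    then show "ls \<in> (\<Union>ls\<in>W. (\<lambda>x. x # ls) ` N ls)" unfolding W_def N_def by auto
  qed (auto simp: W_def N_def)
  then have eq: "card {ls. length ls = Suc k \<and> set ls \<subseteq> T \<and> distinct (map snd ls)} =
      (\<Sum>ls\<in>W. card ((\<lambda>x. x # ls) ` N ls))"
    using fW fN by (simp only:, intro card_UN_disjoint) auto
  also have "\<dots> = (\<Sum>ls\<in>W. card (N ls))" by (intro sum.cong) (auto simp: card_image inj_on_def)
  finally have "card W * (card T - Suc k * m) \<le>
      card {ls. length ls = Suc k \<and> set ls \<subseteq> T \<and> distinct (map snd ls)}"
    using sum_mono[of W "\<lambda>_. card T - Suc k * m", OF N] by simp
  moreover have "(card T - Suc k * m) ^ k \<le> card W"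
  proof -
    have "(card T - Suc k * m) ^ k \<le> (card T - k * m) ^ k" by (intro power_mono) auto
    also have "\<dots> \<le> card W" using Suc unfolding W_def .
    finally show ?thesis .
  qed
  then have "(card T - Suc k * m) ^ Suc k \<le> card W * (card T - Suc k * m)"
    unfolding power_Suc2 by (rule mult_le_mono1)
  ultimately show ?case by (meson le_trans)
qed

section \<open>Counting gadgets in bipartite graphs\<close>

text \<open>Common neighbours are always taken in the larger side \<open>X\<close>, of sets in the
  smaller side \<open>Y\<close>. The bound \<open>no_biclique\<close> describes the situation in
  which no dense biclique can be found directly.\<close>

locale bipartite =
  fixes X Y :: "'v set" and E :: "('v \<times> 'v) set" and t n M :: nat and d :: real
  assumes fin: "finite X" "finite Y" and disj: "X \<inter> Y = {}" and E: "E \<subseteq> X \<times> Y"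
    and degX: "x \<in> X \<Longrightarrow> d \<le> card {y. (x, y) \<in> E}"
    and degY: "y \<in> Y \<Longrightarrow> d \<le> card {x. (x, y) \<in> E}"
    and card_Y: "card Y \<le> card X" and card_X: "card X \<le> n" and X_ne: "X \<noteq> {}"
    and t: "1 \<le> t" and d: "2 * real t \<le> d"
    and no_biclique: "A \<subseteq> Y \<Longrightarrow> card A = t + 1 \<Longrightarrow> card {x \<in> X. \<forall>a\<in>A. (x, a) \<in> E} \<le> M"
begin

definition P :: "'v set \<Rightarrow> 'v set" where
  "P A = {x \<in> X. \<forall>a\<in>A. (x, a) \<in> E}"

text \<open>The conditions \<open>p \<notin> B\<close> and \<open>y \<notin> A\<close> keep the edge
  \<open>(p, y)\<close> apart from \<open>B \<times> {y}\<close> and from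
  \<open>{p} \<times> A\<close>, so that the edges of a gadget are counted exactly.\<close>

definition links :: "'v set \<Rightarrow> 'v set \<Rightarrow> ('v \<times> 'v) set" where
  "links A B = {(p, y) \<in> E. p \<in> P A \<and> y \<notin> A \<and> p \<notin> B \<and> (\<forall>b\<in>B. (b, y) \<in> E)}"

lemma finE: "finite E"
  using E fin finite_subset by blast

lemma finP: "finite (P A)"
  unfolding P_def using fin by auto

lemma n_pos: "0 < n"
  using X_ne card_X fin(1) card_gt_0_iff[of X] by auto

text \<open>Pairs of a vertex of \<open>X\<close> and a \<open>u\<close>-set of its neighbours are
  counted twice and averaged over the \<open>u\<close>-subsets of \<open>Y\<close>. Because of
  \<open>card Y \<le> card X\<close>, one of the \<open>u\<close> factors \<open>card Y\<close>
  cancels against \<open>card X\<close>; this is why only \<open>u - 1\<close> powers of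
  \<open>n\<close> are lost.\<close>

lemma exists_large_P:
  assumes "1 \<le> u" "real u \<le> d"
  obtains A where "A \<subseteq> Y" "card A = u" "(d / u) ^ u \<le> card (P A) * real n ^ (u - 1)"
proof -
  define \<A> where "\<A> = {A. A \<subseteq> Y \<and> card A = u}"
  have fA: "finite \<A>" unfolding \<A>_def using fin(2) by auto
  have Ypos: "0 < card Y"
  proof -
    obtain x where "x \<in> X" using X_ne by auto
    then have "0 < card {y. (x, y) \<in> E}" using degX[of x] assms by linarith
    then have "{y. (x, y) \<in> E} \<noteq> {}" by (metis card.empty less_irrefl)
    then show ?thesis using E fin(2) by (auto simp: card_gt_0_iff)
  qed
  have "(\<Sum>A\<in>\<A>. card (P A)) = (\<Sum>A\<in>\<A>. \<Sum>x\<in>X. if \<forall>a\<in>A. (x, a) \<in> E then 1 else 0)"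
    unfolding P_def using fin(1) by (intro sum.cong) (auto simp: sum.If_cases Int_def)
  also have "\<dots> = (\<Sum>x\<in>X. \<Sum>A\<in>\<A>. if \<forall>a\<in>A. (x, a) \<in> E then 1 else 0)" by (rule sum.swap)
  also have "\<dots> = (\<Sum>x\<in>X. card {A \<in> \<A>. \<forall>a\<in>A. (x, a) \<in> E})"
    using fA by (intro sum.cong) (auto simp: sum.If_cases Int_def)
  also have "\<dots> = (\<Sum>x\<in>X. card {y. (x, y) \<in> E} choose u)"
  proof (rule sum.cong[OF refl])
    fix x assume "x \<in> X"
    have "{A \<in> \<A>. \<forall>a\<in>A. (x, a) \<in> E} = {A. A \<subseteq> {y. (x, y) \<in> E} \<and> card A = u}"
      unfolding \<A>_def using E by auto
    moreover have "finite {y. (x, y) \<in> E}" using E fin(2) by (auto intro: finite_subset)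
    ultimately show "card {A \<in> \<A>. \<forall>a\<in>A. (x, a) \<in> E} = card {y. (x, y) \<in> E} choose u"
      by (simp add: n_subsets)
  qed
  finally have sum_eq: "(\<Sum>A\<in>\<A>. card (P A)) = (\<Sum>x\<in>X. card {y. (x, y) \<in> E} choose u)" .
  have "real (card X) * (d / u) ^ u = (\<Sum>x\<in>X. (d / u) ^ u)" by simp
  also have "\<dots> \<le> (\<Sum>x\<in>X. real (card {y. (x, y) \<in> E} choose u))"
  proof (rule sum_mono)
    fix x assume x: "x \<in> X"
    have "u \<le> card {y. (x, y) \<in> E}" using degX[OF x] assms by linarith
    then have "(real (card {y. (x, y) \<in> E}) / u) ^ u \<le> real (card {y. (x, y) \<in> E} choose u)"
      by (rule binomial_ge_n_over_k_pow_k)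
    moreover have "(d / u) ^ u \<le> (real (card {y. (x, y) \<in> E}) / u) ^ u"
      using degX[OF x] assms by (intro power_mono divide_right_mono) auto
    ultimately show "(d / u) ^ u \<le> real (card {y. (x, y) \<in> E} choose u)" by linarith
  qed
  also have "\<dots> = (\<Sum>A\<in>\<A>. real (card (P A)))" using sum_eq by (metis of_nat_sum)
  finally have le: "real (card X) * (d / u) ^ u \<le> (\<Sum>A\<in>\<A>. real (card (P A)))" .
  have card_le: "card \<A> \<le> card Y ^ u"
    unfolding \<A>_def using n_subsets[OF fin(2), of u] 
    by (cases "u \<le> card Y") (simp_all add: binomial_le_pow binomial_eq_0)
  have "\<exists>A\<in>\<A>. card X * (d / u) ^ u \<le> card (P A) * real (card Y) ^ u"
  proof (rule ccontr)
    assume "\<not> ?thesis"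
    then have lt: "card (P A) * real (card Y) ^ u < card X * (d / u) ^ u" if "A \<in> \<A>" for A
      using that by force
    have pos: "0 < real (card X) * (d / u) ^ u" using X_ne fin(1) assms by (simp add: card_gt_0_iff)
    have "\<A> \<noteq> {}" using le pos by auto
    then have "(\<Sum>A\<in>\<A>. card (P A) * real (card Y) ^ u) < (\<Sum>A\<in>\<A>. card X * (d / u) ^ u)"
      by (intro sum_strict_mono fA) (use lt in auto)
    also have "\<dots> = card \<A> * (card X * (d / u) ^ u)" by simp
    also have "\<dots> \<le> real (card Y) ^ u * (card X * (d / u) ^ u)"
      using card_le pos by (intro mult_right_mono) (simp_all flip: of_nat_power)
    also have "\<dots> \<le> real (card Y) ^ u * (\<Sum>A\<in>\<A>. real (card (P A)))" 
      using le by (intro mult_left_mono) auto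
    finally show False by (simp add: sum_distrib_left mult.commute)
  qed
  then obtain A where A: "A \<in> \<A>" "card X * (d / u) ^ u \<le> card (P A) * real (card Y) ^ u" by blast
  have "card Y * (d / u) ^ u \<le> card X * (d / u) ^ u"
    using card_Y assms by (intro mult_right_mono) auto
  also have "\<dots> \<le> card (P A) * real (card Y) ^ u" by (rule A(2))
  also have "\<dots> = card Y * (card (P A) * real (card Y) ^ (u - 1))"
    using assms(1) by (cases u) auto
  finally have "(d / u) ^ u \<le> card (P A) * real (card Y) ^ (u - 1)"
    using Ypos by simp
  also have "\<dots> \<le> card (P A) * real n ^ (u - 1)"
    using card_Y card_X by (intro mult_left_mono power_mono) auto
  finally show ?thesis using that A(1) unfolding \<A>_def by blast
qed

text \<open>As \<open>y \<notin> A\<close>, the first components of these links are common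
  neighbours of the \<open>t + 1\<close> vertices of \<open>insert y A\<close>.\<close>

lemma card_links_fixed_snd:
  assumes "A \<subseteq> Y" "card A = t"
  shows "card {x \<in> links A B. snd x = y} \<le> M"
proof (cases "y \<in> Y - A")
  case True
  have "finite A" using assms fin(2) finite_subset by auto
  then have "card (insert y A) = t + 1" using True assms by simp
  then have M: "card {x \<in> X. \<forall>a\<in>insert y A. (x, a) \<in> E} \<le> M"
    using True assms by (intro no_biclique) auto
  have "{x \<in> links A B. snd x = y} \<subseteq> (\<lambda>p. (p, y)) ` {x \<in> X. \<forall>a\<in>insert y A. (x, a) \<in> E}"
    unfolding links_def P_def by auto
  then have "card {x \<in> links A B. snd x = y} \<le> card ((\<lambda>p. (p, y)) ` {x \<in> X. \<forall>a\<in>insert y A. (x, a) \<in> E})"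
    using fin(1) by (intro card_mono) auto
  also have "\<dots> \<le> card {x \<in> X. \<forall>a\<in>insert y A. (x, a) \<in> E}" using fin(1) by (intro card_image_le) auto
  finally show ?thesis using M by linarith
next
  case False
  then have "{x \<in> links A B. snd x = y} = {}" using E unfolding links_def by auto
  then show ?thesis by (metis card.empty zero_le)
qed

text \<open>A lower bound for the average number of links between \<open>A\<close> and a
  \<open>t\<close>-set \<open>B\<close>, where \<open>n ^ t\<close> stands in for the number of sets
  \<open>B\<close>.\<close>

definition \<tau> :: "'v set \<Rightarrow> real" where
  "\<tau> A = card (P A) * (d / 2) * (d / (2 * t)) ^ t / real n ^ t"

text \<open>Triples \<open>(p, y, B)\<close> are counted: \<open>p\<close> has at least
  \<open>d - t \<ge> d / 2\<close> neighbours \<open>y\<close> outside \<open>A\<close>, and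
  \<open>B\<close> is a \<open>t\<close>-set among the at least \<open>d - 1 \<ge> d / 2\<close>
  other neighbours of \<open>y\<close>.\<close>

lemma sum_links:
  assumes "A \<subseteq> Y" "card A = t"
  shows "real n ^ t * \<tau> A \<le> (\<Sum>B | B \<subseteq> X \<and> card B = t. real (card (links A B)))"
proof -
  define \<B> where "\<B> = {B. B \<subseteq> X \<and> card B = t}"
  have fB: "finite \<B>" unfolding \<B>_def using fin(1) by auto
  have finN: "finite {x. (x, y) \<in> E}" "finite {y. (x, y) \<in> E}" for x y
    using E fin by (auto intro: finite_subset)
  define L where "L = {(p, y) \<in> E. p \<in> P A \<and> y \<notin> A}"
  have finL: "finite L" unfolding L_def by (rule finite_subset[OF _ finE]) auto
  have finA: "finite A" using assms fin(2) finite_subset by auto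
  have "(\<Sum>B\<in>\<B>. card (links A B)) = (\<Sum>B\<in>\<B>. \<Sum>(p, y)\<in>L. if p \<notin> B \<and> (\<forall>b\<in>B. (b, y) \<in> E) then 1 else 0)"
  proof (rule sum.cong[OF refl])
    fix B
    have "links A B = {x \<in> L. case x of (p, y) \<Rightarrow> p \<notin> B \<and> (\<forall>b\<in>B. (b, y) \<in> E)}"
      unfolding links_def L_def by auto
    moreover have "card {x \<in> L. q x} = (\<Sum>x\<in>L. if q x then 1 else 0)" for q
      using finL by (simp add: sum.If_cases Int_def)
    ultimately have "card (links A B) =
        (\<Sum>x\<in>L. if (case x of (p, y) \<Rightarrow> p \<notin> B \<and> (\<forall>b\<in>B. (b, y) \<in> E)) then 1 else 0)"
      by simp
    then show "card (links A B) = (\<Sum>(p, y)\<in>L. if p \<notin> B \<and> (\<forall>b\<in>B. (b, y) \<in> E) then 1 else 0)"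
      by (simp add: case_prod_beta')
  qed
  also have "\<dots> = (\<Sum>(p, y)\<in>L. \<Sum>B\<in>\<B>. if p \<notin> B \<and> (\<forall>b\<in>B. (b, y) \<in> E) then 1 else 0)"
    by (subst sum.swap) (simp add: case_prod_beta')
  also have "\<dots> = (\<Sum>(p, y)\<in>L. card ({x. (x, y) \<in> E} - {p}) choose t)"
  proof (rule sum.cong[OF refl], clarify)
    fix p y
    have "(\<Sum>B\<in>\<B>. if p \<notin> B \<and> (\<forall>b\<in>B. (b, y) \<in> E) then 1 else 0) =
        card {B \<in> \<B>. p \<notin> B \<and> (\<forall>b\<in>B. (b, y) \<in> E)}"
      using fB by (simp add: sum.If_cases Int_def)
    also have "{B \<in> \<B>. p \<notin> B \<and> (\<forall>b\<in>B. (b, y) \<in> E)} = {B. B \<subseteq> {x. (x, y) \<in> E} - {p} \<and> card B = t}"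
      unfolding \<B>_def using E by auto
    finally show "(\<Sum>B\<in>\<B>. if p \<notin> B \<and> (\<forall>b\<in>B. (b, y) \<in> E) then 1 else 0) =
        card ({x. (x, y) \<in> E} - {p}) choose t"
      using finN by (simp add: n_subsets)
  qed
  finally have sum_eq: "(\<Sum>B\<in>\<B>. card (links A B)) = (\<Sum>(p, y)\<in>L. card ({x. (x, y) \<in> E} - {p}) choose t)" .
  have each: "(d / (2 * t)) ^ t \<le> real (card ({x. (x, y) \<in> E} - {p}) choose t)" if "(p, y) \<in> L" for p y
  proof -
    have "y \<in> Y" "p \<in> {x. (x, y) \<in> E}" using that E unfolding L_def by auto
    then have "real (card ({x. (x, y) \<in> E} - {p})) \<ge> d - 1"
      using degY[of y] finN(1)[of y] by (simp add: of_nat_diff)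
    then have ge: "real (card ({x. (x, y) \<in> E} - {p})) \<ge> d / 2" and
      "real (card ({x. (x, y) \<in> E} - {p})) \<ge> t"
      using d t by linarith+
    then have "(real (card ({x. (x, y) \<in> E} - {p})) / t) ^ t \<le> real (card ({x. (x, y) \<in> E} - {p}) choose t)"
      by (intro binomial_ge_n_over_k_pow_k) simp
    moreover have "(d / (2 * t)) ^ t \<le> (real (card ({x. (x, y) \<in> E} - {p})) / t) ^ t"
      using ge d t by (intro power_mono) (auto simp: field_simps)
    ultimately show ?thesis by linarith
  qed
  have "card (P A) * (d / 2) \<le> card L"
  proof -
    have "L = Sigma (P A) (\<lambda>p. {y. (p, y) \<in> E} - A)" unfolding L_def by auto
    then have "card L = (\<Sum>p\<in>P A. card ({y. (p, y) \<in> E} - A))"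
      using finP finN by (simp add: card_SigmaI)
    moreover have "d / 2 \<le> card ({y. (p, y) \<in> E} - A)" if "p \<in> P A" for p
    proof -
      have "card {y. (p, y) \<in> E} - card A \<le> card ({y. (p, y) \<in> E} - A)"
        by (rule diff_card_le_card_Diff[OF finA])
      moreover have "d \<le> card {y. (p, y) \<in> E}" using that degX unfolding P_def by auto
      ultimately show ?thesis using assms(2) d by linarith
    qed
    then have "(\<Sum>p\<in>P A. d / 2) \<le> (\<Sum>p\<in>P A. real (card ({y. (p, y) \<in> E} - A)))" by (rule sum_mono)
    ultimately show ?thesis by simp
  qed
  then have "card (P A) * (d / 2) * (d / (2 * t)) ^ t \<le> card L * (d / (2 * t)) ^ t"
    using d by (intro mult_right_mono) auto
  also have "\<dots> = (\<Sum>(p, y)\<in>L. (d / (2 * t)) ^ t)" by (simp add: case_prod_beta')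
  also have "\<dots> \<le> (\<Sum>(p, y)\<in>L. real (card ({x. (x, y) \<in> E} - {p}) choose t))"
    using each by (intro sum_mono) auto
  also have "\<dots> = real (\<Sum>(p, y)\<in>L. card ({x. (x, y) \<in> E} - {p}) choose t)"
    by (simp add: case_prod_beta')
  also have "\<dots> = (\<Sum>B\<in>\<B>. real (card (links A B)))" unfolding sum_eq[symmetric] by simp
  finally show ?thesis unfolding \<tau>_def \<B>_def using n_pos by simp
qed


text \<open>The sets \<open>B\<close> with at least \<open>\<tau> A / 2\<close> links carry at least
  half of the guaranteed total. Each has many lists of \<open>k\<close> links with distinct middle
  vertices; the head of a list becomes the free link, the tail belongs to the hub. A pigeonhole over
  the first components of the tail fixes \<open>Q\<close>. What remains is a bipartite graph of
  points and hubs whose edges are gadgets, and \<open>exists_dense_fibers\<close> makes its degrees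
  large on both sides.\<close>

lemma exists_gadgets:
  assumes A: "A \<subseteq> Y" "card A = t" and k: "1 \<le> k" and \<tau>: "0 < \<tau> A" "4 * real k * M \<le> \<tau> A"
  obtains Q \<Gamma> where "finite \<Gamma>" "\<Gamma> \<noteq> {}" "set Q \<subseteq> P A" "length Q = k - 1"
    "\<And>B ls p y. (B, ls, (p, y)) \<in> \<Gamma> \<Longrightarrow> B \<subseteq> X \<and> card B = t \<and> set ls \<subseteq> links A B \<and>
       (p, y) \<in> links A B \<and> map fst ls = Q \<and> distinct (y # map snd ls)"
    "\<And>\<gamma>. \<gamma> \<in> \<Gamma> \<Longrightarrow> real n ^ t * (\<tau> A / 4) ^ k / (3 * real (card (P A)) ^ k)
       \<le> card {\<gamma>' \<in> \<Gamma>. fst (snd (snd \<gamma>')) = fst (snd (snd \<gamma>))}"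
    "\<And>\<gamma>. \<gamma> \<in> \<Gamma> \<Longrightarrow> \<tau> A / 8 \<le> card {\<gamma>' \<in> \<Gamma>. (fst \<gamma>', fst (snd \<gamma>')) = (fst \<gamma>, fst (snd \<gamma>))}"
proof -
  define T where "T = (\<lambda>B. card (links A B))"
  define \<B>0 where "\<B>0 = {B. B \<subseteq> X \<and> card B = t}"
  define \<B> where "\<B> = {B \<in> \<B>0. \<tau> A / 2 \<le> T B}"
  define LL where "LL = (\<lambda>B. {ls. length ls = k \<and> set ls \<subseteq> links A B \<and> distinct (map snd ls)})"
  have fin_links: "finite (links A B)" for B
    by (rule finite_subset[OF _ finE]) (auto simp: links_def)
  have fB0: "finite \<B>0" unfolding \<B>0_def using fin by auto
  then have fB: "finite \<B>" unfolding \<B>_def by auto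
  have fLL: "finite (LL B)" for B unfolding LL_def
    by (rule finite_subset[OF _ finite_lists_length_eq[OF fin_links[of B], of k]]) auto
  have "card \<B>0 \<le> card X ^ t"
    unfolding \<B>0_def using n_subsets[OF fin(1), of t]
    by (cases "t \<le> card X") (simp_all add: binomial_le_pow binomial_eq_0)
  also have "\<dots> \<le> n ^ t" using card_X by (rule power_mono) simp
  finally have cB0: "real (card \<B>0) \<le> real n ^ t" by (metis of_nat_le_iff of_nat_power)
  have "real n ^ t * \<tau> A \<le> (\<Sum>B\<in>\<B>0. real (T B))"
    using sum_links[OF A] unfolding \<B>0_def T_def .
  also have "\<dots> = (\<Sum>B\<in>\<B>. real (T B)) + (\<Sum>B\<in>\<B>0 - \<B>. real (T B))"
    using sum.subset_diff[of \<B> \<B>0 "\<lambda>B. real (T B)"] fB0 unfolding \<B>_def by auto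
  also have "(\<Sum>B\<in>\<B>0 - \<B>. real (T B)) \<le> (\<Sum>B\<in>\<B>0 - \<B>. \<tau> A / 2)"
    by (rule sum_mono) (auto simp: \<B>_def)
  also have "\<dots> \<le> real n ^ t * (\<tau> A / 2)"
  proof -
    have "card (\<B>0 - \<B>) \<le> card \<B>0" by (rule card_mono[OF fB0]) auto
    then have "real (card (\<B>0 - \<B>)) \<le> real n ^ t" using cB0 by linarith
    then show ?thesis using \<tau>(1) by (simp add: mult_right_mono)
  qed
  finally have sumB: "real n ^ t * (\<tau> A / 2) \<le> (\<Sum>B\<in>\<B>. real (T B))" by simp
  have half: "real (T B) / 2 \<le> real (T B - k * M)" if "B \<in> \<B>" for B
  proof -
    have "real (T B) \<ge> 2 * (real k * M)" using that \<tau>(2) unfolding \<B>_def by auto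
    moreover have "0 \<le> real k * M" by simp
    ultimately have "real (k * M) \<le> real (T B)" unfolding of_nat_mult by linarith
    then have "k * M \<le> T B" by (rule of_nat_le_iff[THEN iffD1])
    then have "real (T B - k * M) = real (T B) - real k * M"
      by (simp add: of_nat_diff)
    moreover have "x / 2 \<le> x - z" if "2 * z \<le> x" for x z :: real using that by simp
    ultimately show ?thesis using \<open>real (T B) \<ge> 2 * (real k * M)\<close> by metis
  qed
  \<comment> \<open>Only \<open>k - 1\<close> factors are replaced by their lower bound. One factor
    \<open>T B\<close> is kept, so that the sum over \<open>B\<close> can be compared with
    \<open>sumB\<close>.\<close>
  have LL: "(real (T B) / 2) * (\<tau> A / 4) ^ (k - 1) \<le> card (LL B)" if "B \<in> \<B>" for B
  proof -
    have "(real (T B) / 2) * (\<tau> A / 4) ^ (k - 1) \<le> (real (T B) / 2) * (real (T B) / 2) ^ (k - 1)"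
    proof (intro mult_left_mono power_mono)
      have "\<tau> A / 2 \<le> real (T B)" using that unfolding \<B>_def by simp
      then show "\<tau> A / 4 \<le> real (T B) / 2" by linarith
    qed (use \<tau>(1) in simp_all)
    also have "\<dots> = (real (T B) / 2) ^ k" using k by (cases k) auto
    also have "\<dots> \<le> real (T B - k * M) ^ k" by (rule power_mono[OF half[OF that]]) auto
    also have "\<dots> \<le> card (LL B)"
    proof -
      have "(T B - k * M) ^ k \<le> card (LL B)" unfolding LL_def T_def
        by (rule card_lists_distinct_snd[OF fin_links card_links_fixed_snd[OF A]])
      then have "real ((T B - k * M) ^ k) \<le> real (card (LL B))" by (rule of_nat_mono)
      then show ?thesis by simp
    qed
    finally show ?thesis .
  qed
  define \<Omega> where "\<Omega> = Sigma \<B> LL"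
  have f\<Omega>: "finite \<Omega>" unfolding \<Omega>_def using fB fLL by auto
  have "real n ^ t * (\<tau> A / 4) ^ k = (real n ^ t * (\<tau> A / 2)) / 2 * (\<tau> A / 4) ^ (k - 1)"
    using k by (cases k) auto
  also have "\<dots> \<le> (\<Sum>B\<in>\<B>. real (T B)) / 2 * (\<tau> A / 4) ^ (k - 1)"
    using sumB \<tau>(1) by (intro mult_right_mono divide_right_mono) auto
  also have "\<dots> = (\<Sum>B\<in>\<B>. (real (T B) / 2) * (\<tau> A / 4) ^ (k - 1))"
    by (simp add: sum_distrib_right sum_divide_distrib)
  also have "\<dots> \<le> (\<Sum>B\<in>\<B>. real (card (LL B)))" by (rule sum_mono) (rule LL)
  also have "\<dots> = card \<Omega>" unfolding \<Omega>_def using fB fLL by (simp add: card_SigmaI)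
  finally have card_\<Omega>: "real n ^ t * (\<tau> A / 4) ^ k \<le> card \<Omega>" .
  define \<Q> where "\<Q> = {Q. set Q \<subseteq> P A \<and> length Q = k - 1}"
  have f\<Q>: "finite \<Q>" and card_\<Q>: "card \<Q> = card (P A) ^ (k - 1)"
    unfolding \<Q>_def using finite_lists_length_eq[OF finP] card_lists_length_eq[OF finP] by auto
  define q where "q = (\<lambda>\<omega> :: 'v set \<times> ('v \<times> 'v) list. map fst (tl (snd \<omega>)))"
  have q: "q ` \<Omega> \<subseteq> \<Q>"
  proof
    fix Q assume "Q \<in> q ` \<Omega>"
    then obtain B ls where *: "B \<in> \<B>" "ls \<in> LL B" "Q = map fst (tl ls)" unfolding \<Omega>_def q_def by auto
    then have "set (tl ls) \<subseteq> links A B" unfolding LL_def using list.set_sel(2)[of ls] by (cases ls) auto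
    then have "set Q \<subseteq> P A" unfolding *(3) links_def by auto
    then show "Q \<in> \<Q>" using * unfolding \<Q>_def LL_def by auto
  qed
  have \<Omega>pos: "0 < real n ^ t * (\<tau> A / 4) ^ k" using n_pos \<tau>(1) by simp
  have "\<exists>Q\<in>\<Q>. card \<Omega> \<le> card {\<omega> \<in> \<Omega>. q \<omega> = Q} * card (P A) ^ (k - 1)"
  proof (rule ccontr)
    assume "\<not> ?thesis"
    then have lt: "card {\<omega> \<in> \<Omega>. q \<omega> = Q} * card (P A) ^ (k - 1) < card \<Omega>" if "Q \<in> \<Q>" for Q
      using that by force
    have "\<Omega> \<noteq> {}" using card_\<Omega> \<Omega>pos by auto
    then have ne: "q ` \<Omega> \<noteq> {}" by auto
    have "card \<Omega> = (\<Sum>Q\<in>q ` \<Omega>. card {\<omega> \<in> \<Omega>. q \<omega> = Q})"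
      using sum.image_gen[OF f\<Omega>, of "\<lambda>_. 1::nat" q] by simp
    then have "card \<Omega> * card (P A) ^ (k - 1) = (\<Sum>Q\<in>q ` \<Omega>. card {\<omega> \<in> \<Omega>. q \<omega> = Q} * card (P A) ^ (k - 1))"
      by (simp add: sum_distrib_right)
    also have "\<dots> < (\<Sum>Q\<in>q ` \<Omega>. card \<Omega>)"
      using f\<Omega> ne lt q by (intro sum_strict_mono) auto
    also have "\<dots> \<le> card \<Omega> * card (P A) ^ (k - 1)"
      using card_mono[OF f\<Q> q] card_\<Q> by simp
    finally show False by simp
  qed
  then obtain Q where Q: "Q \<in> \<Q>" "card \<Omega> \<le> card {\<omega> \<in> \<Omega>. q \<omega> = Q} * card (P A) ^ (k - 1)" by blast
  define \<Gamma>0 where "\<Gamma>0 = {(B, ls, x). B \<in> \<B> \<and> x # ls \<in> LL B \<and> map fst ls = Q}"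
  have eq: "\<Gamma>0 = (\<lambda>(B, ls). (B, tl ls, hd ls)) ` {\<omega> \<in> \<Omega>. q \<omega> = Q}"
  proof (intro set_eqI iffI)
    fix g assume "g \<in> \<Gamma>0"
    then obtain B ls x where "g = (B, ls, x)" "B \<in> \<B>" "x # ls \<in> LL B" "map fst ls = Q"
      unfolding \<Gamma>0_def by auto
    then show "g \<in> (\<lambda>(B, ls). (B, tl ls, hd ls)) ` {\<omega> \<in> \<Omega>. q \<omega> = Q}"
      unfolding \<Omega>_def q_def by (intro image_eqI[of _ _ "(B, x # ls)"]) auto
  next
    fix g assume "g \<in> (\<lambda>(B, ls). (B, tl ls, hd ls)) ` {\<omega> \<in> \<Omega>. q \<omega> = Q}"
    then obtain B ls where *: "g = (B, tl ls, hd ls)" "B \<in> \<B>" "ls \<in> LL B" "map fst (tl ls) = Q"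
      unfolding \<Omega>_def q_def by auto
    then have "ls \<noteq> []" using k unfolding LL_def by auto
    then show "g \<in> \<Gamma>0" using * unfolding \<Gamma>0_def by auto
  qed
  have "inj_on (\<lambda>(B, ls). (B, tl ls, hd ls)) {\<omega> \<in> \<Omega>. q \<omega> = Q}"
  proof (rule inj_onI)
    fix w w'
    assume w: "w \<in> {\<omega> \<in> \<Omega>. q \<omega> = Q}" "w' \<in> {\<omega> \<in> \<Omega>. q \<omega> = Q}"
      and e: "(case w of (B, ls) \<Rightarrow> (B, tl ls, hd ls)) = (case w' of (B, ls) \<Rightarrow> (B, tl ls, hd ls))"
    obtain B ls B' ls' where ww: "w = (B, ls)" "w' = (B', ls')" by (cases w; cases w') auto
    have "length ls = k" "length ls' = k" using w unfolding ww \<Omega>_def LL_def by auto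
    then have "ls \<noteq> []" "ls' \<noteq> []" using k by auto
    then show "w = w'" using e unfolding ww by (auto intro: list.expand)
  qed
  then have card_eq: "card \<Gamma>0 = card {\<omega> \<in> \<Omega>. q \<omega> = Q}" unfolding eq by (rule card_image)
  have f\<Gamma>0: "finite \<Gamma>0" unfolding eq using f\<Omega> by auto
  have Ppos: "0 < real (card (P A))" using \<tau>(1) unfolding \<tau>_def by (cases "card (P A)") auto
  have "real n ^ t * (\<tau> A / 4) ^ k \<le> real (card \<Gamma>0 * card (P A) ^ (k - 1))"
    using card_\<Omega> Q(2) unfolding card_eq by linarith
  then have \<Gamma>0_ge: "real n ^ t * (\<tau> A / 4) ^ k \<le> card \<Gamma>0 * real (card (P A)) ^ (k - 1)" by simp
  then have \<Gamma>0_pos: "0 < card \<Gamma>0" using \<Omega>pos by (cases "card \<Gamma>0") auto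
  define pt where "pt = (\<lambda>\<gamma> :: 'v set \<times> ('v \<times> 'v) list \<times> ('v \<times> 'v). fst (snd (snd \<gamma>)))"
  define hub where "hub = (\<lambda>\<gamma> :: 'v set \<times> ('v \<times> 'v) list \<times> ('v \<times> 'v). (fst \<gamma>, fst (snd \<gamma>)))"
  \<comment> \<open>With this threshold the points use up at most a third of
    \<open>\<Gamma>0\<close>. Every hub has at least \<open>\<tau> A / 4\<close> gadgets, so the
    threshold \<open>\<tau> A / 8\<close> uses up at most half; the two shares add up to less than
    1.\<close>
  define a where "a = real n ^ t * (\<tau> A / 4) ^ k / (3 * real (card (P A)) ^ k)"
  have a0: "0 \<le> a" unfolding a_def using \<tau>(1) by simp
  have apt: "a * card (pt ` \<Gamma>0) \<le> card \<Gamma>0 / 3"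
  proof -
    have "pt ` \<Gamma>0 \<subseteq> P A" unfolding \<Gamma>0_def LL_def pt_def links_def by auto
    then have "card (pt ` \<Gamma>0) \<le> card (P A)" using finP by (rule card_mono[rotated])
    then have "a * card (pt ` \<Gamma>0) \<le> a * card (P A)" using a0 by (intro mult_left_mono) auto
    also have "\<dots> = real n ^ t * (\<tau> A / 4) ^ k / (3 * real (card (P A)) ^ (k - 1))"
      unfolding a_def using k Ppos by (cases k) auto
    also have "\<dots> \<le> card \<Gamma>0 / 3" using \<Gamma>0_ge Ppos by (simp add: divide_le_eq)
    finally show ?thesis .
  qed
  have hub: "\<tau> A / 8 * card (hub ` \<Gamma>0) \<le> card \<Gamma>0 / 2"
  proof -
    have "\<tau> A / 4 \<le> card {\<gamma> \<in> \<Gamma>0. hub \<gamma> = u}" if "u \<in> hub ` \<Gamma>0" for u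
    proof -
      obtain \<gamma> where \<gamma>: "\<gamma> \<in> \<Gamma>0" "u = hub \<gamma>" using \<open>u \<in> hub ` \<Gamma>0\<close> by blast
      obtain B ls x where "\<gamma> = (B, ls, x)" by (cases \<gamma>) auto
      then have u: "u = (B, ls)" and *: "B \<in> \<B>" "x # ls \<in> LL B" "map fst ls = Q"
        using \<gamma> unfolding \<Gamma>0_def hub_def by auto
      define N where "N = {x \<in> links A B. snd x \<notin> snd ` set ls}"
      have "links A B \<subseteq> N \<union> (\<Union>y\<in>snd ` set ls. {x \<in> links A B. snd x = y})" unfolding N_def by auto
      then have "card (links A B) \<le> card (N \<union> (\<Union>y\<in>snd ` set ls. {x \<in> links A B. snd x = y}))"
        using fin_links unfolding N_def by (intro card_mono) auto
      also have "\<dots> \<le> card N + card (\<Union>y\<in>snd ` set ls. {x \<in> links A B. snd x = y})"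
        by (rule card_Un_le)
      also have "card (\<Union>y\<in>snd ` set ls. {x \<in> links A B. snd x = y}) \<le>
          (\<Sum>y\<in>snd ` set ls. card {x \<in> links A B. snd x = y})" by (rule card_UN_le) auto
      also have "\<dots> \<le> card (snd ` set ls) * M"
        using sum_bounded_above[of "snd ` set ls" "\<lambda>y. card {x \<in> links A B. snd x = y}" M]
          card_links_fixed_snd[OF A, of B] by simp
      also have "\<dots> \<le> k * M"
      proof -
        have "card (snd ` set ls) \<le> length (map snd ls)" by (metis card_length set_map)
        then show ?thesis using * unfolding LL_def by auto
      qed
      finally have "T B - k * M \<le> card N" unfolding T_def by simp
      then have "\<tau> A / 4 \<le> card N" using half[OF *(1)] *(1) unfolding \<B>_def by auto
      also have "card N = card ((\<lambda>x. (B, ls, x)) ` N)" by (simp add: card_image inj_on_def)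
      also have "\<dots> \<le> card {\<gamma> \<in> \<Gamma>0. hub \<gamma> = u}"
        using * f\<Gamma>0 unfolding u by (intro card_mono) (auto simp: \<Gamma>0_def hub_def N_def LL_def)
      finally show ?thesis by simp
    qed
    then have "(\<Sum>u\<in>hub ` \<Gamma>0. \<tau> A / 4) \<le> (\<Sum>u\<in>hub ` \<Gamma>0. real (card {\<gamma> \<in> \<Gamma>0. hub \<gamma> = u}))"
      by (rule sum_mono)
    also have "\<dots> = card \<Gamma>0"
      using sum.image_gen[OF f\<Gamma>0, of "\<lambda>_. 1::nat" hub] by (simp flip: of_nat_sum)
    finally show ?thesis by (simp add: mult.commute)
  qed
  have "a * card (pt ` \<Gamma>0) + \<tau> A / 8 * card (hub ` \<Gamma>0) < card \<Gamma>0"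
    using apt hub \<Gamma>0_pos by (simp add: field_simps)
  from exists_dense_fibers[OF f\<Gamma>0 a0 _ this]
  obtain \<Gamma> where \<Gamma>: "\<Gamma> \<subseteq> \<Gamma>0" "\<Gamma> \<noteq> {}"
    "\<And>x. x \<in> \<Gamma> \<Longrightarrow> a \<le> card {y \<in> \<Gamma>. pt y = pt x}"
    "\<And>x. x \<in> \<Gamma> \<Longrightarrow> \<tau> A / 8 \<le> card {y \<in> \<Gamma>. hub y = hub x}"
    using \<tau>(1) by auto
  show ?thesis
  proof (rule that[of \<Gamma> Q])
    show "finite \<Gamma>" using \<Gamma>(1) f\<Gamma>0 finite_subset by auto
    show "set Q \<subseteq> P A" "length Q = k - 1" using Q(1) unfolding \<Q>_def by auto
    fix B ls p y assume "(B, ls, (p, y)) \<in> \<Gamma>"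
    then have "(B, ls, (p, y)) \<in> \<Gamma>0" using \<Gamma>(1) by auto
    then show "B \<subseteq> X \<and> card B = t \<and> set ls \<subseteq> links A B \<and>
       (p, y) \<in> links A B \<and> map fst ls = Q \<and> distinct (y # map snd ls)"
      unfolding \<Gamma>0_def \<B>_def \<B>0_def LL_def by auto
  qed (use \<Gamma> in \<open>auto simp: a_def pt_def hub_def\<close>)
qed

end

section \<open>Gadgets as balanced steps\<close>

definition doubleton :: "'v \<times> 'v \<Rightarrow> 'v set" where
  "doubleton e = {fst e, snd e}"

text \<open>Distance at most 3 by explicit paths, which makes it monotone in \<open>H\<close>. In
  the construction points of \<open>P\<close> need one edge, middle vertices and the other vertices
  of \<open>A\<close> two, hub vertices three.\<close>

definition near :: "'v \<Rightarrow> 'v set set \<Rightarrow> 'v \<Rightarrow> bool" where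
  "near a H v \<longleftrightarrow> v = a \<or> {v, a} \<in> H \<or> (\<exists>p. {v, p} \<in> H \<and> {p, a} \<in> H) \<or>
     (\<exists>y p. {v, y} \<in> H \<and> {y, p} \<in> H \<and> {p, a} \<in> H)"

lemma near_mono: "near a H v \<Longrightarrow> H \<subseteq> H' \<Longrightarrow> near a H' v"
  unfolding near_def by blast

lemma doubleton_imageI:
  assumes "(x, y) \<in> S"
  shows "{x, y} \<in> doubleton ` S" "{y, x} \<in> doubleton ` S"
  using imageI[OF assms, of doubleton] by (simp_all add: doubleton_def insert_commute)

lemma Union_doubleton: "\<Union>(doubleton ` S) = fst ` S \<union> snd ` S"
  unfolding doubleton_def by auto

lemma inj_on_doubleton: "X \<inter> Y = {} \<Longrightarrow> S \<subseteq> X \<times> Y \<Longrightarrow> inj_on doubleton S"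
  unfolding inj_on_def doubleton_def by (fastforce simp: doubleton_eq_iff)

lemma card_doubleton_touching:
  assumes "X \<inter> Y = {}" "S \<subseteq> X \<times> Y"
  shows "card {e \<in> doubleton ` S. e \<inter> N \<noteq> {}} = card {(x, y) \<in> S. x \<in> N \<or> y \<in> N}"
proof -
  have "{e \<in> doubleton ` S. e \<inter> N \<noteq> {}} = doubleton ` {(x, y) \<in> S. x \<in> N \<or> y \<in> N}"
  proof (intro set_eqI iffI)
    fix e assume "e \<in> {e \<in> doubleton ` S. e \<inter> N \<noteq> {}}"
    then obtain x y where "(x, y) \<in> S" "e = doubleton (x, y)" "doubleton (x, y) \<inter> N \<noteq> {}" by auto
    then have "(x, y) \<in> {(x, y) \<in> S. x \<in> N \<or> y \<in> N}" by (auto simp: doubleton_def)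
    then show "e \<in> doubleton ` {(x, y) \<in> S. x \<in> N \<or> y \<in> N}" using \<open>e = doubleton (x, y)\<close> by (rule image_eqI[rotated])
  qed (auto simp: doubleton_def)
  moreover have "inj_on doubleton {(x, y) \<in> S. x \<in> N \<or> y \<in> N}"
    by (rule inj_on_doubleton[OF assms(1)]) (use assms in auto)
  ultimately show ?thesis by (simp add: card_image)
qed

text \<open>\<open>e\<close> is the number of edges of a hub step that touch \<open>\<beta>\<close> of its \<open>t\<close> new vertices in \<open>B\<close> and \<open>\<eta>\<close> of its
  \<open>t * (2 * t + 1)\<close> new middle vertices. The slack \<open>2 * e - (2 * t + 1) * (\<beta> + \<eta>)\<close> is affine in \<open>\<beta>\<close>,
  with value \<open>\<eta>\<close> at \<open>\<beta> = 0\<close> and \<open>(2 * t - 1) * (t * (2 * t + 1) - \<eta>)\<close> at \<open>\<beta> = t\<close>.\<close>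

lemma hub_balance:
  fixes t \<beta> \<eta> :: nat
  assumes "1 \<le> t" "\<beta> \<le> t" "\<eta> \<le> t * (2 * t + 1)"
  defines "e \<equiv> t * (t * (2 * t + 1)) - (t - \<beta>) * (t * (2 * t + 1) - \<eta>) + \<eta>"
  shows "(2 * t + 1) * (\<beta> + \<eta>) \<le> 2 * e"
    and "\<beta> + \<eta> \<noteq> 0 \<Longrightarrow> \<beta> + \<eta> \<noteq> t + t * (2 * t + 1) \<Longrightarrow> (2 * t + 1) * (\<beta> + \<eta>) < 2 * e"
proof -
  define k where "k = t * (2 * t + 1)"
  have "(t - \<beta>) * (k - \<eta>) \<le> t * k" by (intro mult_mono) auto
  then have e: "int e = int t * int k - (int t - int \<beta>) * (int k - int \<eta>) + int \<eta>"
    unfolding e_def k_def[symmetric] using assms(2,3)[folded k_def] by (simp add: of_nat_diff)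
  have ik: "int k = int t * (2 * int t + 1)" unfolding k_def by (simp add: algebra_simps)
  have *: "int t * (2 * int e - (2 * int t + 1) * (int \<beta> + int \<eta>)) =
      (int t - int \<beta>) * int \<eta> + int \<beta> * (2 * int t - 1) * (int k - int \<eta>)"
    unfolding e ik by (simp add: algebra_simps)
  have nn: "0 \<le> (int t - int \<beta>) * int \<eta>" "0 \<le> int \<beta> * (2 * int t - 1) * (int k - int \<eta>)"
    using assms(1-3) unfolding k_def[symmetric] by (auto intro!: mult_nonneg_nonneg)
  then have "0 \<le> int t * (2 * int e - (2 * int t + 1) * (int \<beta> + int \<eta>))" unfolding * by simp
  then have "0 \<le> 2 * int e - (2 * int t + 1) * (int \<beta> + int \<eta>)"
    using assms(1) by (simp add: zero_le_mult_iff)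
  then have "int ((2 * t + 1) * (\<beta> + \<eta>)) \<le> int (2 * e)" by (simp add: algebra_simps)
  then show le: "(2 * t + 1) * (\<beta> + \<eta>) \<le> 2 * e" by (simp only: of_nat_le_iff)
  assume ne: "\<beta> + \<eta> \<noteq> 0" "\<beta> + \<eta> \<noteq> t + t * (2 * t + 1)"
  have "(2 * t + 1) * (\<beta> + \<eta>) \<noteq> 2 * e"
  proof
    assume "(2 * t + 1) * (\<beta> + \<eta>) = 2 * e"
    then have "int ((2 * t + 1) * (\<beta> + \<eta>)) = int (2 * e)" by simp
    then have "2 * int e - (2 * int t + 1) * (int \<beta> + int \<eta>) = 0" by (simp add: algebra_simps)
    then have "(int t - int \<beta>) * int \<eta> = 0" "int \<beta> * (2 * int t - 1) * (int k - int \<eta>) = 0"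
      using nn * by (simp_all add: add_nonneg_eq_0_iff)
    then have "\<beta> = t \<or> \<eta> = 0" "\<beta> = 0 \<or> k = \<eta>" using assms(1) by auto
    then show False using ne assms(1) unfolding k_def by auto
  qed
  then show "(2 * t + 1) * (\<beta> + \<eta>) < 2 * e" using le by simp
qed

text \<open>A gadget \<open>(B, ls, (p, y))\<close> consists of the hub \<open>(B, ls)\<close>, whose links \<open>ls\<close> lead to the fixed
  points, and of one more link \<open>(p, y)\<close>. A position is either a point \<open>p\<close> or a hub; the gadget can be
  traversed from \<open>p\<close> to the hub and from the hub to \<open>p\<close>.\<close>

type_synonym 'v gadget = "'v set \<times> ('v \<times> 'v) list \<times> ('v \<times> 'v)"
type_synonym 'v position = "'v + 'v set \<times> ('v \<times> 'v) list"

text \<open>Pairs are oriented from \<open>X\<close> to \<open>Y\<close>, like \<open>E\<close>.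
  Leaving a point brings in a whole hub with all its links, whose ends in \<open>P\<close> are old.
  Leaving a hub brings in one link, and the pairs \<open>{p} \<times> A\<close> supply the edges
  that the new point needs for the balance.\<close>

fun gadget_pairs :: "'v set \<Rightarrow> 'v position \<Rightarrow> 'v gadget \<Rightarrow> ('v \<times> 'v) set" where
  "gadget_pairs A (Inl _) (B, ls, x) = B \<times> (snd ` set (x # ls)) \<union> set (x # ls)"
| "gadget_pairs A (Inr _) (B, ls, (p, y)) = {p} \<times> A \<union> B \<times> {y} \<union> {(p, y)}"

fun gadget_new :: "'v position \<Rightarrow> 'v gadget \<Rightarrow> 'v set" where
  "gadget_new (Inl _) (B, ls, x) = B \<union> snd ` set (x # ls)"
| "gadget_new (Inr _) (B, ls, (p, y)) = {p, y}"

fun gadget_next :: "'v position \<Rightarrow> 'v gadget \<Rightarrow> 'v position" where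
  "gadget_next (Inl _) (B, ls, x) = Inr (B, ls)"
| "gadget_next (Inr _) (B, ls, (p, y)) = Inl p"

fun anchor :: "'v position \<Rightarrow> 'v set" where
  "anchor (Inl p) = {p}"
| "anchor (Inr (B, ls)) = B"

fun gadgets_at :: "'v gadget set \<Rightarrow> 'v position \<Rightarrow> 'v gadget set" where
  "gadgets_at \<Gamma> (Inl p) = {\<gamma> \<in> \<Gamma>. fst (snd (snd \<gamma>)) = p}"
| "gadgets_at \<Gamma> (Inr u) = {\<gamma> \<in> \<Gamma>. (fst \<gamma>, fst (snd \<gamma>)) = u}"

text \<open>At a point the edge to \<open>a\<close> is remembered, as it gives the vertices of the
  next hub their short paths. Nothing is remembered at a hub, since leaving it creates such an edge
  anew.\<close>

fun attached :: "'v \<Rightarrow> 'v position \<Rightarrow> 'v set set \<Rightarrow> bool" where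
  "attached a (Inl p) H \<longleftrightarrow> {p, a} \<in> H"
| "attached a (Inr _) H \<longleftrightarrow> True"

context bipartite
begin

text \<open>The framework \<open>growth\<close> is applied with states alternating between points
  and hubs, \<open>2 * L\<close> moves per walk and \<open>G = 2 * s * t\<close>, which covers the
  deficit of the root graph. The number \<open>z\<close> bounds the vertices of the root graph
  together with \<open>2 * s * t + 1\<close> walks.\<close>

lemma exists_small_dense:
  fixes Q :: "'v list" and \<Gamma> :: "'v gadget set" and L c D\<^sub>P D\<^sub>U :: nat
  defines "s \<equiv> 2 * t + 1"
  defines "z \<equiv> t + t * s + (2 * s * t + 1) * (L * (t + t * s + 2))"
  assumes A: "A \<subseteq> Y" "card A = t"
    and \<Gamma>: "finite \<Gamma>" "\<Gamma> \<noteq> {}" and Q: "set Q \<subseteq> P A" "length Q = t * s - 1"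
    and gadget: "\<And>B ls p y. (B, ls, (p, y)) \<in> \<Gamma> \<Longrightarrow> B \<subseteq> X \<and> card B = t \<and> set ls \<subseteq> links A B \<and>
       (p, y) \<in> links A B \<and> map fst ls = Q \<and> distinct (y # map snd ls)"
    and D\<^sub>P: "\<And>\<gamma>. \<gamma> \<in> \<Gamma> \<Longrightarrow> D\<^sub>P + c \<le> card {\<gamma>' \<in> \<Gamma>. fst (snd (snd \<gamma>')) = fst (snd (snd \<gamma>))}"
    and D\<^sub>U: "\<And>\<gamma>. \<gamma> \<in> \<Gamma> \<Longrightarrow> D\<^sub>U + c \<le> card {\<gamma>' \<in> \<Gamma>. (fst \<gamma>', fst (snd \<gamma>')) = (fst \<gamma>, fst (snd \<gamma>))}"
    and c: "2 ^ z * z ^ (t * s) + z ^ 2 \<le> c" and L: "1 \<le> L"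
    and big: "c ^ (2 * L) * card (P A) < (D\<^sub>P * D\<^sub>U) ^ L"
  obtains H a where "finite H" "finite (\<Union>H)" "H \<subseteq> doubleton ` E" "a \<in> \<Union>H" "\<And>v. v \<in> \<Union>H \<Longrightarrow> near a H v"
    "s * card (\<Union>H) \<le> 2 * card H" "card (\<Union>H) + 2 * s * t \<le> z"
proof -
  have A_ne: "A \<noteq> {}" using A t by auto
  then obtain a0 where a0: "a0 \<in> A" by blast
  have finA: "finite A" using A fin(2) finite_subset by auto
  obtain \<gamma>0 where \<gamma>0: "\<gamma>0 \<in> \<Gamma>" using \<Gamma> by blast
  define p0 where "p0 = fst (snd (snd \<gamma>0))"
  define R where "R = doubleton ` (set (p0 # Q) \<times> A)"
  define S where "S = (\<lambda>i::nat. if even i then Inl ` (\<lambda>\<gamma>. fst (snd (snd \<gamma>))) ` \<Gamma>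
    else Inr ` (\<lambda>\<gamma>. (fst \<gamma>, fst (snd \<gamma>))) ` \<Gamma>)"
  define Good where "Good = (\<lambda>H. H \<subseteq> doubleton ` E \<and> (\<forall>v\<in>\<Union>H. near a0 H v))"
  define D where "D = (\<lambda>i::nat. if even i then D\<^sub>P else D\<^sub>U)"
  define nu where "nu = (\<lambda>i::nat. if even i then t + t * s else 2)"
  have ts: "1 \<le> t * s" using t unfolding s_def by auto
  have linksE: "links A B \<subseteq> P A \<times> Y" "links A B \<subseteq> E" "links A B \<subseteq> X \<times> Y" for B
    using E unfolding links_def P_def by auto
  have PA: "(p, a) \<in> E" if "p \<in> P A" "a \<in> A" for p a using that unfolding P_def by auto
  have pt_P: "fst (snd (snd \<gamma>)) \<in> P A" if "\<gamma> \<in> \<Gamma>" for \<gamma>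
  proof -
    obtain B ls p y where \<gamma>: "\<gamma> = (B, ls, (p, y))" by (cases \<gamma>) auto
    then have "(p, y) \<in> links A B" using gadget that by blast
    then show ?thesis unfolding \<gamma> using linksE(1) by auto
  qed
  have p0Q: "set (p0 # Q) \<subseteq> P A" using pt_P[OF \<gamma>0] Q unfolding p0_def by auto
  have RX: "set (p0 # Q) \<times> A \<subseteq> X \<times> Y" using p0Q A unfolding P_def by auto
  have UR: "\<Union>R = set (p0 # Q) \<union> A" using A_ne unfolding R_def doubleton_def by auto
  \<comment> \<open>\<open>Q\<close> may repeat points or contain \<open>p0\<close>, so only
    \<open>q \<le> t * s\<close> is known. The excess of the root graph is
    \<open>- q - s * t\<close>, hence coincidences reduce the deficit.\<close>
  define q where "q = card (set (p0 # Q))"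
  have "q \<le> length (p0 # Q)" unfolding q_def by (rule card_length)
  then have q: "q \<le> t * s" using Q(2) ts by simp
  have "set (p0 # Q) \<inter> A = {}" using RX disj A_ne A by blast
  then have card_UR: "card (\<Union>R) = q + t" unfolding UR q_def using finA A by (subst card_Un_disjoint) auto
  have card_R: "card R = q * t"
    unfolding R_def q_def using inj_on_doubleton[OF disj RX] A by (simp add: card_image card_cartesian_product)
  have ex_R: "excess s R = - int q - int (s * t)"
    unfolding excess_def card_UR card_R s_def by (simp add: algebra_simps)
  have sum_nu: "sum nu {..<2 * L} = L * (t + t * s + 2)"
    by (induction L) (auto simp: nu_def)
  have prod_D: "prod D {..<2 * L} = (D\<^sub>P * D\<^sub>U) ^ L"
    by (induction L) (auto simp: D_def)
  have pairs: "gadget_pairs A st \<gamma> \<subseteq> E" if "\<gamma> \<in> gadgets_at \<Gamma> st" for st \<gamma>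
  proof -
    obtain B ls p y where \<gamma>: "\<gamma> = (B, ls, (p, y))" by (cases \<gamma>) auto
    have "\<gamma> \<in> \<Gamma>" using that by (cases st) auto
    from gadget[OF this[unfolded \<gamma>]] have g: "set ((p, y) # ls) \<subseteq> links A B" by auto
    then have "B \<times> snd ` set ((p, y) # ls) \<subseteq> E" unfolding links_def by auto
    moreover have "set ((p, y) # ls) \<subseteq> E" using g linksE by blast
    moreover have "p \<in> P A" using g linksE(1)[of B] by auto
    then have "{p} \<times> A \<subseteq> E" using PA by auto
    ultimately show ?thesis unfolding \<gamma> by (cases st) auto
  qed
  have touching: "card {e \<in> doubleton ` gadget_pairs A st \<gamma>. e \<inter> N \<noteq> {}} =
      card {(x, y) \<in> gadget_pairs A st \<gamma>. x \<in> N \<or> y \<in> N}" if "\<gamma> \<in> gadgets_at \<Gamma> st" for st \<gamma> N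
    by (rule card_doubleton_touching[OF disj]) (use pairs[OF that] E in auto)
  have bal: "s * card N \<le> 2 * card {(x, y) \<in> gadget_pairs A st \<gamma>. x \<in> N \<or> y \<in> N} \<and>
     (N \<noteq> {} \<longrightarrow> N \<noteq> gadget_new st \<gamma> \<longrightarrow>
        s * card N < 2 * card {(x, y) \<in> gadget_pairs A st \<gamma>. x \<in> N \<or> y \<in> N})"
    if \<gamma>st: "\<gamma> \<in> gadgets_at \<Gamma> st" and N: "N \<subseteq> gadget_new st \<gamma>" for st \<gamma> N
  proof -
    obtain B ls p y where \<gamma>: "\<gamma> = (B, ls, (p, y))" by (cases \<gamma>) auto
    have "\<gamma> \<in> \<Gamma>" using \<gamma>st by (cases st) auto
    from gadget[OF this[unfolded \<gamma>]] have g: "B \<subseteq> X" "card B = t" "set ((p, y) # ls) \<subseteq> links A B"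
      "map fst ls = Q" "distinct (map snd ((p, y) # ls))" by auto
    have finB: "finite B" using g fin finite_subset by auto
    show ?thesis
    proof (cases st)
      case (Inl p')
      define Ys where "Ys = snd ` set ((p, y) # ls)"
      have "length ls = t * s - 1" using g(4) Q(2) by (metis length_map)
      then have cY: "card Ys = t * s"
        unfolding Ys_def using distinct_card[OF g(5)] ts by simp
      have YsY: "Ys \<subseteq> Y" unfolding Ys_def using g(3) linksE by fastforce
      then have finY: "finite Ys" using fin finite_subset by auto
      have BY: "B \<inter> Ys = {}" using g(1) YsY disj by blast
      have N': "N \<subseteq> B \<union> Ys" using N unfolding \<gamma> Inl Ys_def by simp
      define \<beta> \<eta> where "\<beta> = card (N \<inter> B)" and "\<eta> = card (N \<inter> Ys)"
      have \<beta>: "\<beta> \<le> t" unfolding \<beta>_def using card_mono[OF finB, of "N \<inter> B"] g(2) by auto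
      have \<eta>: "\<eta> \<le> t * s" unfolding \<eta>_def using card_mono[OF finY, of "N \<inter> Ys"] cY by auto
      have "N = (N \<inter> B) \<union> (N \<inter> Ys)" using N' by blast
      then have cN: "card N = \<beta> + \<eta>" unfolding \<beta>_def \<eta>_def
        using card_Un_disjoint[of "N \<inter> B" "N \<inter> Ys"] finB finY BY by auto
      define P1 where "P1 = {(x, y) \<in> B \<times> Ys. x \<in> N \<or> y \<in> N}"
      define P2 where "P2 = {l \<in> set ((p, y) # ls). snd l \<in> N}"
      \<comment> \<open>Counted by complement: the pairs missed by \<open>N\<close> form a
        rectangle. This is the product subtracted in \<open>hub_balance\<close>.\<close>
      have "P1 = B \<times> Ys - (B - N) \<times> (Ys - N)" unfolding P1_def by auto
      then have c1: "card P1 = t * (t * s) - (t - \<beta>) * (t * s - \<eta>)"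
        using finB finY g(2) cY unfolding \<beta>_def \<eta>_def
        by (simp add: card_Diff_subset card_cartesian_product Sigma_mono card_Diff_subset_Int Int_commute)
      have inj: "inj_on snd (set ((p, y) # ls))" using g(5) by (meson distinct_map)
      have "snd ` {l \<in> T. snd l \<in> N} = N \<inter> snd ` T" for T :: "('v \<times> 'v) set" by auto
      then have "snd ` P2 = N \<inter> Ys" unfolding P2_def Ys_def .
      moreover have "inj_on snd P2" using inj by (rule inj_on_subset) (auto simp: P2_def)
      ultimately have c2: "card P2 = \<eta>" unfolding \<eta>_def by (metis card_image)
      have "P1 \<inter> P2 = {}" using g(3) unfolding P1_def P2_def links_def by auto
      moreover have "finite P1" by (rule finite_subset[of _ "B \<times> Ys"]) (auto simp: P1_def finB finY)
      moreover have "finite P2" unfolding P2_def by auto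
      ultimately have "card (P1 \<union> P2) = card P1 + card P2" by (simp add: card_Un_disjoint)
      moreover have sub: "P1 \<union> P2 \<subseteq> {(x, y) \<in> gadget_pairs A st \<gamma>. x \<in> N \<or> y \<in> N}"
        unfolding \<gamma> Inl P1_def P2_def Ys_def by auto
      moreover have "finite {(x, y) \<in> gadget_pairs A st \<gamma>. x \<in> N \<or> y \<in> N}"
        by (rule finite_subset[OF _ finE]) (use pairs[OF \<gamma>st] in auto)
      ultimately have "card P1 + card P2 \<le> card {(x, y) \<in> gadget_pairs A st \<gamma>. x \<in> N \<or> y \<in> N}"
        using card_mono[of "{(x, y) \<in> gadget_pairs A st \<gamma>. x \<in> N \<or> y \<in> N}" "P1 \<union> P2"] by linarith
      then have e: "t * (t * s) - (t - \<beta>) * (t * s - \<eta>) + \<eta> \<le>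
          card {(x, y) \<in> gadget_pairs A st \<gamma>. x \<in> N \<or> y \<in> N}"
        unfolding c1 c2 .
      obtain e0 where e0: "e0 \<le> card {(x, y) \<in> gadget_pairs A st \<gamma>. x \<in> N \<or> y \<in> N}"
        "s * (\<beta> + \<eta>) \<le> 2 * e0"
        "\<beta> + \<eta> \<noteq> 0 \<Longrightarrow> \<beta> + \<eta> \<noteq> t + t * s \<Longrightarrow> s * (\<beta> + \<eta>) < 2 * e0"
        using that[OF e hub_balance[OF t \<beta> \<eta>[unfolded s_def], folded s_def]] by blast
      have full: "N = gadget_new st \<gamma>" if "\<beta> + \<eta> = t + t * s"
      proof -
        have "card N = card (B \<union> Ys)" using that cN BY finB finY g(2) cY by (simp add: card_Un_disjoint)
        then have "N = B \<union> Ys" using N' finB finY by (intro card_subset_eq) auto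
        then show ?thesis unfolding \<gamma> Inl Ys_def gadget_new.simps .
      qed
      have empty: "N = {}" if "\<beta> + \<eta> = 0"
        using that cN finite_subset[OF N'] finB finY by auto
      show ?thesis
      proof (intro conjI impI)
        show "s * card N \<le> 2 * card {(x, y) \<in> gadget_pairs A st \<gamma>. x \<in> N \<or> y \<in> N}"
          unfolding cN using e0(1,2) by linarith
        assume "N \<noteq> {}" "N \<noteq> gadget_new st \<gamma>"
        then have "\<beta> + \<eta> \<noteq> 0" "\<beta> + \<eta> \<noteq> t + t * s" using full empty by blast+
        then show "s * card N < 2 * card {(x, y) \<in> gadget_pairs A st \<gamma>. x \<in> N \<or> y \<in> N}"
          unfolding cN using e0(1) e0(3) by linarith
      qed
    next
      case (Inr u)
      have py: "p \<in> X" "y \<in> Y" "p \<notin> B" "y \<notin> A" using g(3) linksE(3) unfolding links_def by auto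
      have pny: "p \<noteq> y" using py disj by blast
      \<comment> \<open>Each of \<open>p\<close> and \<open>y\<close> lies on \<open>t + 1\<close>
        of the edges, and \<open>2 * (t + 1)\<close> exceeds \<open>s\<close>. Together they lie on
        \<open>2 * t + 1\<close>, because only the link is shared, and this is equality in the
        balance condition.\<close>
      define Pp where "Pp = {p} \<times> A \<union> {(p, y)}"
      define Py where "Py = B \<times> {y} \<union> {(p, y)}"
      have cPp: "card Pp = t + 1" unfolding Pp_def using finA A py
        by (subst card_Un_disjoint) (auto simp: card_cartesian_product)
      have cPy: "card Py = t + 1" unfolding Py_def using finB g(2) py
        by (subst card_Un_disjoint) (auto simp: card_cartesian_product)
      have "Pp \<inter> Py = {(p, y)}" unfolding Pp_def Py_def using py by auto
      moreover have "finite Pp" "finite Py" unfolding Pp_def Py_def using finA finB by auto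
      ultimately have cU: "card (Pp \<union> Py) = 2 * t + 1"
        using card_Un_Int[of Pp Py] cPp cPy by simp
      have finT: "finite {(x, y) \<in> gadget_pairs A st \<gamma>. x \<in> N \<or> y \<in> N}"
        by (rule finite_subset[OF _ finE]) (use pairs[OF \<gamma>st] in auto)
      have Ps: "Pp \<subseteq> gadget_pairs A st \<gamma>" "Py \<subseteq> gadget_pairs A st \<gamma>"
        unfolding \<gamma> Inr Pp_def Py_def by auto
      have N4: "N = {} \<or> N = {p} \<or> N = {y} \<or> N = {p, y}" using N unfolding \<gamma> Inr by auto
      have new: "gadget_new st \<gamma> = {p, y}" unfolding \<gamma> Inr by simp
      consider "N = {}" | "N = {p}" | "N = {y}" | "N = {p, y}" using N4 by blast
      then show ?thesis
      proof cases
        case 2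
        have "Pp \<subseteq> {(x, y) \<in> gadget_pairs A st \<gamma>. x \<in> N \<or> y \<in> N}" using Ps 2 unfolding Pp_def by auto
        from card_mono[OF finT this]
        have "t + 1 \<le> card {(x, y) \<in> gadget_pairs A st \<gamma>. x \<in> N \<or> y \<in> N}" unfolding cPp .
        then show ?thesis using 2 unfolding s_def by simp
      next
        case 3
        have "Py \<subseteq> {(x, y) \<in> gadget_pairs A st \<gamma>. x \<in> N \<or> y \<in> N}" using Ps 3 unfolding Py_def by auto
        from card_mono[OF finT this]
        have "t + 1 \<le> card {(x, y) \<in> gadget_pairs A st \<gamma>. x \<in> N \<or> y \<in> N}" unfolding cPy .
        then show ?thesis using 3 unfolding s_def by simp
      next
        case 4
        have "Pp \<union> Py \<subseteq> {(x, y) \<in> gadget_pairs A st \<gamma>. x \<in> N \<or> y \<in> N}"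
          using Ps 4 unfolding Pp_def Py_def by auto
        from card_mono[OF finT this]
        have "2 * t + 1 \<le> card {(x, y) \<in> gadget_pairs A st \<gamma>. x \<in> N \<or> y \<in> N}" unfolding cU .
        then show ?thesis using 4 pny new unfolding s_def by simp
      qed simp
    qed
  qed
  have \<Gamma>D: "\<gamma> \<in> \<Gamma>" if "\<gamma> \<in> gadgets_at \<Gamma> st" for st \<gamma> using that by (cases st) auto
  have S_cases: "(even i \<and> (\<exists>\<gamma>\<in>\<Gamma>. st = Inl (fst (snd (snd \<gamma>))))) \<or>
      (odd i \<and> (\<exists>\<gamma>\<in>\<Gamma>. st = Inr (fst \<gamma>, fst (snd \<gamma>))))" if "st \<in> S i" for st i
    using that unfolding S_def by (auto split: if_splits)
  have gadgetD: "B \<subseteq> X" "card B = t" "finite B" "B \<noteq> {}" "set (x # ls) \<subseteq> links A B" "map fst ls = Q"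
      "distinct (map snd (x # ls))" if "(B, ls, x) \<in> \<Gamma>" for B ls x
  proof -
    obtain p y where x: "x = (p, y)" by (cases x)
    show "B \<subseteq> X" "card B = t" "set (x # ls) \<subseteq> links A B" "map fst ls = Q" "distinct (map snd (x # ls))"
      using gadget[OF that[unfolded x]] unfolding x by auto
    then show "finite B" "B \<noteq> {}" using fin t finite_subset by auto
  qed
  have finE': "finite (doubleton ` S)" "finite (\<Union>(doubleton ` S))" if "S \<subseteq> E" for S
    using finite_subset[OF that finE] by (auto simp: doubleton_def)
  have RE: "set (p0 # Q) \<times> A \<subseteq> E" using p0Q PA by blast
  have R_near: "{q, a0} \<in> R" if "q \<in> set (p0 # Q)" for q
    unfolding R_def using that a0 by (intro doubleton_imageI) auto
  have Good_R: "Good R" unfolding Good_def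
  proof (intro conjI ballI)
    show "R \<subseteq> doubleton ` E" unfolding R_def using RE by auto
    fix v assume "v \<in> \<Union>R"
    then consider "v \<in> set (p0 # Q)" | "v \<in> A" unfolding UR by auto
    then show "near a0 R v"
    proof cases
      case 1
      then show ?thesis using R_near unfolding near_def by auto
    next
      case 2
      then have "{v, p0} \<in> R" unfolding R_def by (intro doubleton_imageI) auto
      then show ?thesis using R_near[of p0] unfolding near_def by auto
    qed
  qed
  have few: "card {\<gamma> \<in> gadgets_at \<Gamma> st. gadget_new st \<gamma> \<subseteq> Z} \<le> c"
    if Z: "finite Z" "card Z \<le> z" for st Z
  proof (cases st)
    case (Inl p)
    define K where "K = {\<gamma> \<in> gadgets_at \<Gamma> st. gadget_new st \<gamma> \<subseteq> Z}"
    define h where "h = (\<lambda>(B :: 'v set, ls :: ('v \<times> 'v) list, x :: 'v \<times> 'v). (B, map snd (x # ls)))"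
    define W where "W = Pow Z \<times> {ys. set ys \<subseteq> Z \<and> length ys = t * s}"
    \<comment> \<open>The start \<open>p\<close> determines the first component of \<open>x\<close>
      and \<open>Q\<close> those of \<open>ls\<close>, so a gadget is known from \<open>B\<close>
      and its list of middle vertices. Inside \<open>z\<close> vertices this allows at most
      \<open>2 ^ z * z ^ (t * s)\<close> choices; when leaving a hub, the link alone allows at most
      \<open>z ^ 2\<close>.\<close>
    have inj: "inj_on h K"
    proof (rule inj_onI)
      fix \<gamma> \<gamma>' assume K: "\<gamma> \<in> K" "\<gamma>' \<in> K" and h: "h \<gamma> = h \<gamma>'"
      obtain B ls x B' ls' x' where \<gamma>: "\<gamma> = (B, ls, x)" "\<gamma>' = (B', ls', x')" by (cases \<gamma>; cases \<gamma>') auto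
      have "fst x = p" "fst x' = p" and mem: "(B, ls, x) \<in> \<Gamma>" "(B', ls', x') \<in> \<Gamma>"
        using K unfolding K_def \<gamma> Inl by auto
      moreover have "map fst ls = map fst ls'" using gadgetD(6) mem by metis
      moreover have "B = B'" "map snd ls = map snd ls'" "snd x = snd x'"
        using h unfolding \<gamma> h_def by auto
      moreover have "ls = ls'" using calculation by (metis zip_map_fst_snd)
      ultimately show "\<gamma> = \<gamma>'" unfolding \<gamma> by (auto simp: prod_eq_iff)
    qed
    have "h ` K \<subseteq> W"
    proof
      fix w assume "w \<in> h ` K"
      then obtain B ls x where w: "w = (B, map snd (x # ls))" "(B, ls, x) \<in> K" unfolding h_def by auto
      then have "(B, ls, x) \<in> \<Gamma>" and new: "B \<union> snd ` set (x # ls) \<subseteq> Z" unfolding K_def Inl by auto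
      then have "length ls = t * s - 1" using gadgetD(6) Q(2) by (metis length_map)
      then show "w \<in> W" using w new ts unfolding W_def by auto
    qed
    moreover have "finite W" unfolding W_def using Z(1) finite_lists_length_eq[OF Z(1)] by auto
    ultimately have "card K \<le> card W" using inj card_inj_on_le by blast
    also have "\<dots> = 2 ^ card Z * card Z ^ (t * s)"
      unfolding W_def card_cartesian_product using card_Pow[OF Z(1)] card_lists_length_eq[OF Z(1)] by simp
    also have "\<dots> \<le> 2 ^ z * z ^ (t * s)"
      using Z(2) by (intro mult_mono power_mono power_increasing) auto
    finally show ?thesis using c unfolding K_def by linarith
  next
    case (Inr u)
    define K where "K = {\<gamma> \<in> gadgets_at \<Gamma> st. gadget_new st \<gamma> \<subseteq> Z}"
    have "inj_on (\<lambda>\<gamma>. snd (snd \<gamma>)) K" unfolding K_def Inr by (auto simp: inj_on_def)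
    moreover have "(\<lambda>\<gamma>. snd (snd \<gamma>)) ` K \<subseteq> Z \<times> Z" unfolding K_def Inr by auto
    ultimately have "card K \<le> card (Z \<times> Z)" using Z(1) by (intro card_inj_on_le) auto
    also have "\<dots> = card Z ^ 2" by (simp add: card_cartesian_product power2_eq_square)
    also have "\<dots> \<le> z ^ 2" using Z(2) by (rule power_mono) simp
    finally show ?thesis using c unfolding K_def by linarith
  qed
  have zge: "card (\<Union>R) + (2 * s * t + 1) * sum nu {..<2 * L} \<le> z"
    unfolding card_UR sum_nu z_def using q by simp
  interpret growth s "2 * s * t" c "2 * L" Good "attached a0" R "Inl p0" S "gadgets_at \<Gamma>"
    "\<lambda>st \<gamma>. doubleton ` gadget_pairs A st \<gamma>" gadget_new gadget_next anchor D nu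
  proof (rule growth.intro)
    show "finite R" "finite (\<Union>R)" unfolding R_def using finE'[OF RE] by auto
    show "Inl p0 \<in> S 0" unfolding S_def p0_def using \<gamma>0 by auto
    show "anchor (Inl p0) \<subseteq> \<Union>R" unfolding UR by auto
    show "Good R" by (rule Good_R)
    show "attached a0 (Inl p0) R" using R_near by simp
    show "0 < nu i" for i unfolding nu_def using t by simp
    show "attached a0 st H'" if "attached a0 st H" "H \<subseteq> H'" for st H H' using that by (cases st) auto
    fix i st assume st: "st \<in> S i"
    show "anchor st \<noteq> {}" using S_cases[OF st] gadgetD(4) by force
    show "finite (gadgets_at \<Gamma> st)" using \<Gamma>(1) by (cases st) auto
    show "card {\<gamma> \<in> gadgets_at \<Gamma> st. gadget_new st \<gamma> \<subseteq> Z} \<le> c"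
      if "finite Z" "card Z \<le> card (\<Union>R) + (2 * s * t + 1) * sum nu {..<2 * L}" for Z
      using few that zge by simp
    show "D i + c \<le> card (gadgets_at \<Gamma> st)"
      using S_cases[OF st] D\<^sub>P D\<^sub>U unfolding D_def by auto
    fix \<gamma> assume \<gamma>st: "\<gamma> \<in> gadgets_at \<Gamma> st"
    obtain B ls x where \<gamma>: "\<gamma> = (B, ls, x)" by (cases \<gamma>) auto
    obtain p y where x: "x = (p, y)" by (cases x) auto
    have mem: "(B, ls, x) \<in> \<Gamma>" using \<Gamma>D[OF \<gamma>st] unfolding \<gamma> .
    note g = gadgetD[OF mem]
    have parity: "even i \<longleftrightarrow> isl st" using S_cases[OF st] by auto
    have u: "st = Inr u \<Longrightarrow> u = (B, ls)" and p: "st = Inl p' \<Longrightarrow> p' = p" for u p'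
      using \<gamma>st unfolding \<gamma> x by auto
    show "gadget_next st \<gamma> \<in> S (Suc i)"
      using parity mem unfolding \<gamma> S_def by (cases st; cases x) (force simp: image_iff)+
    show "finite (doubleton ` gadget_pairs A st \<gamma>)" "finite (\<Union>(doubleton ` gadget_pairs A st \<gamma>))"
      using finE'[OF pairs[OF \<gamma>st]] by auto
    have lsQ: "fst ` set ls = set Q" using g(6) by (metis set_map)
    have Un: "\<Union>(doubleton ` gadget_pairs A st \<gamma>) =
      (case st of Inl p' \<Rightarrow> B \<union> snd ` set (x # ls) \<union> insert p (set Q) | Inr u \<Rightarrow> {p, y} \<union> B \<union> A)"
    proof (cases st)
      case (Inl p')
      have "fst ` set ((p, y) # ls) = insert p (set Q)" using lsQ by simp
      then show ?thesis using g(4) unfolding Inl \<gamma> x Union_doubleton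
        by (simp only: gadget_pairs.simps image_Un fst_image_times snd_image_times sum.case) auto
    next
      case (Inr u)
      show ?thesis using g(4) A_ne unfolding Inr \<gamma> x Union_doubleton by (auto simp: image_Un)
    qed
    show "\<Union>(doubleton ` gadget_pairs A st \<gamma>) \<subseteq> gadget_new st \<gamma> \<union> anchor st \<union> \<Union>R"
      using p u unfolding Un unfolding UR \<gamma> x by (cases st) auto
    show "gadget_new st \<gamma> \<subseteq> \<Union>(doubleton ` gadget_pairs A st \<gamma>)"
      unfolding Un unfolding \<gamma> x by (cases st) auto
    show "anchor st \<subseteq> \<Union>(doubleton ` gadget_pairs A st \<gamma>)"
      using p u unfolding Un by (cases st) auto
    show "anchor (gadget_next st \<gamma>) \<subseteq> gadget_new st \<gamma>"
      unfolding \<gamma> x by (cases st) auto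
    show "e \<inter> gadget_new st \<gamma> \<noteq> {}" if "e \<in> doubleton ` gadget_pairs A st \<gamma>" for e
      using that unfolding \<gamma> x by (cases st) (auto simp: doubleton_def)
    show "s * card N \<le> 2 * card {e \<in> doubleton ` gadget_pairs A st \<gamma>. e \<inter> N \<noteq> {}}"
      if "N \<subseteq> gadget_new st \<gamma>" for N
      using bal[OF \<gamma>st that] unfolding touching[OF \<gamma>st] by blast
    show "s * card N < 2 * card {e \<in> doubleton ` gadget_pairs A st \<gamma>. e \<inter> N \<noteq> {}}"
      if "N \<subset> gadget_new st \<gamma>" "N \<noteq> {}" for N
      using bal[OF \<gamma>st, of N] that unfolding touching[OF \<gamma>st] by blast
    show "card (gadget_new st \<gamma>) \<le> nu i"
    proof (cases st)
      case (Inl p')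
      have "card (snd ` set (x # ls)) \<le> length (map snd (x # ls))" by (metis card_length set_map)
      moreover have "length ls = t * s - 1" using g(6) Q(2) by (metis length_map)
      ultimately have "card (snd ` set (x # ls)) \<le> t * s" using ts by simp
      then show ?thesis using card_Un_le[of B "snd ` set (x # ls)"] g(2) parity
        unfolding \<gamma> Inl nu_def by simp
    next
      case (Inr u)
      then show ?thesis using parity card_insert_le_m1[of 2 "{y}" p] unfolding \<gamma> x nu_def by simp
    qed
    fix H assume H: "R \<subseteq> H" "anchor st \<subseteq> \<Union>H" "Good H" "attached a0 st H"
    define H' where "H' = H \<union> doubleton ` gadget_pairs A st \<gamma>"
    have sub: "H \<subseteq> H'" unfolding H'_def by auto
    have old: "near a0 H' v" if "v \<in> \<Union>H" for v
      using H(3) that near_mono[OF _ sub] unfolding Good_def by blast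
    have edge: "{v, w} \<in> H'" "{w, v} \<in> H'" if "(v, w) \<in> gadget_pairs A st \<gamma>" for v w
      unfolding H'_def using doubleton_imageI[OF that] by auto
    have nearp: "{p, a0} \<in> H'"
    proof (cases st)
      case (Inl p')
      then show ?thesis using p H(4) sub by auto
    next
      case (Inr u)
      then show ?thesis using edge(1)[of p a0] a0 unfolding \<gamma> x by auto
    qed
    have nearQ: "{q, a0} \<in> H'" if "q \<in> set (p # Q)" for q
      using that nearp R_near[of q] H(1) sub by auto
    have new: "near a0 H' v" if "v \<in> gadget_new st \<gamma>" for v
    proof (cases st)
      case (Inl p')
      have link: "near a0 H' w \<and> (\<exists>q. {w, q} \<in> H' \<and> {q, a0} \<in> H')" if "w \<in> snd ` set (x # ls)" for w
      proof -
        obtain q where q: "(q, w) \<in> set (x # ls)"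
          using \<open>w \<in> snd ` set (x # ls)\<close> by (metis imageE prod.collapse)
        have "fst ` set (x # ls) = set (p # Q)" unfolding x using lsQ by simp
        then have "q \<in> set (p # Q)" using imageI[OF q, of fst] by simp
        moreover have "{w, q} \<in> H'" using edge(2)[of q w] q unfolding \<gamma> Inl by auto
        ultimately show ?thesis using nearQ unfolding near_def by blast
      qed
      show ?thesis
      proof (cases "v \<in> B")
        case True
        have "{v, y} \<in> H'" using edge(1)[of v y] True unfolding \<gamma> Inl x by auto
        then show ?thesis using link[of y] unfolding near_def x by auto
      next
        case False
        then show ?thesis using that link unfolding \<gamma> Inl by auto
      qed
    next
      case (Inr u)
      have "{y, p} \<in> H'" using edge(2)[of p y] unfolding \<gamma> Inr x by auto
      then have "near a0 H' y" "near a0 H' p" using nearp unfolding near_def by blast+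
      then show ?thesis using that unfolding \<gamma> Inr x by auto
    qed
    have "near a0 H' v" if "v \<in> \<Union>H'" for v
    proof -
      have "v \<in> gadget_new st \<gamma> \<union> \<Union>H"
        using that \<open>\<Union>(doubleton ` gadget_pairs A st \<gamma>) \<subseteq> gadget_new st \<gamma> \<union> anchor st \<union> \<Union>R\<close> H(1,2)
        unfolding H'_def by blast
      then show ?thesis using old new by blast
    qed
    moreover have "H' \<subseteq> doubleton ` E" using H(3) pairs[OF \<gamma>st] unfolding Good_def H'_def by blast
    ultimately have "Good H'" unfolding Good_def by blast
    moreover have "attached a0 (gadget_next st \<gamma>) H'"
      using nearp unfolding \<gamma> x by (cases st) auto
    ultimately show "Good (H \<union> doubleton ` gadget_pairs A st \<gamma>) \<and>
        attached a0 (gadget_next st \<gamma>) (H \<union> doubleton ` gadget_pairs A st \<gamma>)"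
      unfolding H'_def by blast
  qed
  have "finite (S (2 * L))" unfolding S_def using \<Gamma>(1) by auto
  moreover have "c ^ (2 * L) * card (S (2 * L)) < prod D {..<2 * L}"
  proof -
    have "card (S (2 * L)) = card ((\<lambda>\<gamma>. fst (snd (snd \<gamma>))) ` \<Gamma>)"
      unfolding S_def by (simp add: card_image)
    also have "\<dots> \<le> card (P A)" using pt_P finP by (intro card_mono) auto
    finally have "c ^ (2 * L) * card (S (2 * L)) \<le> c ^ (2 * L) * card (P A)" by simp
    then show ?thesis using big unfolding prod_D by linarith
  qed
  ultimately obtain H where H: "dense H" using exists_dense L by auto
  have "a0 \<in> \<Union>R" unfolding UR using a0 by auto
  then have "a0 \<in> \<Union>H" using H unfolding dense_def by blast
  moreover have "s * card (\<Union>H) \<le> 2 * card H"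
  proof -
    have "excess s R + int (2 * s * t) \<le> excess s H" using H unfolding dense_def by blast
    moreover have "int q \<le> int (s * t)" using q mult.commute[of t s] by (simp only: of_nat_le_iff)
    ultimately have "0 \<le> excess s H" unfolding ex_R by simp
    then have "int (s * card (\<Union>H)) \<le> int (2 * card H)" unfolding excess_def by simp
    then show ?thesis by (simp only: of_nat_le_iff)
  qed
  moreover have "card (\<Union>H) + 2 * s * t \<le> z"
  proof -
    have "card (\<Union>H) \<le> card (\<Union>R) + (2 * s * t + 1) * sum nu {..<2 * L} - 2 * s * t"
      using H unfolding dense_def by blast
    moreover have "2 * s * t \<le> (2 * s * t + 1) * sum nu {..<2 * L}"
    proof -
      have "1 \<le> sum nu {..<2 * L}" unfolding sum_nu using L by simp
      then have "(2 * s * t + 1) * 1 \<le> (2 * s * t + 1) * sum nu {..<2 * L}" by (rule mult_left_mono) simp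
      then show ?thesis by simp
    qed
    ultimately show ?thesis using q unfolding card_UR z_def sum_nu by linarith
  qed
  moreover have "finite H" "finite (\<Union>H)" "Good H" using H unfolding dense_def by auto
  ultimately show ?thesis unfolding Good_def by (intro that[of H a0]) auto
qed

end

section \<open>From degrees to the numerical conditions\<close>

context bipartite
begin

text \<open>\<open>V\<close> is \<open>\<tau> A / (8 * card (P A))\<close>, which does not depend on
  \<open>A\<close>. \<open>W\<close> bounds the number of moves out of a point from below,
  \<open>card (P A) * V\<close> that of moves out of a hub, and \<open>\<pi>\<close> bounds
  \<open>card (P A)\<close>. The factor \<open>card (P A)\<close> for the possible ends cancels one
  of the \<open>L\<close> such factors from the hub moves, which leaves the exponent
  \<open>L - 1\<close> on \<open>\<pi>\<close>.\<close>

lemma exists_small_dense_of_bounds: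
  fixes L c :: nat
  defines "s \<equiv> 2 * t + 1"
  defines "z \<equiv> t + t * s + (2 * s * t + 1) * (L * (t + t * s + 2))"
  defines "V \<equiv> d ^ (t + 1) / (16 * (2 * real t) ^ t * real n ^ t)"
  defines "W \<equiv> real n ^ t * (V / 2) ^ (t * s) / 3"
  defines "\<pi> \<equiv> (d / t) ^ t / real n ^ (t - 1)"
  assumes c: "2 ^ z * z ^ (t * s) + z ^ 2 \<le> c" and L: "1 \<le> L"
    and W: "2 * (real c + 1) \<le> W" and V: "2 * (real c + 1) \<le> \<pi> * V" "real (t * s) * M \<le> 2 * \<pi> * V"
    and big: "real c ^ (2 * L) < \<pi> ^ (L - 1) * (W * V / 4) ^ L"
  obtains H a where "finite H" "finite (\<Union>H)" "H \<subseteq> doubleton ` E" "a \<in> \<Union>H" "\<And>v. v \<in> \<Union>H \<Longrightarrow> near a H v"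
    "s * card (\<Union>H) \<le> 2 * card H" "card (\<Union>H) + 2 * s * t \<le> z"
proof -
  have n0: "0 < real n" using n_pos by simp
  have d0: "0 < d" using d t by simp
  have V0: "0 < V" unfolding V_def using n0 d0 t by simp
  have W0: "0 < W" unfolding W_def using n0 V0 by simp
  have \<pi>0: "0 < \<pi>" unfolding \<pi>_def using n0 d0 t by simp
  have k: "1 \<le> t * s" using t unfolding s_def by simp
  obtain A where A: "A \<subseteq> Y" "card A = t" "(d / t) ^ t \<le> card (P A) * real n ^ (t - 1)"
    using exists_large_P[of t] t d by auto
  have P: "\<pi> \<le> card (P A)" unfolding \<pi>_def using A(3) n0 by (simp add: divide_le_eq)
  then have P0: "0 < real (card (P A))" using \<pi>0 by linarith
  have \<tau>: "\<tau> A = 8 * card (P A) * V"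
    unfolding \<tau>_def V_def by (simp add: power_divide power_mult_distrib ac_simps)
  have PV: "\<pi> * V \<le> card (P A) * V" using P V0 by (intro mult_right_mono) auto
  have \<tau>0: "0 < \<tau> A" unfolding \<tau> using P0 V0 by simp
  have \<tau>M: "4 * real (t * s) * M \<le> \<tau> A" using V(2) PV unfolding \<tau> by linarith
  have W_eq: "real n ^ t * (\<tau> A / 4) ^ (t * s) / (3 * real (card (P A)) ^ (t * s)) \<ge> W"
  proof -
    have "real n ^ t * (\<tau> A / 4) ^ (t * s) / (3 * real (card (P A)) ^ (t * s)) =
        real n ^ t * ((\<tau> A / 4) / card (P A)) ^ (t * s) / 3"
      by (simp add: power_divide)
    also have "(\<tau> A / 4) / card (P A) = 2 * V" unfolding \<tau> using P0 by simp
    also have "real n ^ t * (2 * V) ^ (t * s) / 3 \<ge> W"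
      unfolding W_def using V0 by (intro divide_right_mono mult_left_mono power_mono) auto
    finally show ?thesis .
  qed
  obtain Q \<Gamma> where \<Gamma>: "finite \<Gamma>" "\<Gamma> \<noteq> {}" "set Q \<subseteq> P A" "length Q = t * s - 1"
    "\<And>B ls p y. (B, ls, (p, y)) \<in> \<Gamma> \<Longrightarrow> B \<subseteq> X \<and> card B = t \<and> set ls \<subseteq> links A B \<and>
       (p, y) \<in> links A B \<and> map fst ls = Q \<and> distinct (y # map snd ls)"
    "\<And>\<gamma>. \<gamma> \<in> \<Gamma> \<Longrightarrow> real n ^ t * (\<tau> A / 4) ^ (t * s) / (3 * real (card (P A)) ^ (t * s))
       \<le> card {\<gamma>' \<in> \<Gamma>. fst (snd (snd \<gamma>')) = fst (snd (snd \<gamma>))}"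
    "\<And>\<gamma>. \<gamma> \<in> \<Gamma> \<Longrightarrow> \<tau> A / 8 \<le> card {\<gamma>' \<in> \<Gamma>. (fst \<gamma>', fst (snd \<gamma>')) = (fst \<gamma>, fst (snd \<gamma>))}"
    by (rule exists_gadgets[OF A(1,2) k \<tau>0 \<tau>M]) (rule that; assumption)
  \<comment> \<open>Rounding down and giving up \<open>c\<close> moves still leaves half:
    \<open>x - 1 - c \<ge> x / 2\<close> means \<open>x \<ge> 2 * (c + 1)\<close>.\<close>
  define N where "N = (\<lambda>x :: real. nat \<lfloor>x\<rfloor> - c :: nat)"
  have N: "real (N x) \<ge> x / 2" "real m \<ge> x \<Longrightarrow> N x + c \<le> m" if "2 * (real c + 1) \<le> x" for x m
  proof -
    define f where "f = nat \<lfloor>x\<rfloor>"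
    have c0: "0 \<le> real c" by simp
    then have "0 \<le> x" using that by argo
    then have f: "x - 1 < real f" "real f \<le> x" unfolding f_def
      using of_nat_floor[of x] by linarith+
    have "real c \<le> real f" using f(1) that c0 by argo
    then have cf: "c \<le> f" by simp
    then have "real (N x) = real f - c" unfolding N_def f_def[symmetric] by (simp add: of_nat_diff)
    then show "real (N x) \<ge> x / 2" using f(1) that by argo
    assume "real m \<ge> x"
    then have "f \<le> m" using f(2) by linarith
    then show "N x + c \<le> m" unfolding N_def f_def[symmetric] using cf by simp
  qed
  define DP where "DP = N W"
  define DU where "DU = N (card (P A) * V)"
  have V': "2 * (real c + 1) \<le> card (P A) * V" using V(1) PV by linarith
  have "real (c ^ (2 * L) * card (P A)) < \<pi> ^ (L - 1) * (W * V / 4) ^ L * card (P A)"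
    using big P0 by simp
  also have "\<dots> \<le> real (card (P A)) ^ (L - 1) * (W * V / 4) ^ L * card (P A)"
    using P \<pi>0 W0 V0 by (intro mult_right_mono power_mono) auto
  also have "\<dots> = real (card (P A)) ^ L * (W * V / 4) ^ L" using L by (cases L) auto
  also have "\<dots> = (W / 2 * (card (P A) * V / 2)) ^ L"
    by (simp add: power_mult_distrib[symmetric] mult.assoc mult.left_commute)
  also have "\<dots> \<le> (real DP * real DU) ^ L"
    using N(1)[OF W] N(1)[OF V'] W0 V0 P0 unfolding DP_def DU_def
    by (intro power_mono mult_mono) auto
  also have "\<dots> = real ((DP * DU) ^ L)" by simp
  finally have D: "c ^ (2 * L) * card (P A) < (DP * DU) ^ L" by (simp only: of_nat_less_iff)
  show ?thesis
  proof (rule exists_small_dense[OF A(1,2) \<Gamma>(1-3) _ \<Gamma>(5) _ _ c[unfolded z_def s_def] L D])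
    show "length Q = t * (2 * t + 1) - 1" using \<Gamma>(4) unfolding s_def .
    show "DP + c \<le> card {\<gamma>' \<in> \<Gamma>. fst (snd (snd \<gamma>')) = fst (snd (snd \<gamma>))}" if "\<gamma> \<in> \<Gamma>" for \<gamma>
      unfolding DP_def using \<Gamma>(6)[OF that] W_eq by (intro N(2)[OF W]) linarith
    show "DU + c \<le> card {\<gamma>' \<in> \<Gamma>. (fst \<gamma>', fst (snd \<gamma>')) = (fst \<gamma>, fst (snd \<gamma>))}" if "\<gamma> \<in> \<Gamma>" for \<gamma>
      unfolding DU_def using \<Gamma>(7)[OF that] \<tau> by (intro N(2)[OF V']) simp
  next
    fix H a
    assume H: "finite H" "finite (\<Union>H)" "H \<subseteq> doubleton ` E" "a \<in> \<Union>H" "\<And>v. v \<in> \<Union>H \<Longrightarrow> near a H v"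
      "(2 * t + 1) * card (\<Union>H) \<le> 2 * card H"
      "card (\<Union>H) + 2 * (2 * t + 1) * t \<le>
        t + t * (2 * t + 1) + (2 * (2 * t + 1) * t + 1) * (L * (t + t * (2 * t + 1) + 2))"
    show thesis
      by (rule that[OF H(1-5)]) (use H(6,7) in \<open>simp_all only: z_def s_def\<close>)
  qed
qed

text \<open>The averaging argument for \<open>t + 1\<close> instead of \<open>t\<close> vertices
  meets the bound \<open>M\<close>. For small \<open>r\<close> this alone is contradictory.\<close>

lemma degree_bound: "(d / (t + 1)) ^ (t + 1) \<le> M * real n ^ t"
proof -
  obtain A where A: "A \<subseteq> Y" "card A = t + 1" "(d / (t + 1)) ^ (t + 1) \<le> card (P A) * real n ^ t"
    using exists_large_P[of "t + 1"] t d by (auto simp: add.commute)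
  have "card (P A) \<le> M" unfolding P_def by (rule no_biclique[OF A(1,2)])
  then have "card (P A) * real n ^ t \<le> M * real n ^ t" by (intro mult_right_mono) auto
  then show ?thesis using A(3) by linarith
qed

end

text \<open>Sides of \<open>t + 1\<close> and \<open>s * (t + 1)\<close> vertices give
  \<open>s * (t + 1)^2\<close> edges on \<open>(t + 1) * (s + 1) = 2 * (t + 1)^2\<close> vertices,
  which is average degree exactly \<open>s\<close>.\<close>

lemma biclique_dense:
  fixes t :: nat
  defines "s \<equiv> 2 * t + 1"
  assumes "finite X" "X \<inter> Y = {}" "A \<subseteq> Y" "card A = t + 1"
    and "s * (t + 1) < card {x \<in> X. \<forall>a\<in>A. (x, a) \<in> E}"
  obtains H a where "finite H" "finite (\<Union>H)" "H \<subseteq> doubleton ` E" "a \<in> \<Union>H" "\<And>v. v \<in> \<Union>H \<Longrightarrow> near a H v"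
    "s * card (\<Union>H) \<le> 2 * card H" "card (\<Union>H) = (t + 1) * (s + 1)"
proof -
  obtain B where B: "B \<subseteq> {x \<in> X. \<forall>a\<in>A. (x, a) \<in> E}" "card B = s * (t + 1)"
    using assms(6) by (meson less_imp_le obtain_subset_with_card_n)
  have "finite A" using assms(5) by (metis add_is_0 card.infinite one_neq_zero)
  have BX: "B \<subseteq> X" using B by auto
  have finB: "finite B" using B assms(2) by (auto intro: finite_subset)
  have ne: "A \<noteq> {}" "B \<noteq> {}" using assms(5) B(2) by (auto simp: s_def)
  define H where "H = doubleton ` (B \<times> A)"
  have UH: "\<Union>H = B \<union> A" unfolding H_def Union_doubleton using ne by auto
  have AB: "B \<inter> A = {}" using BX assms by blast
  have cU: "card (\<Union>H) = (t + 1) * (s + 1)"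
    unfolding UH using finB \<open>finite A\<close> AB assms(5) B(2) by (simp add: card_Un_disjoint algebra_simps)
  have "inj_on doubleton (B \<times> A)" by (rule inj_on_doubleton[of B A]) (use AB in auto)
  then have cH: "card H = s * (t + 1) * (t + 1)"
    unfolding H_def using B(2) assms(5) by (simp add: card_image card_cartesian_product)
  obtain a b where ab: "a \<in> A" "b \<in> B" using ne by blast
  have pa: "{p, w} \<in> H" "{w, p} \<in> H" if "p \<in> B" "w \<in> A" for p w
    unfolding H_def using doubleton_imageI[of p w "B \<times> A"] that by auto
  show ?thesis
  proof (rule that[of H a])
    show "finite H" unfolding H_def using finB \<open>finite A\<close> by auto
    show "finite (\<Union>H)" unfolding UH using finB \<open>finite A\<close> by auto
    show "H \<subseteq> doubleton ` E" unfolding H_def using B by auto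
    show "a \<in> \<Union>H" unfolding UH using ab by auto
    show "near a H v" if "v \<in> \<Union>H" for v
      using that ab pa unfolding UH near_def by blast
    show "s * card (\<Union>H) \<le> 2 * card H" unfolding cU cH s_def by (simp add: algebra_simps)
  qed (rule cU)
qed

text \<open>The cut keeps half of the arcs and its better orientation half of those, so
  \<open>card A / 4\<close> remain. The two degree thresholds on at most \<open>card V\<close>
  vertices each use up \<open>card A / 8\<close> in total; hence the 16. Reversing \<open>E\<close>,
  if necessary, makes \<open>X\<close> the larger side.\<close>

lemma exists_bipartite_min_degree:
  fixes V :: "'v set" and A :: "('v \<times> 'v) set"
  assumes "finite V" "A \<subseteq> V \<times> V" "\<And>v. (v, v) \<notin> A" "\<And>u v. (u, v) \<in> A \<Longrightarrow> (v, u) \<in> A" "A \<noteq> {}"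
  obtains X Y E where "X \<subseteq> V" "Y \<subseteq> V" "X \<inter> Y = {}" "E \<subseteq> X \<times> Y" "E \<subseteq> A" "X \<noteq> {}" "card Y \<le> card X"
    "\<And>x. x \<in> X \<Longrightarrow> real (card A) / (16 * card V) \<le> card {y. (x, y) \<in> E}"
    "\<And>y. y \<in> Y \<Longrightarrow> real (card A) / (16 * card V) \<le> card {x. (x, y) \<in> E}"
proof -
  define d where "d = real (card A) / (16 * card V)"
  have finA: "finite A" using assms finite_subset by fast
  have cA: "0 < card A" using finA assms(5) by (simp add: card_gt_0_iff)
  have "V \<noteq> {}" using assms(2,5) by auto
  then have cV: "0 < card V" using assms(1) by (simp add: card_gt_0_iff)
  obtain S where S: "card A \<le> 2 * card {(u, v) \<in> A. (u \<in> S) \<noteq> (v \<in> S)}"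
    using exists_large_cut[OF assms(1-3)] by blast
  define cut where "cut = (\<lambda>S. {(u, v) \<in> A. u \<in> S \<and> v \<notin> S})"
  have "{(u, v) \<in> A. (u \<in> S) \<noteq> (v \<in> S)} = cut S \<union> cut (- S)" unfolding cut_def by auto
  then have "card {(u, v) \<in> A. (u \<in> S) \<noteq> (v \<in> S)} \<le> card (cut S) + card (cut (- S))"
    by (metis card_Un_le)
  then have "card A \<le> 4 * card (cut S) \<or> card A \<le> 4 * card (cut (- S))" using S by linarith
  then obtain S where S: "card A \<le> 4 * card (cut S)" by blast
  have fcut: "finite (cut S)" unfolding cut_def by (rule finite_subset[OF _ finA]) auto
  have img: "fst ` cut S \<subseteq> V" "snd ` cut S \<subseteq> V" using assms(2) unfolding cut_def by auto
  have d0: "0 \<le> d" unfolding d_def by simp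
  have "card (fst ` cut S) \<le> card V" "card (snd ` cut S) \<le> card V"
    using img assms(1) by (auto intro: card_mono)
  then have "d * card (fst ` cut S) + d * card (snd ` cut S) \<le> d * card V + d * card V"
    using d0 by (intro add_mono mult_left_mono) auto
  also have "\<dots> = card A / 8" unfolding d_def using cV by simp
  also have "\<dots> < card (cut S)" using S cA by linarith
  finally obtain E where E: "E \<subseteq> cut S" "E \<noteq> {}"
    "\<And>e. e \<in> E \<Longrightarrow> d \<le> card {e' \<in> E. fst e' = fst e}"
    "\<And>e. e \<in> E \<Longrightarrow> d \<le> card {e' \<in> E. snd e' = snd e}"
    using exists_dense_fibers[OF fcut d0 d0] by blast
  have degX: "d \<le> card {y. (x, y) \<in> E}" if "x \<in> fst ` E" for x
  proof -
    obtain e where e: "e \<in> E" "x = fst e" using \<open>x \<in> fst ` E\<close> by blast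
    have "{e' \<in> E. fst e' = fst e} = Pair x ` {y. (x, y) \<in> E}" using e by force
    then have "card {e' \<in> E. fst e' = fst e} = card {y. (x, y) \<in> E}"
      by (simp add: card_image inj_on_def)
    then show ?thesis using E(3)[OF e(1)] by simp
  qed
  have degY: "d \<le> card {x. (x, y) \<in> E}" if "y \<in> snd ` E" for y
  proof -
    obtain e where e: "e \<in> E" "y = snd e" using \<open>y \<in> snd ` E\<close> by blast
    have "{e' \<in> E. snd e' = snd e} = (\<lambda>x. (x, y)) ` {x. (x, y) \<in> E}" using e by force
    then have "card {e' \<in> E. snd e' = snd e} = card {x. (x, y) \<in> E}"
      by (simp add: card_image inj_on_def)
    then show ?thesis using E(4)[OF e(1)] by simp
  qed
  have "E \<subseteq> A" using E(1) unfolding cut_def by auto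
  then have sub: "fst ` E \<subseteq> V" "snd ` E \<subseteq> V" "E \<subseteq> A" using assms(2) by auto
  have "fst ` E \<subseteq> S" "snd ` E \<subseteq> - S" using E(1) unfolding cut_def by auto
  then have disj: "fst ` E \<inter> snd ` E = {}" by blast
  have EA: "E\<inverse> \<subseteq> A" using sub(3) assms(4) by auto
  show ?thesis
  proof (cases "card (snd ` E) \<le> card (fst ` E)")
    case True
    show ?thesis
      using degX degY sub disj E(2) True unfolding d_def
      by (intro that[of "fst ` E" "snd ` E" E]) (auto intro: image_eqI[rotated])
  next
    case False
    show ?thesis
      using degX degY sub disj E(2) False EA unfolding d_def
      by (intro that[of "snd ` E" "fst ` E" "E\<inverse>"]) (auto intro: image_eqI[rotated])
  qed
qed

section \<open>Choice of the constants\<close>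

text \<open>With \<open>i = 1/s\<close> and \<open>j = 1/r\<close>, the quantities
  \<open>\<pi>\<close>, \<open>V\<close>, \<open>W\<close> grow at least like \<open>n\<close> to
  the powers \<open>e1 = i + t * j\<close>, \<open>e2 = (t + 1) * j - i\<close> and
  \<open>e3 = t * s * (t + 1) * j\<close>. The power \<open>e2\<close> can be negative, but the
  conclusion involves only \<open>e3\<close>, \<open>e1 + e2\<close> and
  \<open>e1 * (L - 1) + (e3 + e2) * L\<close>. Nonnegativity of the last is \<open>Lr\<close> after
  multiplication by \<open>s * r\<close>.\<close>

lemma growth_constant:
  fixes t r L :: nat and C :: real
  assumes t: "1 \<le> t" and r: "1 \<le> r" and L: "1 \<le> L"
    and Lr: "r + (2 * t + 1) * t \<le> L * ((2 * t + 1)\<^sup>2 * (1 + t + t\<^sup>2))"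
  shows "\<exists>\<gamma>\<ge>1. \<forall>(n::nat) d. 1 \<le> n \<longrightarrow>
    \<gamma> * real n powr (1 - 2 / (2 * real t + 1) + 1 / real r) \<le> d \<longrightarrow>
    (let V = d ^ (t + 1) / (16 * (2 * real t) ^ t * real n ^ t);
         W = real n ^ t * (V / 2) ^ (t * (2 * t + 1)) / 3;
         \<pi> = (d / t) ^ t / real n ^ (t - 1)
     in C \<le> W \<and> C \<le> \<pi> * V \<and> C < \<pi> ^ (L - 1) * (W * V / 4) ^ L)"
proof -
  define s where "s = 2 * real t + 1"
  define k where "k = t * (2 * t + 1)"
  have s0: "0 < s" and t0: "0 < real t" and r0: "0 < real r" unfolding s_def using t r by auto
  define i where "i = 1 / s"
  define j where "j = 1 / real r"
  have i: "i * s = 1" and j: "j * real r = 1" unfolding i_def j_def using s0 r0 by auto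
  have ij0: "0 < i" "0 < j" unfolding i_def j_def using s0 r0 by auto
  define a where "a = 1 - 2 * i + j"
  define e1 where "e1 = i + real t * j"
  define e2 where "e2 = (real t + 1) * j - i"
  define e3 where "e3 = real k * (real t + 1) * j"
  have rk: "real k = real t * s" unfolding k_def s_def by (simp add: algebra_simps)
  have E1: "a * real t - (real t - 1) = e1" and E2: "a * (real t + 1) - real t = e2"
    and E3: "real t + e2 * real k = e3"
    unfolding a_def e1_def e2_def e3_def rk using i s_def by algebra+
  have e12: "0 \<le> e1 + e2" unfolding e1_def e2_def using ij0 by (simp add: algebra_simps)
  have e3: "0 \<le> e3" unfolding e3_def using ij0 by simp
  have E: "0 \<le> e1 * (real L - 1) + (e3 + e2) * real L"
  proof -
    have "real (r + (2 * t + 1) * t) \<le> real (L * ((2 * t + 1)\<^sup>2 * (1 + t + t\<^sup>2)))" using Lr by (rule of_nat_mono)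
    then have "real r + s * t \<le> real L * (s\<^sup>2 * (1 + real t + (real t)\<^sup>2))" unfolding s_def by (simp add: algebra_simps)
    moreover have "(e1 * (real L - 1) + (e3 + e2) * real L) * (s * r) =
        real L * (s\<^sup>2 * (1 + real t + (real t)\<^sup>2)) - (real r + s * t)"
      unfolding e1_def e2_def e3_def rk using i j s_def by algebra
    ultimately have "0 \<le> (e1 * (real L - 1) + (e3 + e2) * real L) * (s * r)" by linarith
    moreover have "0 < s * r" using s0 r0 by simp
    ultimately show ?thesis by (metis zero_le_mult_iff less_le_not_le)
  qed
  define c1 where "c1 = 1 / real t ^ t"
  define c2 where "c2 = 1 / (16 * (2 * real t) ^ t)"
  define c3 where "c3 = (c2 / 2) ^ k / 3"
  \<comment> \<open>Each of the three quantities is at least \<open>cc\<close> times a positive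
    power of \<open>\<gamma>\<close> times a power of \<open>n\<close> that is at least 1. As
    \<open>\<gamma> \<ge> 1\<close>, a single factor \<open>\<gamma>\<close> has to beat
    \<open>C\<close>.\<close>
  define cc where "cc = min (min c3 (c1 * c2)) (c1 ^ (L - 1) * (c3 * c2 / 4) ^ L)"
  have c0: "0 < c1" "0 < c2" "0 < c3" unfolding c1_def c2_def c3_def using t by auto
  then have cc: "0 < cc" unfolding cc_def by simp
  define \<gamma> where "\<gamma> = max 1 ((\<bar>C\<bar> + 1) / cc)"
  have \<gamma>1: "1 \<le> \<gamma>" unfolding \<gamma>_def by simp
  have "(\<bar>C\<bar> + 1) / cc \<le> \<gamma>" unfolding \<gamma>_def by simp
  then have "\<bar>C\<bar> + 1 \<le> \<gamma> * cc" using cc by (simp add: divide_le_eq)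
  then have \<gamma>C: "C < \<gamma> * cc" by linarith
  have p1: "\<gamma> \<le> \<gamma> ^ m" if "1 \<le> m" for m using self_le_power[OF \<gamma>1] that by simp
  show ?thesis
  proof (intro exI[of _ \<gamma>] conjI allI impI)
    fix n :: nat and d :: real
    assume n: "1 \<le> n" and d: "\<gamma> * real n powr (1 - 2 / (2 * real t + 1) + 1 / real r) \<le> d"
    define N where "N = real n"
    have N: "1 \<le> N" unfolding N_def using n by simp
    have d': "\<gamma> * N powr a \<le> d" using d unfolding N_def a_def i_def j_def s_def by simp
    have pp: "(N powr x) ^ m = N powr (x * real m)" for x m
      using N by (subst powr_realpow[symmetric]) (auto simp: powr_powr)
    have dm: "\<gamma> ^ m * N powr (a * m) \<le> d ^ m" for m
    proof -
      have "(\<gamma> * N powr a) ^ m \<le> d ^ m" using d' \<gamma>1 by (intro power_mono) auto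
      then show ?thesis by (simp add: power_mult_distrib pp)
    qed
    have npow: "N ^ m = N powr m" for m using N by (simp add: powr_realpow)
    define V where "V = d ^ (t + 1) / (16 * (2 * real t) ^ t * N ^ t)"
    define W where "W = N ^ t * (V / 2) ^ k / 3"
    define P where "P = (d / t) ^ t / N ^ (t - 1)"
    have P: "c1 * \<gamma> ^ t * N powr e1 \<le> P"
    proof -
      have "c1 * \<gamma> ^ t * N powr e1 = c1 * (\<gamma> ^ t * N powr (a * t)) / N powr (real t - 1)"
        unfolding E1[symmetric] by (simp add: powr_diff)
      also have "\<dots> \<le> c1 * d ^ t / N powr (real t - 1)"
        using dm[of t] c0 by (intro divide_right_mono mult_left_mono) auto
      also have "N powr (real t - 1) = N ^ (t - 1)" unfolding npow using t by (simp add: of_nat_diff)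
      finally show ?thesis unfolding P_def c1_def by (simp add: power_divide)
    qed
    have V: "c2 * \<gamma> ^ (t + 1) * N powr e2 \<le> V"
    proof -
      have "c2 * \<gamma> ^ (t + 1) * N powr e2 = c2 * (\<gamma> ^ (t + 1) * N powr (a * real (t + 1))) / N powr t"
        unfolding E2[symmetric] by (simp add: powr_diff add.commute)
      also have "\<dots> \<le> c2 * d ^ (t + 1) / N powr t"
        using dm[of "t + 1"] c0 by (intro divide_right_mono mult_left_mono) auto
      finally show ?thesis unfolding V_def c2_def npow by simp
    qed
    have W: "c3 * \<gamma> ^ ((t + 1) * k) * N powr e3 \<le> W"
    proof -
      have "c3 * \<gamma> ^ ((t + 1) * k) * N powr e3 = N powr t * ((c2 * \<gamma> ^ (t + 1) * N powr e2) / 2) ^ k / 3"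
      proof -
        have "(\<gamma> ^ (t + 1)) ^ k = \<gamma> ^ ((t + 1) * k)" by (rule power_mult[symmetric])
        then show ?thesis unfolding E3[symmetric] c3_def
          by (simp only: powr_add power_mult_distrib power_divide pp) simp
      qed
      also have "\<dots> \<le> N powr t * (V / 2) ^ k / 3"
        using V c0 \<gamma>1 by (intro divide_right_mono mult_left_mono power_mono) auto
      finally show ?thesis unfolding W_def npow .
    qed
    have k1: "1 \<le> (t + 1) * k" unfolding k_def using t by simp
    have one: "1 \<le> N powr e" if "0 \<le> e" for e using N that by (simp add: ge_one_powr_ge_zero)
    have P0: "0 \<le> c1 * \<gamma> ^ t * N powr e1" and V0: "0 \<le> c2 * \<gamma> ^ (t + 1) * N powr e2"
      and W0: "0 \<le> c3 * \<gamma> ^ ((t + 1) * k) * N powr e3" using c0 \<gamma>1 by auto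
    have g: "\<gamma> * cc \<le> c * \<gamma> ^ m * N powr e" if "cc \<le> c" "1 \<le> m" "0 \<le> e" for c m e
    proof -
      have "\<gamma> * cc \<le> \<gamma> ^ m * c" using p1[OF that(2)] that(1) cc \<gamma>1 by (intro mult_mono) auto
      also have "\<dots> = c * \<gamma> ^ m * 1" by simp
      also have "\<dots> \<le> c * \<gamma> ^ m * N powr e"
        using one[OF that(3)] cc that(1) \<gamma>1 by (intro mult_left_mono) auto
      finally show ?thesis .
    qed
    have "cc \<le> c3" unfolding cc_def by simp
    from g[OF this k1 e3] have CW: "C \<le> W" using W \<gamma>C by linarith
    have "\<gamma> * cc \<le> c1 * c2 * \<gamma> ^ (t + (t + 1)) * N powr (e1 + e2)"
      by (rule g) (use e12 in \<open>auto simp: cc_def\<close>)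
    also have "\<dots> = (c1 * \<gamma> ^ t * N powr e1) * (c2 * \<gamma> ^ (t + 1) * N powr e2)"
      by (simp add: power_add powr_add)
    also have "\<dots> \<le> P * V" using P V P0 V0 by (intro mult_mono) auto
    finally have CPV: "C \<le> P * V" using \<gamma>C by linarith
    define m where "m = t * (L - 1) + ((t + 1) * k + (t + 1)) * L"
    have "\<gamma> * cc \<le> (c1 ^ (L - 1) * (c3 * c2 / 4) ^ L) * \<gamma> ^ m * N powr (e1 * (real L - 1) + (e3 + e2) * real L)"
      using E L by (intro g) (auto simp: cc_def m_def)
    also have "\<dots> = (c1 * \<gamma> ^ t * N powr e1) ^ (L - 1) *
        ((c3 * \<gamma> ^ ((t + 1) * k) * N powr e3) * (c2 * \<gamma> ^ (t + 1) * N powr e2) / 4) ^ L"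
    proof -
      have "N powr (e1 * (real L - 1)) = (N powr e1) ^ (L - 1)" 
        using L by (simp add: pp of_nat_diff)
      moreover have "N powr ((e3 + e2) * real L) = (N powr e3 * N powr e2) ^ L"
        by (simp add: pp flip: powr_add)
      moreover have "\<gamma> ^ m = (\<gamma> ^ t) ^ (L - 1) * (\<gamma> ^ ((t + 1) * k) * \<gamma> ^ (t + 1)) ^ L"
        unfolding m_def by (simp only: power_add power_mult)
      ultimately show ?thesis unfolding powr_add
        by (simp add: power_mult_distrib power_divide ac_simps)
    qed
    also have "\<dots> \<le> P ^ (L - 1) * (W * V / 4) ^ L"
      using P V W P0 V0 W0 by (intro mult_mono power_mono divide_right_mono) auto
    finally have "C < P ^ (L - 1) * (W * V / 4) ^ L" using \<gamma>C by linarith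
    then show "let V = d ^ (t + 1) / (16 * (2 * real t) ^ t * real n ^ t);
         W = real n ^ t * (V / 2) ^ (t * (2 * t + 1)) / 3;
         \<pi> = (d / t) ^ t / real n ^ (t - 1)
     in C \<le> W \<and> C \<le> \<pi> * V \<and> C < \<pi> ^ (L - 1) * (W * V / 4) ^ L"
      using CW CPV unfolding Let_def V_def[unfolded N_def] W_def[unfolded N_def] P_def[unfolded N_def] 
        V_def W_def P_def N_def k_def by blast
  qed (rule \<gamma>1)
qed

text \<open>The second conclusion lets walks of \<open>2 * L\<close> moves outnumber their ends;
  taking \<open>L\<close> minimal bounds it above in terms of \<open>r\<close>. If
  \<open>L = 1\<close>, minimality is no help and the lower bound on \<open>r\<close> is used
  instead. The term \<open>2 * s * t\<close> on the right is the number of vertices saved by the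
  gains.\<close>

lemma exists_walk_length:
  fixes t r :: nat
  defines "s \<equiv> 2 * t + 1" and "g \<equiv> 1 + t + t\<^sup>2"
  assumes t: "1 \<le> t" and r: "s * (t + 1) < r"
  obtains L where "1 \<le> L" "r + s * t \<le> L * (s\<^sup>2 * g)"
    "t + t * s + (2 * s * t + 1) * (L * (t + t * s + 2)) \<le> 2 * s * t + r * (4 * t\<^sup>2 + 2 * t)"
proof -
  define L where "L = (LEAST L. r + s * t \<le> L * (s\<^sup>2 * g))"
  have "0 < s\<^sup>2 * g" unfolding s_def g_def by simp
  then have sg: "1 \<le> s\<^sup>2 * g" by linarith
  have "r + s * t \<le> (r + s * t) * (s\<^sup>2 * g)" using sg by simp
  then have L: "r + s * t \<le> L * (s\<^sup>2 * g)" unfolding L_def by (rule LeastI)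
  have L1: "1 \<le> L" using L r by (cases L) auto
  have "\<not> r + s * t \<le> (L - 1) * (s\<^sup>2 * g)"
    using not_less_Least[of "L - 1" "\<lambda>L. r + s * t \<le> L * (s\<^sup>2 * g)"] L1 unfolding L_def by simp
  then have lt: "(L - 1) * (s\<^sup>2 * g) < r + s * t" by simp
  obtain m where m: "L = m + 1" using L1 by (metis add.commute le_Suc_ex)
  \<comment> \<open>In terms of \<open>u\<close> the polynomial inequalities below hold
    coefficientwise.\<close>
  obtain u where u: "t = u + 1" using t by (metis add.commute le_Suc_ex)
  have rr: "s * (t + 1) + 1 \<le> r" using r by simp
  have goal: "t + t * s + (2 * s * t + 1) * (L * (t + t * s + 2)) \<le> 2 * s * t + r * (4 * t\<^sup>2 + 2 * t)"
  proof (cases m)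
    case 0
    have "t + t * s + (2 * s * t + 1) * (L * (t + t * s + 2)) \<le> 2 * s * t + (s * (t + 1) + 1) * (4 * t\<^sup>2 + 2 * t)"
      unfolding m 0 s_def u by (simp add: algebra_simps power2_eq_square)
    also have "\<dots> \<le> 2 * s * t + r * (4 * t\<^sup>2 + 2 * t)" using rr by (intro add_left_mono mult_right_mono) auto
    finally show ?thesis .
  next
    case (Suc v)
    have r': "(v + 1) * (s\<^sup>2 * g) + 1 \<le> r + s * t" using lt unfolding m Suc by simp
    have "((v + 1) * (s\<^sup>2 * g) + 1) * (4 * t\<^sup>2 + 2 * t) \<le> (r + s * t) * (4 * t\<^sup>2 + 2 * t)"
      using r' by (rule mult_right_mono) simp
    moreover have "t + t * s + (2 * s * t + 1) * (L * (t + t * s + 2)) + s * t * (4 * t\<^sup>2 + 2 * t)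
        \<le> 2 * s * t + ((v + 1) * (s\<^sup>2 * g) + 1) * (4 * t\<^sup>2 + 2 * t)"
      unfolding m Suc s_def g_def u by (simp add: algebra_simps power2_eq_square)
    ultimately show ?thesis by (simp add: add_mult_distrib)
  qed
  show ?thesis by (rule that[OF L1 L goal])
qed

section \<open>The main theorem\<close>

definition has_compact_dense :: "nat \<Rightarrow> nat \<Rightarrow> ('v \<times> 'v) set \<Rightarrow> bool" where
  "has_compact_dense t r E \<longleftrightarrow> (\<exists>H a. finite H \<and> finite (\<Union>H) \<and> H \<subseteq> doubleton ` E \<and> a \<in> \<Union>H \<and>
     (\<forall>v\<in>\<Union>H. near a H v) \<and> (2 * t + 1) * card (\<Union>H) \<le> 2 * card H \<and>
     card (\<Union>H) \<le> r * (4 * t\<^sup>2 + 2 * t))"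

lemma exists_small_dense_in_bipartite:
  fixes t r :: nat
  assumes t: "1 \<le> t" and r: "2 \<le> r"
  defines "s \<equiv> 2 * t + 1"
  shows "\<exists>\<gamma>>0. \<forall>(X :: 'v set) Y E (n :: nat) (d :: real). finite X \<longrightarrow> finite Y \<longrightarrow> X \<inter> Y = {} \<longrightarrow> E \<subseteq> X \<times> Y \<longrightarrow>
      (\<forall>x\<in>X. d \<le> card {y. (x, y) \<in> E}) \<longrightarrow> (\<forall>y\<in>Y. d \<le> card {x. (x, y) \<in> E}) \<longrightarrow>
      card Y \<le> card X \<longrightarrow> card X \<le> n \<longrightarrow> X \<noteq> {} \<longrightarrow>
      \<gamma> * real n powr (1 - 2 / (2 * real t + 1) + 1 / real r) \<le> d \<longrightarrow>
      has_compact_dense t r E"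
proof -
  define M where "M = s * (t + 1)"
  define a where "a = 1 - 2 / (2 * real t + 1) + 1 / real r"
  have "2 / (2 * real t + 1) \<le> 1" using t by (simp add: field_simps)
  then have a0: "0 \<le> a" unfolding a_def by (simp add: add_increasing2)
  have "\<exists>\<gamma>>0. \<forall>(X :: 'v set) Y E (n :: nat) (d :: real). bipartite X Y E t n M d \<longrightarrow> \<gamma> * real n powr a \<le> d \<longrightarrow>
      has_compact_dense t r E"
  proof (cases "s * (t + 1) < r")
    case False
    define \<gamma> where "\<gamma> = (real t + 1) * (real M + 1)"
    \<comment> \<open>\<open>a * (t + 1) - t = (t + 1) / r - 1 / s\<close> is nonnegative precisely
      for \<open>r \<le> s * (t + 1)\<close>. In that range the degree exceeds what
      \<open>degree_bound\<close> permits, so the assumption that there is no large biclique is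
      contradictory.\<close>
    have at: "real t \<le> a * (real t + 1)"
    proof -
      have "real r \<le> real (s * (t + 1))" using False by (intro of_nat_mono) simp
      then have "1 / (2 * real t + 1) \<le> (real t + 1) / r"
        using r unfolding s_def by (simp add: field_simps)
      moreover have i: "2 / (2 * real t + 1) * (real t + 1) = 1 + 1 / (2 * real t + 1)"
        by (simp add: field_simps)
      have "a * (real t + 1) - real t = (real t + 1) / r - 1 / (2 * real t + 1)"
        unfolding a_def distrib_right[of _ _ "real t + 1"] left_diff_distrib[of _ _ "real t + 1"] i by simp
      ultimately show ?thesis by linarith
    qed
    have "False" if "bipartite X Y E t n M d" "\<gamma> * real n powr a \<le> d"
      for X Y :: "'v set" and E n d
    proof -
      interpret bipartite X Y E t n M d by fact
      have n1: "1 \<le> real n" using n_pos by simp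
      have "real M * real n ^ t < (real M + 1) * real n powr t"
        using n1 by (simp add: powr_realpow)
      also have "\<dots> \<le> (real M + 1) ^ (t + 1) * real n powr (a * (real t + 1))"
        using n1 at self_le_power[of "real M + 1" "t + 1"] by (intro mult_mono powr_mono) auto
      also have "\<dots> = ((real M + 1) * real n powr a) ^ (t + 1)"
      proof -
        have "(real n powr a) ^ (t + 1) = real n powr (a * (real t + 1))"
          using n1 by (subst powr_realpow[symmetric]) (auto simp: powr_powr add.commute)
        then show ?thesis by (simp only: power_mult_distrib)
      qed
      also have "\<dots> \<le> (d / (t + 1)) ^ (t + 1)"
        using that(2) unfolding \<gamma>_def by (intro power_mono) (auto simp: field_simps)
      finally show False using degree_bound by linarith
    qed
    moreover have "0 < \<gamma>" unfolding \<gamma>_def by (simp add: add_nonneg_pos)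
    ultimately show ?thesis by (intro exI[of _ \<gamma>] conjI allI impI) blast+
  next
    case True
    obtain L where L: "1 \<le> L" "r + s * t \<le> L * (s\<^sup>2 * (1 + t + t\<^sup>2))"
      "t + t * s + (2 * s * t + 1) * (L * (t + t * s + 2)) \<le> 2 * s * t + r * (4 * t\<^sup>2 + 2 * t)"
      by (rule exists_walk_length[OF t True[unfolded s_def], folded s_def]) (rule that; assumption)
    define z where "z = t + t * s + (2 * s * t + 1) * (L * (t + t * s + 2))"
    define c where "c = 2 ^ z * z ^ (t * s) + z ^ 2"
    define C where "C = max (max (2 * (real c + 1)) (real (t * s) * M)) (real c ^ (2 * L))"
    have r1: "1 \<le> r" using r by simp
    from growth_constant[OF t r1 L(1) L(2)[unfolded s_def], of C, folded s_def a_def]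
    obtain \<gamma> where \<gamma>: "1 \<le> \<gamma>" "\<forall>(n :: nat) d. 1 \<le> n \<longrightarrow> \<gamma> * real n powr a \<le> d \<longrightarrow>
      (let V = d ^ (t + 1) / (16 * (2 * real t) ^ t * real n ^ t);
         W = real n ^ t * (V / 2) ^ (t * s) / 3;
         \<pi> = (d / t) ^ t / real n ^ (t - 1)
       in C \<le> W \<and> C \<le> \<pi> * V \<and> C < \<pi> ^ (L - 1) * (W * V / 4) ^ L)"
      by (elim exE conjE) (rule that; assumption)
    have "has_compact_dense t r E"
      if "bipartite X Y E t n M d" "\<gamma> * real n powr a \<le> d" for X Y :: "'v set" and E n d
    proof -
      interpret bipartite X Y E t n M d by fact
      have n1: "1 \<le> n" using n_pos by simp
      define V where "V = d ^ (t + 1) / (16 * (2 * real t) ^ t * real n ^ t)"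
      define W where "W = real n ^ t * (V / 2) ^ (t * s) / 3"
      define \<pi> where "\<pi> = (d / t) ^ t / real n ^ (t - 1)"
      have *: "C \<le> W" "C \<le> \<pi> * V" "C < \<pi> ^ (L - 1) * (W * V / 4) ^ L"
        using \<gamma>(2)[rule_format, OF n1 that(2)] unfolding Let_def V_def W_def \<pi>_def by blast+
      have C: "2 * (real c + 1) \<le> C" "real (t * s) * M \<le> C" "real c ^ (2 * L) \<le> C"
        unfolding C_def by auto
      have nn: "0 \<le> C" using C(3) by (rule order.trans[rotated]) simp
      have h: "2 * (real c + 1) \<le> W" "2 * (real c + 1) \<le> \<pi> * V" "real (t * s) * M \<le> 2 * \<pi> * V"
        "real c ^ (2 * L) < \<pi> ^ (L - 1) * (W * V / 4) ^ L"
        using * C nn by auto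
      obtain H a where "finite H" "finite (\<Union>H)" "H \<subseteq> doubleton ` E" "a \<in> \<Union>H" "\<And>v. v \<in> \<Union>H \<Longrightarrow> near a H v"
        "s * card (\<Union>H) \<le> 2 * card H" "card (\<Union>H) + 2 * s * t \<le> z"
        using exists_small_dense_of_bounds[of L c, folded s_def, folded z_def, folded V_def, folded W_def \<pi>_def]
          c_def L(1) h by blast
      moreover have "card (\<Union>H) \<le> r * (4 * t\<^sup>2 + 2 * t)"
        using calculation(7) L(3) unfolding z_def by linarith
      ultimately show ?thesis unfolding has_compact_dense_def s_def by blast
    qed
    then show ?thesis using \<gamma>(1) by (intro exI[of _ \<gamma>]) auto
  qed
  then obtain \<gamma>0 where \<gamma>0: "0 < \<gamma>0" "\<And>(X :: 'v set) Y E (n :: nat) (d :: real). bipartite X Y E t n M d \<Longrightarrow> \<gamma>0 * real n powr a \<le> d \<Longrightarrow>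
      has_compact_dense t r E"
    by blast
  show ?thesis unfolding a_def[symmetric]
  \<comment> \<open>The second argument of \<open>max\<close> ensures \<open>2 * t \<le> d\<close>,
    as demanded by \<open>bipartite\<close>: the power of \<open>n\<close> is at least 1 because
    \<open>a \<ge> 0\<close>.\<close>
  proof (intro exI[of _ "max \<gamma>0 (2 * real t)"] conjI allI impI)
    show "0 < max \<gamma>0 (2 * real t)" using \<gamma>0(1) by simp
    fix X Y :: "'v set" and E and n :: nat and d :: real
    assume fin: "finite X" "finite Y" and disj: "X \<inter> Y = {}" and E: "E \<subseteq> X \<times> Y"
      and deg: "\<forall>x\<in>X. d \<le> card {y. (x, y) \<in> E}" "\<forall>y\<in>Y. d \<le> card {x. (x, y) \<in> E}"
      and c: "card Y \<le> card X" "card X \<le> n" "X \<noteq> {}" and d: "max \<gamma>0 (2 * real t) * real n powr a \<le> d"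
    have "0 < card X" using fin c by (simp add: card_gt_0_iff)
    then have n1: "1 \<le> real n" using c(2) by simp
    have p1: "1 \<le> real n powr a" using n1 a0 by (rule ge_one_powr_ge_zero)
    have "\<gamma>0 * real n powr a \<le> max \<gamma>0 (2 * real t) * real n powr a" using p1 by (intro mult_right_mono) auto
    then have d0: "\<gamma>0 * real n powr a \<le> d" using d by linarith
    have "2 * real t * 1 \<le> max \<gamma>0 (2 * real t) * real n powr a" using p1 by (intro mult_mono) auto
    then have dt: "2 * real t \<le> d" using d by linarith
    show "has_compact_dense t r E"
    proof (cases "\<exists>A\<subseteq>Y. card A = t + 1 \<and> M < card {x \<in> X. \<forall>a\<in>A. (x, a) \<in> E}")
      case True
      then obtain A where A: "A \<subseteq> Y" "card A = t + 1" "M < card {x \<in> X. \<forall>a\<in>A. (x, a) \<in> E}" by blast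
      have size: "(t + 1) * (s + 1) \<le> r * (4 * t\<^sup>2 + 2 * t)"
      proof -
        obtain u where u: "t = u + 1" using t by (metis add.commute le_Suc_ex)
        have "(t + 1) * (s + 1) \<le> 2 * (4 * t\<^sup>2 + 2 * t)"
          unfolding s_def u by (simp add: algebra_simps power2_eq_square)
        also have "\<dots> \<le> r * (4 * t\<^sup>2 + 2 * t)" using r by (rule mult_right_mono) simp
        finally show ?thesis .
      qed
      show ?thesis
      proof (rule biclique_dense[OF fin(1) disj A(1,2) A(3)[unfolded M_def s_def]])
        fix H a
        assume "finite H" "finite (\<Union>H)" "H \<subseteq> doubleton ` E" "a \<in> \<Union>H" "\<And>v. v \<in> \<Union>H \<Longrightarrow> near a H v"
          "(2 * t + 1) * card (\<Union>H) \<le> 2 * card H" "card (\<Union>H) = (t + 1) * (2 * t + 1 + 1)"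
        then show "has_compact_dense t r E"
          using size unfolding has_compact_dense_def s_def by (intro exI[of _ H] exI[of _ a]) simp
      qed
    next
      case False
      have "bipartite X Y E t n M d"
        by unfold_locales (use fin disj E deg c t dt False in \<open>auto simp: not_less\<close>)
      then show ?thesis using \<gamma>0(2) d0 by blast
    qed
  qed
qed

section \<open>Translation to pair graphs and conclusion\<close>

lemma pair_graph_of_edges:
  fixes G :: "'a pair_pre_digraph"
  assumes G: "pair_graph G" and H: "finite H" "finite (\<Union>H)" "H \<subseteq> doubleton ` parcs G"
    and a: "a \<in> \<Union>H" "\<And>v. v \<in> \<Union>H \<Longrightarrow> near a H v"
  obtains H' :: "'a pair_pre_digraph" where "pair_graph H'" "subgraph (with_proj H') (with_proj G)"
    "num_edges H' = card H" "num_verts H' = card (\<Union>H)" "radius H' \<le> 3"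
proof -
  interpret G: pair_graph G by fact
  \<comment> \<open>Exactly the covered vertices are taken, so that every vertex has a short path to
    \<open>a\<close> and \<open>excess\<close> refers to the right vertex count.\<close>
  define H' where "H' = \<lparr>pverts = \<Union>H, parcs = {(u, v). {u, v} \<in> H}\<rparr>"
  have sym: "(v, u) \<in> parcs G" if "(u, v) \<in> parcs G" for u v
    using that G.pair_sym_arcs unfolding symmetric_def by (auto dest: symD)
  have arc: "(u, v) \<in> parcs G" if "{u, v} \<in> H" for u v
  proof -
    obtain e where "e \<in> parcs G" "{u, v} = doubleton e" using \<open>{u, v} \<in> H\<close> H(3) by blast
    then obtain x y where xy: "(x, y) \<in> parcs G" "{u, v} = doubleton (x, y)" by (cases e) auto
    then have "u = x \<and> v = y \<or> u = y \<and> v = x" by (auto simp: doubleton_def doubleton_eq_iff)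
    then show ?thesis using xy(1) sym by blast
  qed
  have "\<Union>(doubleton ` parcs G) \<subseteq> pverts G"
    using G.arc_fst_in_verts G.arc_snd_in_verts unfolding Union_doubleton by blast
  then have sub: "parcs H' \<subseteq> parcs G" "pverts H' \<subseteq> pverts G"
    using arc Union_mono[OF H(3)] unfolding H'_def by auto
  have pg: "pair_graph H'"
  proof
    show "fst e \<in> pverts H'" "snd e \<in> pverts H'" if "e \<in> parcs H'" for e
      using that unfolding H'_def by auto
    show "finite (pverts H')" unfolding H'_def using H by simp
    show "finite (parcs H')" by (rule finite_subset[OF sub(1) G.pair_finite_arcs])
    show "fst e \<noteq> snd e" if "e \<in> parcs H'" for e using that sub(1) G.pair_no_loops by auto
    show "symmetric (with_proj H')" unfolding symmetric_def H'_def by (auto simp: sym_def insert_commute)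
  qed
  interpret H': pair_graph H' by fact
  have "subgraph (with_proj H') (with_proj G)"
    unfolding subgraph_def using sub G.wf_digraph_axioms H'.wf_digraph_axioms by (auto simp: compatible_def)
  moreover have "{{u, v} |u v. (u, v) \<in> parcs H'} = H"
    using H(3) unfolding H'_def doubleton_def by fastforce
  then have "num_edges H' = card H" unfolding num_edges_def by simp
  moreover have "num_verts H' = card (\<Union>H)" unfolding num_verts_def H'_def by simp
  moreover have "radius H' \<le> 3"
  proof -
    have dist: "graph_dist H' a v \<le> 3" if "v \<in> \<Union>H" for v
    proof -
      have le: "graph_dist H' a v \<le> 3" if "H'.awalk a p v" "length p \<le> 3" for p
      proof -
        have "graph_dist H' a v \<le> ereal (H'.awalk_cost (\<lambda>_. 1) p)"
          unfolding graph_dist_def by (rule H'.min_cost_le_walk_cost[OF that(1)])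
        also have "H'.awalk_cost (\<lambda>_. 1) p = real (length p)" by (induction p) auto
        also have "ereal (real (length p)) \<le> ereal 3" using that(2) by simp
        finally show ?thesis by simp
      qed
      have aw: "H'.awalk a p v" if "set p \<subseteq> parcs H'" "pcas a p v" for p
        using that a(1) unfolding H'.awalk_def by (simp add: H'_def)
      consider "v = a" | "{v, a} \<in> H" | p where "{v, p} \<in> H" "{p, a} \<in> H" |
        y p where "{v, y} \<in> H" "{y, p} \<in> H" "{p, a} \<in> H"
        using a(2)[OF \<open>v \<in> \<Union>H\<close>] unfolding near_def by blast
      then show ?thesis
      proof cases
        case 1
        then show ?thesis using le[OF aw[of "[]"]] by simp
      next
        case 2
        then show ?thesis using le[OF aw[of "[(a, v)]"]] by (simp add: H'_def insert_commute)
      next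
        case (3 p)
        then show ?thesis using le[OF aw[of "[(a, p), (p, v)]"]] by (simp add: H'_def insert_commute)
      next
        case (4 y p)
        then show ?thesis
          using le[OF aw[of "[(a, p), (p, y), (y, v)]"]] by (simp add: H'_def insert_commute)
      qed
    qed
    have "radius H' \<le> eccentricity H' a" unfolding radius_def
      by (rule INF_lower) (use a(1) in \<open>auto simp: H'_def\<close>)
    also have "\<dots> \<le> 3" unfolding eccentricity_def
      by (rule SUP_least) (use dist in \<open>auto simp: H'_def\<close>)
    finally show ?thesis .
  qed
  ultimately show ?thesis using pg that by blast
qed

theorem theorem5p9:
  fixes r t :: nat
  assumes "r > 0" and "t > 0"
  shows "\<exists>\<beta>::real. \<forall>(G :: 'a pair_pre_digraph) n.
    pair_graph G \<and> num_verts G = n \<and>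
    real (num_edges G) \<ge> \<beta> * real n powr (4 * real t / (2 * real t + 1) + 1 / real r) \<and>
    real n powr ((2 * real t + 1) / real r) > 12 * real t * ln ((real r)\<^sup>2 * real n) \<and>
    n > fact t
    \<longrightarrow> (\<exists>H :: 'a pair_pre_digraph. pair_graph H \<and> subgraph (with_proj H) (with_proj G) \<and>
          avg_degree H \<ge> 2 * real t + 1 \<and>
          radius H \<le> ereal (real r + 1) \<and>
          num_verts H \<le> r * (4 * t\<^sup>2 + 2 * t))"
proof -
  define \<alpha> where "\<alpha> = 4 * real t / (2 * real t + 1) + 1 / real r"
  define a where "a = 1 - 2 / (2 * real t + 1) + 1 / real r"
  have \<alpha>a: "\<alpha> = a + 1" unfolding \<alpha>_def a_def by (simp add: field_simps)
  have arcs_le: "real (num_edges G) \<le> card (parcs G)" if "pair_graph G" for G :: "'a pair_pre_digraph"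
  proof -
    interpret pair_graph G by fact
    have "{{u, v} |u v. (u, v) \<in> parcs G} = doubleton ` parcs G" unfolding doubleton_def by force
    then show ?thesis unfolding num_edges_def using card_image_le[OF pair_finite_arcs] by simp
  qed
  show ?thesis
  \<comment> \<open>Radius 3 is at most \<open>r + 1\<close> only from \<open>r = 2\<close> on. For
    \<open>r = 1\<close> the exponent \<open>\<alpha>\<close> is at least 2, and with
    \<open>\<beta> = 2\<close> no graph has enough edges, since there are at most
    \<open>n * n\<close> arcs.\<close>
  proof (cases "r = 1")
    case True
    have \<alpha>2: "2 \<le> \<alpha>" unfolding \<alpha>_def True using assms(2) by (simp add: field_simps)
    have False if G: "pair_graph G" and n: "num_verts G = n" "fact t < n"
      and e: "2 * real n powr \<alpha> \<le> num_edges G" for G :: "'a pair_pre_digraph" and n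
    proof -
      interpret pair_graph G by fact
      have n1: "1 \<le> real n" using n(2) by simp
      have "parcs G \<subseteq> pverts G \<times> pverts G" using arc_fst_in_verts arc_snd_in_verts by force
      then have "card (parcs G) \<le> n * n"
        using card_mono[of "pverts G \<times> pverts G"] pair_finite_verts n(1)
        unfolding num_verts_def by (simp add: card_cartesian_product)
      then have "real (card (parcs G)) \<le> real (n * n)" by (rule of_nat_mono)
      then have "2 * real n powr \<alpha> \<le> real n * real n" using e arcs_le[OF G] by simp
      moreover have "real n * real n = real n powr 2" using n1 by (simp add: powr_numeral power2_eq_square)
      moreover have "real n powr 2 \<le> real n powr \<alpha>" using n1 \<alpha>2 by (intro powr_mono) auto
      moreover have "0 < real n powr \<alpha>" using n1 by simp
      ultimately show False by linarith
    qed
    then show ?thesis unfolding \<alpha>_def[symmetric] by (intro exI[of _ 2]) blast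
  next
    case False
    then have r2: "2 \<le> r" and t1: "1 \<le> t" using assms by auto
    obtain \<gamma> where \<gamma>: "0 < \<gamma>" "\<And>(X :: 'a set) Y E (n :: nat) (d :: real). finite X \<Longrightarrow> finite Y \<Longrightarrow> X \<inter> Y = {} \<Longrightarrow> E \<subseteq> X \<times> Y \<Longrightarrow>
      (\<forall>x\<in>X. d \<le> card {y. (x, y) \<in> E}) \<Longrightarrow> (\<forall>y\<in>Y. d \<le> card {x. (x, y) \<in> E}) \<Longrightarrow>
      card Y \<le> card X \<Longrightarrow> card X \<le> n \<Longrightarrow> X \<noteq> {} \<Longrightarrow> \<gamma> * real n powr a \<le> d \<Longrightarrow>
      has_compact_dense t r E"
      using exists_small_dense_in_bipartite[OF t1 r2, where 'v = 'a] unfolding a_def by blast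
    have "\<exists>H :: 'a pair_pre_digraph. pair_graph H \<and> subgraph (with_proj H) (with_proj G) \<and>
          avg_degree H \<ge> 2 * real t + 1 \<and> radius H \<le> ereal (real r + 1) \<and>
          num_verts H \<le> r * (4 * t\<^sup>2 + 2 * t)"
      if G: "pair_graph G" and n: "num_verts G = n" "fact t < n"
        and e: "16 * \<gamma> * real n powr \<alpha> \<le> num_edges G" for G :: "'a pair_pre_digraph" and n
    proof -
      interpret pair_graph G by fact
      have n1: "1 \<le> real n" using n(2) by simp
      have cV: "card (pverts G) = n" using n(1) unfolding num_verts_def .
      have arcs: "16 * \<gamma> * real n powr \<alpha> \<le> card (parcs G)" using e arcs_le[OF G] by linarith
      moreover have "0 < 16 * \<gamma> * real n powr \<alpha>" using \<gamma>(1) n1 by simp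
      ultimately have "parcs G \<noteq> {}" by auto
      moreover have "parcs G \<subseteq> pverts G \<times> pverts G" using arc_fst_in_verts arc_snd_in_verts by force
      moreover have "(v, v) \<notin> parcs G" for v using pair_no_loops by force
      moreover have "(v, u) \<in> parcs G" if "(u, v) \<in> parcs G" for u v
        using that pair_sym_arcs unfolding symmetric_def by (auto dest: symD)
      ultimately obtain X Y E where XY: "X \<subseteq> pverts G" "Y \<subseteq> pverts G" "X \<inter> Y = {}" "E \<subseteq> X \<times> Y"
        "E \<subseteq> parcs G" "X \<noteq> {}" "card Y \<le> card X"
        "\<And>x. x \<in> X \<Longrightarrow> real (card (parcs G)) / (16 * card (pverts G)) \<le> card {y. (x, y) \<in> E}"
        "\<And>y. y \<in> Y \<Longrightarrow> real (card (parcs G)) / (16 * card (pverts G)) \<le> card {x. (x, y) \<in> E}"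
        using exists_bipartite_min_degree[OF pair_finite_verts, of "parcs G"] by metis
      \<comment> \<open>Passing to the bipartite subgraph divides by \<open>16 * n\<close>. The 16
        is absorbed by the choice \<open>16 * \<gamma>\<close> for \<open>\<beta>\<close>, and the
        factor \<open>n\<close> is the difference between the exponents \<open>\<alpha>\<close> and
        \<open>a\<close>.\<close>
      define d where "d = real (card (parcs G)) / (16 * n)"
      have "real n powr \<alpha> = real n powr a * real n" unfolding \<alpha>a using n1 by (simp add: powr_add)
      then have d: "\<gamma> * real n powr a \<le> d" unfolding d_def using arcs n1 by (simp add: field_simps)
      have fin: "finite X" "finite Y" 
        using finite_subset[OF XY(1) pair_finite_verts] finite_subset[OF XY(2) pair_finite_verts] .
      have "card X \<le> n" using card_mono[OF pair_finite_verts XY(1)] cV by simp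
      then have "has_compact_dense t r E"
        by (intro \<gamma>(2)[OF fin XY(3,4) _ _ XY(7) _ XY(6) d]) (use XY(8,9) in \<open>auto simp: d_def cV\<close>)
      then obtain H b where H: "finite H" "finite (\<Union>H)" "H \<subseteq> doubleton ` E" "b \<in> \<Union>H"
        "\<And>v. v \<in> \<Union>H \<Longrightarrow> near b H v" "(2 * t + 1) * card (\<Union>H) \<le> 2 * card H"
        "card (\<Union>H) \<le> r * (4 * t\<^sup>2 + 2 * t)"
        unfolding has_compact_dense_def by blast
      have HG: "H \<subseteq> doubleton ` parcs G" using H(3) XY(5) by blast
      obtain H' :: "'a pair_pre_digraph" where H': "pair_graph H'" "subgraph (with_proj H') (with_proj G)"
        "num_edges H' = card H" "num_verts H' = card (\<Union>H)" "radius H' \<le> 3"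
        using pair_graph_of_edges[OF G H(1,2) HG H(4,5)] by blast
      have pos: "0 < card (\<Union>H)" using H(2,4) by (auto simp: card_gt_0_iff)
      have "real ((2 * t + 1) * card (\<Union>H)) \<le> real (2 * card H)" using H(6) by (rule of_nat_mono)
      then have "2 * real t + 1 \<le> avg_degree H'"
        unfolding avg_degree_def H'(3,4) using pos by (simp add: field_simps)
      moreover have "radius H' \<le> ereal (real r + 1)"
        using H'(5) by (rule order.trans) (use r2 in simp)
      ultimately show ?thesis using H' H(7) by auto
    qed
    then show ?thesis unfolding \<alpha>_def[symmetric] by (intro exI[of _ "16 * \<gamma>"]) blast
  qed
qed

end
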